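(* Let $f:[0,1]\to\mathbb R$ be an arbitrary continuous and strictly concave function, and let $\Gamma_1,\Gamma_2,\Gamma_3,\ldots:I^2\to[0,1]$ be a sequence of graphons. (a) Suppose that $W\in\mathbf{ACC}_{\mathrm{w}^*}(\Gamma_1,\Gamma_2,\Gamma_3,\ldots)$ is not a cut-norm accumulation point of versions of the $\Gamma_n$, i.e., there are no versions $\Gamma_1',\Gamma_2',\Gamma_3',\ldots$ of $\Gamma_1,\Gamma_2,\Gamma_3,\ldots$ and no indices $n_1<n_2<\cdots$ with $\|\Gamma'_{n_i}-W\|_\square\to 0$ as $i\to\infty$. Then there exists $\widetilde W\in\mathbf{ACC}_{\mathrm{w}^*}(\Gamma_1,\Gamma_2,\Gamma_3,\ldots)$ such that $\mathrm{INT}_f(\widetilde W)<\mathrm{INT}_f(W)$. (b) There exist a subsequence $\Gamma_{k_1},\Gamma_{k_2},\Gamma_{k_3},\ldots$ and a graphon $W_{\min}\in\mathbf{ACC}_{\mathrm{w}^*}(\Gamma_{k_1},\Gamma_{k_2},\Gamma_{k_3},\ldots)$ such that $$\mathrm{INT}_f(W_{\min})=\inf\left\{\mathrm{INT}_f(W)\colon W\in\mathbf{ACC}_{\mathrm{w}^*}(\Gamma_{k_1},\Gamma_{k_2},\Gamma_{k_3},\ldots)\right\}.$$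
   Context: $I=[0,1]$ with Lebesgue measure. A graphon is a symmetric Lebesgue measurable function $I^2\to[0,1]$. A measurable $\gamma:I\to I$ is an almost-bijection if there are conull sets $J_1,J_2\subset I$ such that $\gamma|_{J_1}$ is a bijection of $J_1$ onto $J_2$; $\gamma^{-1}$ denotes $(\gamma|_{J_1})^{-1}$. A graphon $\Gamma'$ is a version of a graphon $\Gamma$ if there is a measure preserving almost-bijection $\gamma:I\to I$ with $\Gamma'(x,y)=\Gamma(\gamma^{-1}(x),\gamma^{-1}(y))$ for almost every $(x,y)\in I^2$. The weak$^*$ topology on graphons is that inherited from $L^\infty(I^2)=(L^1(I^2))^*$; equivalently, $W_n\to W$ weak$^*$ iff $\int_A\int_A W_n\to\int_A\int_A W$ for every measurable $A\subset I$. A weak$^*$ accumulation point of a sequence is a weak$^*$ limit of some subsequence. $\mathbf{ACC}_{\mathrm{w}^*}(\Gamma_1,\Gamma_2,\ldots)$ is the set of all $W:I^2\to[0,1]$ for which there exist versions $\Gamma'_1,\Gamma'_2,\ldots$ of $\Gamma_1,\Gamma_2,\ldots$ such that $W$ is a weak$^*$ accumulation point of $\Gamma'_1,\Gamma'_2,\ldots$ (such $W$ are graphons). The cut-norm is $\|U\|_\square=\sup_{A}\left|\int_A\int_A U(x,y)\right|$, the supremum over measurable $A\subset I$. For a graphon $W$, $\mathrm{INT}_f(W)=\int_{x\in I}\int_{y\in I}f(W(x,y))$. *)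

theory Defs
  imports "HOL-Analysis.Analysis"
begin

abbreviation unit_ivl :: "real set" where
  "unit_ivl \<equiv> {0..1}"

text \<open>Functions on the unit square are total functions on \<open>real \<times> real\<close>; only their values on
  \<open>unit_ivl \<times> unit_ivl\<close> matter.\<close>

definition graphon :: "(real \<times> real \<Rightarrow> real) \<Rightarrow> bool" where
  "graphon W \<longleftrightarrow>
     W \<in> borel_measurable (lebesgue_on (unit_ivl \<times> unit_ivl)) \<and>
     (\<forall>x\<in>unit_ivl. \<forall>y\<in>unit_ivl. W (x, y) \<in> {0..1} \<and> W (x, y) = W (y, x))"

text \<open>The conull sets are parameters, because the inverse of an almost-bijection
  is the inverse of its restriction to the first of them.\<close>

definition almost_bijection :: "(real \<Rightarrow> real) \<Rightarrow> real set \<Rightarrow> real set \<Rightarrow> bool" where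
  "almost_bijection \<gamma> J1 J2 \<longleftrightarrow>
     \<gamma> \<in> measurable (lebesgue_on unit_ivl) (lebesgue_on unit_ivl) \<and>
     J1 \<subseteq> unit_ivl \<and> negligible (unit_ivl - J1) \<and>
     J2 \<subseteq> unit_ivl \<and> negligible (unit_ivl - J2) \<and>
     bij_betw \<gamma> J1 J2"

definition measure_preserving :: "(real \<Rightarrow> real) \<Rightarrow> bool" where
  "measure_preserving \<gamma> \<longleftrightarrow>
     \<gamma> \<in> measurable (lebesgue_on unit_ivl) (lebesgue_on unit_ivl) \<and>
     distr (lebesgue_on unit_ivl) (lebesgue_on unit_ivl) \<gamma> = lebesgue_on unit_ivl"

definition version_of :: "(real \<times> real \<Rightarrow> real) \<Rightarrow> (real \<times> real \<Rightarrow> real) \<Rightarrow> bool" where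
  "version_of \<Gamma>' \<Gamma> \<longleftrightarrow> graphon \<Gamma>' \<and> graphon \<Gamma> \<and>
     (\<exists>\<gamma> J1 J2. almost_bijection \<gamma> J1 J2 \<and> measure_preserving \<gamma> \<and>
        (AE (x, y) in lebesgue_on (unit_ivl \<times> unit_ivl).
           \<Gamma>' (x, y) = \<Gamma> (inv_into J1 \<gamma> x, inv_into J1 \<gamma> y)))"

text \<open>Convergence in the weak-star topology of \<open>L\<^sup>\<infinity> = (L\<^sup>1)\<^sup>*\<close>, tested against all integrable functions
  on the unit square.\<close>

definition weak_star_converges ::
    "(nat \<Rightarrow> real \<times> real \<Rightarrow> real) \<Rightarrow> (real \<times> real \<Rightarrow> real) \<Rightarrow> bool" where
  "weak_star_converges U W \<longleftrightarrow>
     (\<forall>g. integrable (lebesgue_on (unit_ivl \<times> unit_ivl)) g \<longrightarrow>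
        (\<lambda>n. LINT z|lebesgue_on (unit_ivl \<times> unit_ivl). U n z * g z)
          \<longlonglongrightarrow> (LINT z|lebesgue_on (unit_ivl \<times> unit_ivl). W z * (g z :: real)))"

definition weak_star_acc_point ::
    "(nat \<Rightarrow> real \<times> real \<Rightarrow> real) \<Rightarrow> (real \<times> real \<Rightarrow> real) \<Rightarrow> bool" where
  "weak_star_acc_point U W \<longleftrightarrow> (\<exists>r. strict_mono r \<and> weak_star_converges (U \<circ> r) W)"

text \<open>A weak-star limit of graphons is determined only up to null sets; membership is restricted to
  the representatives that are symmetric and \<open>{0..1}\<close>-valued everywhere on the unit square.\<close>

definition ACC_weak_star :: "(nat \<Rightarrow> real \<times> real \<Rightarrow> real) \<Rightarrow> (real \<times> real \<Rightarrow> real) set" where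
  "ACC_weak_star \<Gamma> =
     {W. graphon W \<and>
         (\<exists>\<Gamma>'. (\<forall>n. version_of (\<Gamma>' n) (\<Gamma> n)) \<and> weak_star_acc_point \<Gamma>' W)}"

definition cut_norm :: "(real \<times> real \<Rightarrow> real) \<Rightarrow> real" where
  "cut_norm U =
     (SUP A \<in> sets (lebesgue_on unit_ivl). \<bar>LINT x:A|lebesgue. (LINT y:A|lebesgue. U (x, y))\<bar>)"

definition INT_f :: "(real \<Rightarrow> real) \<Rightarrow> (real \<times> real \<Rightarrow> real) \<Rightarrow> real" where
  "INT_f f W = (LINT x|lebesgue_on unit_ivl. (LINT y|lebesgue_on unit_ivl. f (W (x, y))))"

definition strictly_concave_on :: "real set \<Rightarrow> (real \<Rightarrow> real) \<Rightarrow> bool" where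
  "strictly_concave_on S f \<longleftrightarrow> convex S \<and>
     (\<forall>x\<in>S. \<forall>y\<in>S. \<forall>t. x \<noteq> y \<and> 0 < t \<and> t < 1 \<longrightarrow>
        (1 - t) * f x + t * f y < f ((1 - t) * x + t * y))"

end

theory Submission
  imports Defs "HOL-Library.Diagonal_Subsequence" "HOL-Combinatorics.Permutations"
begin

text \<open>Suppose versions \<open>U n\<close> of a subsequence converge weak-star to \<open>W\<close>, but sets \<open>A n\<close> witness that their
  cut-norm distance to \<open>W\<close> is at least \<open>e\<close>. Fix a dyadic partition so fine that \<open>W\<close> is close to its
  average over the cells, and rearrange each cell so that its part in \<open>A n\<close> comes first. A weak-star
  limit \<open>W'\<close> of the rearranged graphons has the same cell averages as \<open>W\<close>, but it stays at \<open>L\<^sup>1\<close>-distance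
  at least \<open>e / 2\<close> from them, as seen on the limiting set. A quantitative form of Jensen's inequality
  then pushes the energy of \<open>W'\<close> below that of \<open>W\<close> by an amount depending only on \<open>e\<close> and \<open>f\<close>. This is
  part (a).

  Because the gain is uniform, an accumulation point whose energy is close to the infimum is within
  \<open>e\<close> in cut norm of versions of a subsequence. Hence every sequence of graphons is totally bounded up to
  versions, and a diagonal argument yields a subsequence with a cut-norm limit \<open>W\<close>. Any accumulation point of
  that subsequence is a weak-star limit of versions of \<open>W\<close>, so by concavity its energy is at least
  that of \<open>W\<close>. This is part (b).

  All rearrangements are permutations of dyadic intervals; versions under arbitrary
  almost-bijections are \<open>L\<^sup>1\<close>-limits of versions under such permutations.\<close>

subsection \<open>Averages along a refining sequence of partitions\<close>

text \<open>The obstacle is that a weak-star limit tests against fixed functions only: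
  \<open>U n\<close> can tend to \<open>W\<close> while the discrepancy on the moving sets
  \<open>A n\<close> stays large. Rearranging inside the cells trades the moving sets for one fixed
  set on which the discrepancy survives the limit, and it cannot disturb the cell averages. The gain
  of energy comes from a compactness argument about \<open>f\<close> alone. It is therefore known
  before the partition is chosen, and the partition can be made fine enough to lose only half of it
  when \<open>W\<close> is replaced by its averages.

  A second obstacle is measurability. The inverse of an almost-bijection is only an
  \<open>inv_into\<close>, and the Lebesgue measure of the square is not the product of the Lebesgue
  measures of its sides. So the argument runs on Borel graphons over a product space, moved by
  everywhere invertible Borel maps, and null sets return only in the final translation. There the
  relation between a version and its graphon is read backwards, so that the measurable map is
  composed and its inverse disappears.\<close>

text \<open>The sets whose indicators satisfy \<open>P\<close> form a Dynkin system, so an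
  intersection-stable generator suffices; linearity and L1-closedness then reach all integrable
  functions. Limit statements about integrable functions thus need checking on cells only.\<close>

lemma integrable_closed_subspace_induct:
  fixes g :: "'a \<Rightarrow> real"
  assumes fin: "finite_measure M"
    and G: "Int_stable G" "G \<subseteq> sets M" "space M \<in> G" "sets M \<subseteq> sigma_sets (space M) G"
    and ind: "\<And>A. A \<in> G \<Longrightarrow> P (indicator A)"
    and lin: "\<And>u v a b. integrable M u \<Longrightarrow> integrable M v \<Longrightarrow> P u \<Longrightarrow> P v
                \<Longrightarrow> P (\<lambda>x. a * u x + b * v x)"
    and clo: "\<And>u s. integrable M u \<Longrightarrow> (\<And>n. integrable M (s n)) \<Longrightarrow> (\<And>n. P (s n)) \<Longrightarrow>
                (\<lambda>n. LINT x|M. \<bar>u x - s n x\<bar>) \<longlonglongrightarrow> 0 \<Longrightarrow> P u"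
    and g: "integrable M g"
  shows "P g"
proof -
  interpret finite_measure M by fact
  have int_ind: "integrable M (indicator A :: 'a \<Rightarrow> real)" if "A \<in> sets M" for A
    using that by (simp add: integrable_indicator_iff emeasure_finite less_top[symmetric])
  have sub: "sigma_sets (space M) G \<subseteq> sets M"
    using G(2) by (rule sets.sigma_sets_subset)
  have zero: "P (\<lambda>x. 0)"
    using lin[OF int_ind int_ind ind[OF G(3)] ind[OF G(3)], of 0 0] by simp
  \<comment> \<open>Dominated convergence turns pointwise limits into L1-limits. The factor 2 is the
    bound that \<open>integrable_induct\<close> provides for its approximating functions.\<close>
  have dom: "P u"
    if u: "integrable M u" and s: "\<And>n. integrable M (s n)" "\<And>n. P (s n)"
      and lim: "\<And>x. x \<in> space M \<Longrightarrow> (\<lambda>n. s n x) \<longlonglongrightarrow> u x"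
      and bd: "\<And>n x. x \<in> space M \<Longrightarrow> \<bar>s n x\<bar> \<le> 2 * \<bar>u x\<bar>" for u and s :: "nat \<Rightarrow> 'a \<Rightarrow> real"
  proof (rule clo[OF u s])
    have "(\<lambda>n. LINT x|M. \<bar>u x - s n x\<bar>) \<longlonglongrightarrow> (LINT x|M. 0)"
    proof (rule integral_dominated_convergence[where w = "\<lambda>x. 3 * \<bar>u x\<bar>"])
      show "AE x in M. (\<lambda>n. \<bar>u x - s n x\<bar>) \<longlonglongrightarrow> 0"
      proof (rule AE_I2)
        fix x assume "x \<in> space M"
        from tendsto_diff[OF tendsto_const[of "u x"] lim[OF this]]
        have "(\<lambda>n. u x - s n x) \<longlonglongrightarrow> 0" by simp
        then show "(\<lambda>n. \<bar>u x - s n x\<bar>) \<longlonglongrightarrow> 0" by (rule tendsto_rabs_zero)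
      qed
      show "AE x in M. norm \<bar>u x - s n x\<bar> \<le> 3 * \<bar>u x\<bar>" for n
        using bd[of _ n] by (intro AE_I2) (force simp: abs_le_iff)
    qed (use u s in auto)
    then show "(\<lambda>n. LINT x|M. \<bar>u x - s n x\<bar>) \<longlonglongrightarrow> 0" by simp
  qed
  have sets: "P (indicator A)" if A: "A \<in> sets M" for A
  proof -
    have "A \<in> sigma_sets (space M) G" using A G(4) by auto
    have "G \<subseteq> Pow (space M)" using G(2) sets.sets_into_space by blast
    from G(1) this \<open>A \<in> sigma_sets (space M) G\<close> show ?thesis
    proof (induction A rule: sigma_sets_induct_disjoint)
      case (basic A)
      then show ?case by (rule ind)
    next
      case empty
      then show ?case using zero by (simp add: indicator_def)
    next
      case (compl A)
      then have A: "A \<in> sets M" using sub by auto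
      have "indicator (space M - A) = (\<lambda>x. 1 * indicator (space M) x + (-1) * indicator A x :: real)"
        using sets.sets_into_space[OF A] by (auto simp: fun_eq_iff indicator_def)
      then show ?case
        using lin[OF int_ind int_ind ind[OF G(3)] compl.IH, of 1 "-1"] A by simp
    next
      case (union A)
      then have A: "\<And>i. A i \<in> sets M" using sub by auto
      \<comment> \<open>A countable disjoint union is an L1-limit of its finite partial unions,
        whose indicators are sums.\<close>
      have U: "P (indicator (\<Union>i<n. A i))" for n :: nat
      proof (induction n)
        case 0
        then show ?case using zero by (simp add: indicator_def)
      next
        case (Suc n)
        have "A n \<inter> (\<Union>i<n. A i) = {}"
          using union.hyps(1) by (auto simp: disjoint_family_on_def) (metis IntI empty_iff less_irrefl)
        then have "indicator (\<Union>i<Suc n. A i)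
            = (\<lambda>x. 1 * indicator (A n) x + 1 * indicator (\<Union>i<n. A i) x :: real)"
          by (auto simp: lessThan_Suc indicator_def fun_eq_iff)
        then show ?case using lin[OF int_ind int_ind union(3)[of n] Suc.IH, where a = 1 and b = 1] A by simp
      qed
      show ?case
      proof (rule dom[where s = "\<lambda>n. indicator (\<Union>i<n. A i)"])
        show "(\<lambda>n. indicator (\<Union>i<n. A i) x) \<longlonglongrightarrow> (indicator (\<Union> (range A)) x :: real)" for x
          by (rule LIMSEQ_indicator_UN)
        show "integrable M (indicator (\<Union> (range A)) :: 'a \<Rightarrow> real)"
          "integrable M (indicator (\<Union>i<n. A i) :: 'a \<Rightarrow> real)" for n
          using A by (auto intro!: int_ind)
      qed (use U in \<open>auto simp: indicator_def\<close>)
    qed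
  qed
  from g show ?thesis
  proof (induction rule: integrable_induct)
    case (base A c)
    have "P (\<lambda>x. c * indicator A x + 0 * indicator A x)"
      by (intro lin int_ind sets base)
    then show ?case by (simp add: mult.commute)
  next
    case (add u v)
    then show ?case using lin[of u v 1 1] by simp
  next
    case (lim u s)
    show ?case
      by (rule dom[where s = s]) (use lim in auto)
  qed
qed

text \<open>The intended instances are the dyadic partitions of \<open>[0,1]\<close> and of its square.\<close>

locale finite_filtration = finite_measure M for M :: "'a measure" +
  fixes c :: "nat \<Rightarrow> 'a \<Rightarrow> 'b"
  assumes mass_1: "measure M (space M) = 1"
    and c_meas [measurable]: "\<And>m. c m \<in> M \<rightarrow>\<^sub>M count_space UNIV"
    and c_fin: "\<And>m. finite (c m ` space M)"
    and c_ref: "\<And>m n x y. m \<le> n \<Longrightarrow> x \<in> space M \<Longrightarrow> y \<in> space M \<Longrightarrow> c n x = c n y \<Longrightarrow> c m x = c m y"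
    and c_gen: "sets M \<subseteq> sigma_sets (space M) {c m -` S \<inter> space M | m S. True}"
begin

definition cell :: "nat \<Rightarrow> 'b \<Rightarrow> 'a set" where
  "cell m k = c m -` {k} \<inter> space M"

text \<open>Null cells receive the value 0 through division by zero. Hence
  \<open>cavg_times_measure\<close> holds for every cell, while \<open>cexp_label_AE\<close> holds
  only almost everywhere.\<close>

definition cavg :: "nat \<Rightarrow> ('a \<Rightarrow> real) \<Rightarrow> 'b \<Rightarrow> real" where
  "cavg m u k = (LINT x|M. indicator (cell m k) x * u x) / measure M (cell m k)"

text \<open>The conditional expectation of \<open>u\<close> given the finite sigma-algebra of level
  \<open>m\<close>, in the version that is a function of the label.\<close>

definition cexp :: "nat \<Rightarrow> ('a \<Rightarrow> real) \<Rightarrow> 'a \<Rightarrow> real" where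
  "cexp m u x = cavg m u (c m x)"

lemma cell_sets [measurable, simp]: "cell m k \<in> sets M"
  unfolding cell_def by measurable

lemma label_set [measurable]: "c m -` S \<inter> space M \<in> sets M"
  by measurable

lemma cexp_meas [measurable]: "cexp m u \<in> borel_measurable M"
  unfolding cexp_def by (rule measurable_compose[OF c_meas]) simp

text \<open>A finer label determines the coarser one, so two label sets of different levels can both
  be described at the finer level.\<close>

lemma generators_Int_stable: "Int_stable {c m -` S \<inter> space M | m S. True}"
proof (rule Int_stableI, clarify)
  fix m n S T
  have *: "\<exists>k R. (c m -` S \<inter> space M) \<inter> (c n -` T \<inter> space M) = c k -` R \<inter> space M"
    if "m \<le> n" for m n S T
  proof (intro exI)
    show "(c m -` S \<inter> space M) \<inter> (c n -` T \<inter> space M)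
        = c n -` (T \<inter> c n ` (c m -` S \<inter> space M)) \<inter> space M"
      using c_ref[OF that] by auto
  qed
  show "\<exists>k R. (c m -` S \<inter> space M) \<inter> (c n -` T \<inter> space M) = c k -` R \<inter> space M \<and> True"
    using *[of m n S T] *[of n m T S] by (cases "m \<le> n") (auto simp: Int_commute)
qed

lemma closed_subspace_induct [consumes 1, case_names ind lin clo]:
  fixes g :: "'a \<Rightarrow> real"
  assumes "integrable M g"
    and "\<And>m S. P (indicator (c m -` S \<inter> space M))"
    and "\<And>u v a b. integrable M u \<Longrightarrow> integrable M v \<Longrightarrow> P u \<Longrightarrow> P v
                \<Longrightarrow> P (\<lambda>x. a * u x + b * v x)"
    and "\<And>u s. integrable M u \<Longrightarrow> (\<And>n. integrable M (s n)) \<Longrightarrow> (\<And>n. P (s n)) \<Longrightarrow>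
                (\<lambda>n. LINT x|M. \<bar>u x - s n x\<bar>) \<longlonglongrightarrow> 0 \<Longrightarrow> P u"
  shows "P g"
proof (rule integrable_closed_subspace_induct[OF finite_measure_axioms generators_Int_stable])
  show "space M \<in> {c m -` S \<inter> space M |m S. True}"
    by (auto intro!: exI[of _ UNIV])
  show "{c m -` S \<inter> space M |m S. True} \<subseteq> sets M"
    by auto
  show "P (indicator A)" if "A \<in> {c m -` S \<inter> space M |m S. True}" for A
    using that assms(2) by blast
qed (fact assms c_gen)+

lemma integrable_bounded [intro]:
  fixes u :: "'a \<Rightarrow> real"
  assumes "u \<in> borel_measurable M" "\<And>x. x \<in> space M \<Longrightarrow> \<bar>u x\<bar> \<le> B"
  shows "integrable M u"
  using assms by (intro integrable_const_bound[where B = B]) auto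

lemma integrable_cell [intro]:
  fixes u :: "'a \<Rightarrow> real"
  assumes "integrable M u" "A \<in> sets M"
  shows "integrable M (\<lambda>x. indicator A x * u x)"
  using integrable_mult_indicator[OF assms(2,1)] by simp

lemma integral_cells:
  fixes u :: "'a \<Rightarrow> real"
  assumes u: "integrable M u"
  shows "(LINT x|M. u x) = (\<Sum>k\<in>c m ` space M. (LINT x|M. indicator (cell m k) x * u x))"
proof -
  have "(LINT x|M. u x) = (LINT x|M. (\<Sum>k\<in>c m ` space M. indicator (cell m k) x * u x))"
  proof (rule Bochner_Integration.integral_cong[OF refl])
    fix x assume x: "x \<in> space M"
    have "(\<Sum>k\<in>c m ` space M. indicator (cell m k) x * u x)
        = (\<Sum>k\<in>c m ` space M. if k = c m x then u x else 0)"
      using x by (intro sum.cong) (auto simp: indicator_def cell_def)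
    then show "u x = (\<Sum>k\<in>c m ` space M. indicator (cell m k) x * u x)"
      using x by (simp add: c_fin)
  qed
  also have "\<dots> = (\<Sum>k\<in>c m ` space M. (LINT x|M. indicator (cell m k) x * u x))"
    using u by (intro Bochner_Integration.integral_sum) auto
  finally show ?thesis .
qed

lemma integrable_label [intro]:
  fixes g :: "'b \<Rightarrow> real"
  shows "integrable M (\<lambda>x. g (c m x))"
proof (rule integrable_bounded)
  show "\<bar>g (c m x)\<bar> \<le> Max ((\<lambda>k. \<bar>g k\<bar>) ` c m ` space M)" if "x \<in> space M" for x
    using that c_fin[of m] by (intro Max_ge) auto
qed (rule measurable_compose[OF c_meas], simp)

lemma integral_label_cell:
  "(LINT x|M. indicator (cell m k) x * g (c m x)) = g k * measure M (cell m k)"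
proof -
  have "(LINT x|M. indicator (cell m k) x * g (c m x)) = (LINT x|M. indicator (cell m k) x * g k)"
    by (intro Bochner_Integration.integral_cong) (auto simp: cell_def indicator_def)
  then show ?thesis by (simp add: mult.commute)
qed

lemma integral_label:
  fixes g :: "'b \<Rightarrow> real"
  shows "(LINT x|M. g (c m x)) = (\<Sum>k\<in>c m ` space M. g k * measure M (cell m k))"
  by (subst integral_cells[of _ m, OF integrable_label]) (simp add: integral_label_cell)

lemma integrable_cexp [intro]: "integrable M (cexp m u)"
  unfolding cexp_def by (rule integrable_label)

lemma null_cell_integral:
  assumes "measure M (cell m k) = 0"
  shows "(LINT x|M. indicator (cell m k) x * (u x :: real)) = 0"
proof -
  have "cell m k \<in> null_sets M" using assms by (intro null_setsI) (simp_all add: emeasure_eq_measure)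
  from AE_not_in[OF this] have "AE x in M. indicator (cell m k) x * u x = 0"
    by (rule eventually_mono) simp
  then show ?thesis by (rule integral_eq_zero_AE)
qed

lemma cavg_times_measure:
  "cavg m u k * measure M (cell m k) = (LINT x|M. indicator (cell m k) x * u x)"
  unfolding cavg_def using null_cell_integral[of m k u] by simp

lemma cavg_diff:
  assumes "integrable M u" "integrable M v"
  shows "cavg m (\<lambda>x. u x - v x) k = cavg m u k - cavg m v k"
  unfolding cavg_def
  by (simp add: right_diff_distrib diff_divide_distrib assms integrable_cell)

text \<open>On each cell the modulus of an integral is at most the integral of the modulus. This is
  what makes the functions satisfying \<open>cexp_tendsto\<close> a closed set in L1.\<close>

lemma cexp_contraction:
  assumes u: "integrable M u" and v: "integrable M v"
  shows "(LINT x|M. \<bar>cexp m u x - cexp m v x\<bar>) \<le> (LINT x|M. \<bar>u x - v x\<bar>)"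
proof -
  have d: "integrable M (\<lambda>x. u x - v x)" using u v by auto
  have "(LINT x|M. \<bar>cexp m u x - cexp m v x\<bar>)
      = (\<Sum>k\<in>c m ` space M. \<bar>cavg m u k - cavg m v k\<bar> * measure M (cell m k))"
    unfolding cexp_def by (rule integral_label)
  also have "\<dots> = (\<Sum>k\<in>c m ` space M. \<bar>LINT x|M. indicator (cell m k) x * (u x - v x)\<bar>)"
    unfolding cavg_times_measure[symmetric] cavg_diff[OF u v] by (simp add: abs_mult)
  also have "\<dots> \<le> (\<Sum>k\<in>c m ` space M. (LINT x|M. indicator (cell m k) x * \<bar>u x - v x\<bar>))"
  proof (rule sum_mono)
    fix k
    have "\<bar>LINT x|M. indicator (cell m k) x * (u x - v x)\<bar> \<le> (LINT x|M. \<bar>indicator (cell m k) x * (u x - v x)\<bar>)"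
      by (rule integral_abs_bound)
    then show "\<bar>LINT x|M. indicator (cell m k) x * (u x - v x)\<bar> \<le> (LINT x|M. indicator (cell m k) x * \<bar>u x - v x\<bar>)"
      by (simp add: abs_mult)
  qed
  also have "\<dots> = (LINT x|M. \<bar>u x - v x\<bar>)"
    by (rule integral_cells[symmetric]) (use d in auto)
  finally show ?thesis .
qed

text \<open>From level \<open>m\<close> on, a function of the label \<open>c m\<close> is constant
  on every cell, so averaging returns it except on the null cells.\<close>

lemma cexp_label_AE:
  assumes "m \<le> n"
  shows "AE x in M. cexp n (\<lambda>x. g (c m x)) x = g (c m x)"
proof -
  have "AE x in M. \<forall>k\<in>{k \<in> c n ` space M. measure M (cell n k) = 0}. x \<notin> cell n k"
  proof (rule AE_finite_allI)
    show "finite {k \<in> c n ` space M. measure M (cell n k) = 0}" using c_fin by auto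
    show "AE x in M. x \<notin> cell n k" if "k \<in> {k \<in> c n ` space M. measure M (cell n k) = 0}" for k
      using that by (intro AE_not_in null_setsI) (simp_all add: emeasure_eq_measure)
  qed
  then show ?thesis
  proof (rule AE_mp, intro AE_I2 impI)
    fix x assume x: "x \<in> space M" and H: "\<forall>k\<in>{k \<in> c n ` space M. measure M (cell n k) = 0}. x \<notin> cell n k"
    have pos: "measure M (cell n (c n x)) \<noteq> 0" using H x by (auto simp: cell_def)
    have "(LINT y|M. indicator (cell n (c n x)) y * g (c m y)) = (LINT y|M. indicator (cell n (c n x)) y * g (c m x))"
    proof (rule Bochner_Integration.integral_cong[OF refl])
      fix y assume "y \<in> space M"
      then have "c m y = c m x" if "c n y = c n x"
        using c_ref[OF assms _ x that] by simp
      then show "indicator (cell n (c n x)) y * g (c m y) = indicator (cell n (c n x)) y * g (c m x)"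
        by (cases "c n y = c n x") (simp_all add: cell_def indicator_def)
    qed
    then show "cexp n (\<lambda>x. g (c m x)) x = g (c m x)"
      unfolding cexp_def cavg_def using pos by simp
  qed
qed

text \<open>L1 martingale convergence. Indicators of label sets are eventually reproduced by
  averaging, and the contraction property carries convergence over to L1-limits.\<close>

lemma cexp_tendsto:
  assumes "integrable M u"
  shows "(\<lambda>m. LINT x|M. \<bar>u x - cexp m u x\<bar>) \<longlonglongrightarrow> 0"
  using assms
proof (induction rule: closed_subspace_induct)
  case (ind m S)
  have "(LINT x|M. \<bar>indicator (c m -` S \<inter> space M) x - cexp n (indicator (c m -` S \<inter> space M)) x\<bar>) = 0"
    if "m \<le> n" for n
  proof (rule integral_eq_zero_AE)
    have eq: "indicator (c m -` S \<inter> space M) x = (indicator S (c m x) :: real)" if "x \<in> space M" for x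
      using that by (auto simp: indicator_def)
    have "(LINT y|M. indicator (cell n k) y * (indicator (c m -` S \<inter> space M) y :: real))
        = (LINT y|M. indicator (cell n k) y * indicator S (c m y))" for k
      by (rule Bochner_Integration.integral_cong) (simp_all only: eq)
    then have ce: "cexp n (indicator (c m -` S \<inter> space M)) x = cexp n (\<lambda>x. indicator S (c m x)) x" for x
      unfolding cexp_def cavg_def by (simp only:)
    show "AE x in M. \<bar>indicator (c m -` S \<inter> space M) x - cexp n (indicator (c m -` S \<inter> space M)) x\<bar> = 0"
      using cexp_label_AE[OF that, of "indicator S"]
    proof (rule AE_mp, intro AE_I2 impI)
      fix x assume x: "x \<in> space M" and H: "cexp n (\<lambda>x. indicator S (c m x)) x = (indicator S (c m x) :: real)"
      show "\<bar>indicator (c m -` S \<inter> space M) x - cexp n (indicator (c m -` S \<inter> space M)) x\<bar> = 0"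
        unfolding ce eq[OF x] H by simp
    qed
  qed
  then show ?case
    by (intro tendsto_eventually) (auto simp: eventually_sequentially)
next
  case (lin u v a b)
  note iu = \<open>integrable M u\<close> and iv = \<open>integrable M v\<close>
  have ce: "cexp m (\<lambda>x. a * u x + b * v x) x = a * cexp m u x + b * cexp m v x" for m x
  proof -
    have "(LINT y|M. indicator (cell m k) y * (a * u y + b * v y))
      = a * (LINT y|M. indicator (cell m k) y * u y) + b * (LINT y|M. indicator (cell m k) y * v y)" for k
    proof -
      have "(LINT y|M. indicator (cell m k) y * (a * u y + b * v y))
        = (LINT y|M. a * (indicator (cell m k) y * u y) + b * (indicator (cell m k) y * v y))"
        by (simp add: algebra_simps)
      also have "\<dots> = a * (LINT y|M. indicator (cell m k) y * u y) + b * (LINT y|M. indicator (cell m k) y * v y)"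
        using iu iv by (subst Bochner_Integration.integral_add) (auto intro!: integrable_mult_right)
      finally show ?thesis .
    qed
    then show ?thesis unfolding cexp_def cavg_def by (simp add: add_divide_distrib)
  qed
  show ?case
  proof (rule tendsto_sandwich[OF always_eventually always_eventually tendsto_const])
    show "(\<lambda>m. \<bar>a\<bar> * (LINT x|M. \<bar>u x - cexp m u x\<bar>) + \<bar>b\<bar> * (LINT x|M. \<bar>v x - cexp m v x\<bar>)) \<longlonglongrightarrow> 0"
      using tendsto_add[OF tendsto_mult[OF tendsto_const[of "\<bar>a\<bar>"] lin.IH(1)] tendsto_mult[OF tendsto_const[of "\<bar>b\<bar>"] lin.IH(2)]] by simp
    show "\<forall>m. (LINT x|M. \<bar>(a * u x + b * v x) - cexp m (\<lambda>x. a * u x + b * v x) x\<bar>)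
      \<le> \<bar>a\<bar> * (LINT x|M. \<bar>u x - cexp m u x\<bar>) + \<bar>b\<bar> * (LINT x|M. \<bar>v x - cexp m v x\<bar>)"
    proof
      fix m
      have "(LINT x|M. \<bar>(a * u x + b * v x) - cexp m (\<lambda>x. a * u x + b * v x) x\<bar>)
        \<le> (LINT x|M. \<bar>a\<bar> * \<bar>u x - cexp m u x\<bar> + \<bar>b\<bar> * \<bar>v x - cexp m v x\<bar>)"
      proof (rule integral_mono)
        fix x
        have "\<bar>(a * u x + b * v x) - (a * cexp m u x + b * cexp m v x)\<bar>
            = \<bar>a * (u x - cexp m u x) + b * (v x - cexp m v x)\<bar>" by (simp add: algebra_simps)
        also have "\<dots> \<le> \<bar>a\<bar> * \<bar>u x - cexp m u x\<bar> + \<bar>b\<bar> * \<bar>v x - cexp m v x\<bar>"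
          by (metis abs_mult abs_triangle_ineq)
        finally show "\<bar>(a * u x + b * v x) - cexp m (\<lambda>x. a * u x + b * v x) x\<bar>
            \<le> \<bar>a\<bar> * \<bar>u x - cexp m u x\<bar> + \<bar>b\<bar> * \<bar>v x - cexp m v x\<bar>" by (simp add: ce)
      qed (use iu iv in \<open>auto intro!: integrable_abs Bochner_Integration.integrable_diff Bochner_Integration.integrable_add integrable_mult_right\<close>)
      also have "\<dots> = \<bar>a\<bar> * (LINT x|M. \<bar>u x - cexp m u x\<bar>) + \<bar>b\<bar> * (LINT x|M. \<bar>v x - cexp m v x\<bar>)"
        using iu iv by (subst Bochner_Integration.integral_add) (auto intro!: integrable_mult_right integrable_abs Bochner_Integration.integrable_diff)
      finally show "(LINT x|M. \<bar>(a * u x + b * v x) - cexp m (\<lambda>x. a * u x + b * v x) x\<bar>)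
      \<le> \<bar>a\<bar> * (LINT x|M. \<bar>u x - cexp m u x\<bar>) + \<bar>b\<bar> * (LINT x|M. \<bar>v x - cexp m v x\<bar>)" .
    qed
  qed auto
next
  case (clo u s)
  show ?case
  proof (rule LIMSEQ_I)
    fix e :: real assume e: "e > 0"
    obtain i where i: "(LINT x|M. \<bar>u x - s i x\<bar>) < e / 3"
      using order_tendstoD(2)[OF clo.hyps(3), of "e/3"] e by (auto simp: eventually_sequentially)
    obtain N where N: "\<And>m. m \<ge> N \<Longrightarrow> (LINT x|M. \<bar>s i x - cexp m (s i) x\<bar>) < e / 3"
      using order_tendstoD(2)[OF clo.IH[of i], of "e/3"] e by (auto simp: eventually_sequentially)
    have "norm ((LINT x|M. \<bar>u x - cexp m u x\<bar>) - 0) < e" if m: "m \<ge> N" for m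
    proof -
      note I = clo.hyps(1) clo.hyps(2)[of i] integrable_cexp
      have "(LINT x|M. \<bar>u x - cexp m u x\<bar>)
        \<le> (LINT x|M. \<bar>u x - s i x\<bar> + \<bar>s i x - cexp m (s i) x\<bar> + \<bar>cexp m (s i) x - cexp m u x\<bar>)"
        by (rule integral_mono) (use I in \<open>auto intro!: integrable_abs Bochner_Integration.integrable_diff Bochner_Integration.integrable_add\<close>)
      also have "\<dots> = (LINT x|M. \<bar>u x - s i x\<bar>) + (LINT x|M. \<bar>s i x - cexp m (s i) x\<bar>) + (LINT x|M. \<bar>cexp m (s i) x - cexp m u x\<bar>)"
        using I by (simp add: Bochner_Integration.integral_add integrable_abs)
      also have "\<dots> < e"
        using i N[OF m] cexp_contraction[OF I(2,1), of m] by (simp add: abs_minus_commute)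
      finally show ?thesis by (simp add: integral_nonneg_AE)
    qed
    then show "\<exists>no. \<forall>m\<ge>no. norm ((LINT x|M. \<bar>u x - cexp m u x\<bar>) - 0) < e" by blast
  qed
qed

end

subsection \<open>Weak-star compactness\<close>

text \<open>This and \<open>tendsto_approx\<close> serve the closure steps of the inductions: there
  the approximation error does not depend on the index of the sequence.\<close>

lemma convergent_approx:
  fixes a :: "nat \<Rightarrow> real"
  assumes "\<And>e. e > 0 \<Longrightarrow> \<exists>b. convergent b \<and> (\<forall>n. \<bar>a n - b n\<bar> \<le> e)"
  shows "convergent a"
proof -
  have "Cauchy a"
  proof (rule CauchyI)
    fix e :: real assume "e > 0"
    then obtain b where b: "convergent b" "\<And>n. \<bar>a n - b n\<bar> \<le> e / 4" using assms[of "e/4"] by auto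
    obtain N where N: "\<And>m n. m \<ge> N \<Longrightarrow> n \<ge> N \<Longrightarrow> norm (b m - b n) < e / 4"
      using CauchyD[OF convergent_Cauchy[OF b(1)], of "e/4"] \<open>e > 0\<close> by auto
    have "norm (a m - a n) < e" if "m \<ge> N" "n \<ge> N" for m n
      using N[OF that] b(2)[of m] b(2)[of n] unfolding real_norm_def by linarith
    then show "\<exists>N. \<forall>m\<ge>N. \<forall>n\<ge>N. norm (a m - a n) < e" by blast
  qed
  then show ?thesis by (rule Cauchy_convergent)
qed

lemma tendsto_approx:
  fixes a :: "nat \<Rightarrow> real"
  assumes "\<And>e. e > 0 \<Longrightarrow> \<exists>b L. b \<longlonglongrightarrow> L \<and> \<bar>l - L\<bar> \<le> e \<and> (\<forall>n. \<bar>a n - b n\<bar> \<le> e)"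
  shows "a \<longlonglongrightarrow> l"
proof (rule LIMSEQ_I)
  fix e :: real assume "e > 0"
  then obtain b L where b: "b \<longlonglongrightarrow> L" "\<bar>l - L\<bar> \<le> e / 4" "\<And>n. \<bar>a n - b n\<bar> \<le> e / 4"
    using assms[of "e/4"] by auto
  obtain N where N: "\<And>n. n \<ge> N \<Longrightarrow> norm (b n - L) < e / 4"
    using LIMSEQ_D[OF b(1), of "e/4"] \<open>e > 0\<close> by auto
  have "norm (a n - l) < e" if "n \<ge> N" for n
    using N[OF that] b(2) b(3)[of n] unfolding real_norm_def by linarith
  then show "\<exists>N. \<forall>n\<ge>N. norm (a n - l) < e" by blast
qed

lemma integral_bounded_diff:
  fixes u v w :: "'a \<Rightarrow> real"
  assumes "integrable M u" "integrable M v" "w \<in> borel_measurable M"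
    and "\<And>x. x \<in> space M \<Longrightarrow> \<bar>w x\<bar> \<le> 1"
  shows "\<bar>(LINT x|M. w x * u x) - (LINT x|M. w x * v x)\<bar> \<le> (LINT x|M. \<bar>u x - v x\<bar>)"
proof -
  have i: "integrable M (\<lambda>x. w x * h x)" if "integrable M h" for h :: "'a \<Rightarrow> real"
    using that by (rule Bochner_Integration.integrable_bound)
      (use assms that in \<open>auto intro!: mult_left_le_one_le simp: abs_mult\<close>)
  have "\<bar>(LINT x|M. w x * u x) - (LINT x|M. w x * v x)\<bar> = \<bar>LINT x|M. w x * (u x - v x)\<bar>"
    using i[OF assms(1)] i[OF assms(2)] by (simp add: right_diff_distrib)
  also have "\<dots> \<le> (LINT x|M. \<bar>w x * (u x - v x)\<bar>)" by (rule integral_abs_bound)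
  also have "\<dots> \<le> (LINT x|M. \<bar>u x - v x\<bar>)"
  proof (rule integral_mono)
    show "integrable M (\<lambda>x. \<bar>w x * (u x - v x)\<bar>)"
      by (intro integrable_abs i Bochner_Integration.integrable_diff assms)
    show "integrable M (\<lambda>x. \<bar>u x - v x\<bar>)"
      by (intro integrable_abs Bochner_Integration.integrable_diff assms)
  qed (use assms(4) in \<open>auto intro!: mult_left_le_one_le simp: abs_mult\<close>)
  finally show ?thesis .
qed

context finite_filtration
begin

text \<open>Each level has finitely many labels, so only finitely many sets \<open>S\<close> count
  there. Countability is what the diagonal argument in \<open>weak_compactness\<close>
  needs.\<close>

lemma countable_generators: "countable {c m -` S \<inter> space M | m S. True}"
proof -
  have "{c m -` S \<inter> space M | m S. True}
      \<subseteq> (\<Union>m. (\<lambda>S. c m -` S \<inter> space M) ` Pow (c m ` space M))"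
  proof clarify
    fix m S
    have "c m -` S \<inter> space M = c m -` (S \<inter> c m ` space M) \<inter> space M" by auto
    then show "c m -` S \<inter> space M \<in> (\<Union>m. (\<lambda>S. c m -` S \<inter> space M) ` Pow (c m ` space M))" by blast
  qed
  moreover have "countable \<dots>"
    by (rule countable_UN, simp, rule countable_finite, simp add: c_fin)
  ultimately show ?thesis by (rule countable_subset)
qed

lemma integrable_unit [intro]:
  fixes u :: "'a \<Rightarrow> real"
  assumes "u \<in> borel_measurable M" "\<And>x. x \<in> space M \<Longrightarrow> u x \<in> {0..1}"
  shows "integrable M u"
  using assms by (intro integrable_bounded[of _ 1]) fastforce+

lemma integrable_unit_mult [intro]:
  fixes u :: "'a \<Rightarrow> real"
  assumes "u \<in> borel_measurable M" "\<And>x. x \<in> space M \<Longrightarrow> u x \<in> {0..1}" "integrable M g"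
  shows "integrable M (\<lambda>x. u x * g x)"
  using assms(3) by (rule Bochner_Integration.integrable_bound)
      (use assms in \<open>auto intro!: mult_left_le_one_le simp: abs_mult\<close>)

lemma integrable_ind: "A \<in> sets M \<Longrightarrow> integrable M (indicator A :: 'a \<Rightarrow> real)"
  by (intro integrable_bounded[of _ 1]) auto

text \<open>Domination by the measure does three things: it gives continuity at the empty set, hence
  countable additivity; it gives absolute continuity, hence a Radon-Nikodym density; and it bounds
  that density by 1 almost everywhere.\<close>

lemma density_of_dominated_functional:
  fixes F :: "'a set \<Rightarrow> real"
  assumes nn: "\<And>A. A \<in> sets M \<Longrightarrow> 0 \<le> F A" and le: "\<And>A. A \<in> sets M \<Longrightarrow> F A \<le> measure M A"
    and add: "\<And>A B. A \<in> sets M \<Longrightarrow> B \<in> sets M \<Longrightarrow> A \<inter> B = {} \<Longrightarrow> F (A \<union> B) = F A + F B"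
  shows "\<exists>W. W \<in> borel_measurable M \<and> (\<forall>x. W x \<in> {0..1}) \<and>
           (\<forall>A\<in>sets M. F A = (LINT x|M. W x * indicator A x))"
proof -
  define N where "N = measure_of (space M) (sets M) (\<lambda>A. ennreal (F A))"
  have F0: "F {} = 0" using add[of "{}" "{}"] by simp
  have pos: "positive (sets M) (\<lambda>A. ennreal (F A))" by (simp add: positive_def F0)
  have ca: "countably_additive (sets M) (\<lambda>A. ennreal (F A))"
  proof (rule sets.empty_continuous_imp_countably_additive[OF pos])
    show "additive (sets M) (\<lambda>A. ennreal (F A))"
      unfolding additive_def using add nn by (simp add: ennreal_plus[symmetric] del: ennreal_plus)
    fix A :: "nat \<Rightarrow> 'a set" assume A: "range A \<subseteq> sets M" "decseq A" "(\<Inter>i. A i) = {}"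
    have "(\<lambda>i. measure M (A i)) \<longlonglongrightarrow> 0"
      using finite_Lim_measure_decseq[OF A(1,2)] A(3) by simp
    then have "(\<lambda>i. F (A i)) \<longlonglongrightarrow> 0"
      by (rule tendsto_sandwich[OF _ _ tendsto_const, rotated 2])
        (use A nn le in \<open>auto intro!: always_eventually\<close>)
    then show "(\<lambda>i. ennreal (F (A i))) \<longlonglongrightarrow> 0"
      using tendsto_ennrealI by fastforce
  qed simp
  have sN: "sets N = sets M" "space N = space M" unfolding N_def by simp_all
  have eN: "emeasure N A = ennreal (F A)" if "A \<in> sets M" for A
    unfolding N_def using that pos ca
    by (intro emeasure_measure_of_sigma) (auto simp: sets.sigma_algebra_axioms)
  have "absolutely_continuous M N"
    unfolding absolutely_continuous_def
  proof
    fix A assume "A \<in> null_sets M"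
    then have A: "A \<in> sets M" "measure M A = 0" by (auto simp: measure_eq_0_null_sets)
    then show "A \<in> null_sets N" using nn[of A] le[of A] eN[of A] sN by (auto intro!: null_setsI)
  qed
  from Radon_Nikodym[OF this sN(1)] obtain w0 where w0 [measurable]: "w0 \<in> borel_measurable M" and dens: "density M w0 = N"
    by auto
  define w where "w x = enn2real (w0 x)" for x
  have wm [measurable]: "w \<in> borel_measurable M" unfolding w_def by measurable
  have nni: "(\<integral>\<^sup>+x. w0 x * indicator A x \<partial>M) = ennreal (F A)" if "A \<in> sets M" for A
    using eN[OF that] that by (simp add: dens[symmetric] emeasure_density)
  have fin: "AE x in M. w0 x \<noteq> \<infinity>"
  proof (rule nn_integral_PInf_AE)
    have "(\<integral>\<^sup>+x. w0 x \<partial>M) = (\<integral>\<^sup>+x. w0 x * indicator (space M) x \<partial>M)"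
      by (rule nn_integral_cong) simp
    then show "(\<integral>\<^sup>+x. w0 x \<partial>M) \<noteq> \<infinity>" using nni[of "space M"] by simp
  qed simp
  have nnw: "(\<integral>\<^sup>+x. ennreal (w x * indicator A x) \<partial>M) = ennreal (F A)" if "A \<in> sets M" for A
  proof -
    have "(\<integral>\<^sup>+x. ennreal (w x * indicator A x) \<partial>M) = (\<integral>\<^sup>+x. w0 x * indicator A x \<partial>M)"
      by (rule nn_integral_cong_AE, rule AE_mp[OF fin])
        (auto simp: w_def indicator_def less_top intro!: AE_I2)
    then show ?thesis using nni[OF that] by simp
  qed
  have wi: "integrable M (\<lambda>x. w x * indicator A x)" if "A \<in> sets M" for A
    using that nnw[OF that] by (intro integrableI_nonneg) (auto simp: w_def)
  have wA: "(LINT x|M. w x * indicator A x) = F A" if "A \<in> sets M" for A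
  proof -
    have "ennreal (LINT x|M. w x * indicator A x) = ennreal (F A)"
      using nn_integral_eq_integral[OF wi[OF that]] nnw[OF that] by (simp add: w_def)
    then show ?thesis using nn[OF that]
      by (subst (asm) ennreal_inj) (auto intro!: integral_nonneg_AE simp: w_def)
  qed
  have w1: "AE x in M. w x \<le> 1"
  proof -
    \<comment> \<open>On this set \<open>w - 1\<close> is positive, but its integral is
      \<open>F A - measure M A\<close>, which is at most 0; so the set is null.\<close>
    define A where "A = {x\<in>space M. w x > 1}"
    have A: "A \<in> sets M" unfolding A_def by measurable
    have iA: "integrable M (\<lambda>x. w x * indicator A x - indicator A x)"
      by (intro Bochner_Integration.integrable_diff wi integrable_ind A)
    have "(LINT x|M. w x * indicator A x - indicator A x) = F A - measure M A"
      using wA[OF A] A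
      by (subst Bochner_Integration.integral_diff[OF wi[OF A] integrable_ind[OF A]])
        (simp add: Int_absorb2 sets.sets_into_space)
    also have "\<dots> \<le> 0" using le[OF A] by simp
    finally have "(LINT x|M. w x * indicator A x - indicator A x) = 0"
      by (intro antisym integral_nonneg_AE) (auto simp: A_def indicator_def)
    then have "AE x in M. w x * indicator A x - indicator A x = 0"
      by (subst (asm) integral_nonneg_eq_0_iff_AE[OF iA]) (auto simp: A_def indicator_def)
    then show ?thesis
      by (rule AE_mp) (auto simp: A_def indicator_def not_less intro!: AE_I2)
  qed
  \<comment> \<open>Truncation changes \<open>w\<close> on a null set only and makes the bound hold
    everywhere.\<close>
  define W where "W x = min 1 (w x)" for x
  show ?thesis
  proof (intro exI conjI ballI allI)
    show "W \<in> borel_measurable M" unfolding W_def by measurable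
    show "W x \<in> {0..1}" for x by (auto simp: W_def w_def)
    fix A assume A: "A \<in> sets M"
    have "(LINT x|M. W x * indicator A x) = (LINT x|M. w x * indicator A x)"
      by (rule integral_cong_AE, use A in \<open>simp_all add: W_def\<close>)
        (use w1 in eventually_elim, simp)
    then show "F A = (LINT x|M. W x * indicator A x)" using wA[OF A] by simp
  qed
qed

text \<open>Sequential Banach-Alaoglu. A diagonal subsequence converges against the countably many
  label sets, hence against all of L1. The limits on indicators are additive and dominated by the
  measure, so they have a density, and a second induction identifies all the limits with it.\<close>

lemma weak_compactness:
  fixes U :: "nat \<Rightarrow> 'a \<Rightarrow> real"
  assumes Um: "\<And>n. U n \<in> borel_measurable M" and U01: "\<And>n x. x \<in> space M \<Longrightarrow> U n x \<in> {0..1}"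
  shows "\<exists>r W. strict_mono r \<and> W \<in> borel_measurable M \<and> (\<forall>x. W x \<in> {0..1}) \<and>
    (\<forall>g. integrable M g \<longrightarrow> (\<lambda>n. LINT x|M. U (r n) x * g x) \<longlonglongrightarrow> (LINT x|M. W x * g x))"
proof -
  let ?G = "{c m -` S \<inter> space M | m S. True}"
  define B where "B = from_nat_into ?G"
  have GM: "?G \<subseteq> sets M" by auto
  have rB: "range B = ?G"
    unfolding B_def by (rule range_from_nat_into) (use countable_generators in auto)
  have iu: "integrable M (\<lambda>x. U n x * g x)" if "integrable M g" for n g
    using that Um U01 by auto
  note ii = integrable_ind
  have range: "(LINT x|M. U n x * indicator A x) \<in> {0..measure M A}" if A: "A \<in> sets M" for n A
  proof -
    have "(LINT x|M. U n x * indicator A x) \<le> (LINT x|M. indicator A x)"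
      using U01 by (intro integral_mono iu ii A) (auto simp: indicator_def)
    moreover have "0 \<le> (LINT x|M. U n x * indicator A x)"
      using U01 by (intro integral_nonneg_AE AE_I2) (auto simp: indicator_def)
    ultimately show ?thesis using A by (simp add: Int_absorb2 sets.sets_into_space)
  qed
  interpret subseqs "\<lambda>n s. convergent (\<lambda>l. LINT x|M. U (s l) x * indicator (B n) x)"
  proof
    fix n and s :: "nat \<Rightarrow> nat"
    have Bn: "B n \<in> sets M" using subsetD[OF GM, of "B n"] rangeI[of B n] rB by simp
    have "\<exists>l\<in>{0..measure M (B n)}. \<exists>r. strict_mono r \<and> ((\<lambda>l. LINT x|M. U (s l) x * indicator (B n) x) \<circ> r) \<longlonglongrightarrow> l"
      by (rule compact_Icc[unfolded compact_def, rule_format]) (rule range[OF Bn])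
    then show "\<exists>r. strict_mono r \<and> convergent (\<lambda>l. LINT x|M. U ((s \<circ> r) l) x * indicator (B n) x)"
      by (auto simp: convergent_def o_def)
  qed
  define r where "r = diagseq"
  have cB: "convergent (\<lambda>l. LINT x|M. U (r l) x * indicator (B k) x)" for k
  proof -
    \<comment> \<open>Only from index \<open>Suc k\<close> on is the diagonal sequence a subsequence
      of the one chosen for \<open>B k\<close>; the shift is removed afterwards.\<close>
    have "convergent (\<lambda>l. LINT x|M. U ((diagseq \<circ> ((+) (Suc k))) l) x * indicator (B k) x)"
    proof (rule diagseq_holds)
      fix t s :: "nat \<Rightarrow> nat" and n
      assume "strict_mono t" "convergent (\<lambda>l. LINT x|M. U (s l) x * indicator (B n) x)"
      then show "convergent (\<lambda>l. LINT x|M. U ((s \<circ> t) l) x * indicator (B n) x)"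
        using convergent_subseq_convergent[of "\<lambda>l. LINT x|M. U (s l) x * indicator (B n) x" t]
        by (simp add: o_def)
    qed
    then have "convergent (\<lambda>l. LINT x|M. U (r (l + Suc k)) x * indicator (B k) x)"
      by (simp only: r_def o_apply add.commute[of "Suc k"])
    then show ?thesis
      by (rule convergent_ignore_initial_segment[THEN iffD1, where f1 = "\<lambda>l. LINT x|M. U (r l) x * indicator (B k) x"])
  qed
  have conv: "convergent (\<lambda>l. LINT x|M. U (r l) x * g x)" if "integrable M g" for g
    using that
  proof (induction rule: closed_subspace_induct)
    case (ind m S)
    then obtain k where "B k = c m -` S \<inter> space M" using rB by (metis (mono_tags, lifting) mem_Collect_eq rangeE)
    then show ?case using cB[of k] by simp
  next
    case (lin u v a b)
    have "(LINT x|M. U (r l) x * (a * u x + b * v x))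
        = a * (LINT x|M. U (r l) x * u x) + b * (LINT x|M. U (r l) x * v x)" for l
      using iu[OF lin.hyps(1), of "r l"] iu[OF lin.hyps(2), of "r l"]
      by (simp add: distrib_left mult.left_commute)
    then show ?case using lin.IH by (simp add: convergent_add convergent_mult convergent_const)
  next
    case (clo u s)
    show ?case
    proof (rule convergent_approx)
      fix e :: real assume "e > 0"
      then obtain i where "(LINT x|M. \<bar>u x - s i x\<bar>) < e"
        using order_tendstoD(2)[OF clo.hyps(3), of "e"] by (auto simp: eventually_sequentially)
      moreover have "\<bar>(LINT x|M. U (r n) x * u x) - (LINT x|M. U (r n) x * s i x)\<bar> \<le> (LINT x|M. \<bar>u x - s i x\<bar>)" for n
        using clo.hyps U01 Um by (intro integral_bounded_diff) (auto simp: abs_le_iff intro: order_trans[of _ 0])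
      ultimately show "\<exists>b. convergent b \<and> (\<forall>n. \<bar>(LINT x|M. U (r n) x * u x) - b n\<bar> \<le> e)"
        using clo.IH[of i] by (intro exI[of _ "\<lambda>n. LINT x|M. U (r n) x * s i x"]) (auto intro: order_trans less_imp_le)
    qed
  qed
  define F where "F A = lim (\<lambda>l. LINT x|M. U (r l) x * indicator A x)" for A
  have F: "(\<lambda>l. LINT x|M. U (r l) x * indicator A x) \<longlonglongrightarrow> F A" if "A \<in> sets M" for A
    unfolding F_def using conv[OF ii[OF that]] by (simp add: convergent_LIMSEQ_iff)
  have "\<exists>W. W \<in> borel_measurable M \<and> (\<forall>x. W x \<in> {0..1}) \<and>
           (\<forall>A\<in>sets M. F A = (LINT x|M. W x * indicator A x))"
  proof (rule density_of_dominated_functional)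
    fix A assume A: "A \<in> sets M"
    show "0 \<le> F A" using LIMSEQ_le_const[OF F[OF A]] range[OF A] by auto
    show "F A \<le> measure M A" using LIMSEQ_le_const2[OF F[OF A]] range[OF A] by auto
  next
    fix A B assume A: "A \<in> sets M" and B: "B \<in> sets M" and d: "A \<inter> B = {}"
    have "(LINT x|M. U (r l) x * indicator (A \<union> B) x)
        = (LINT x|M. U (r l) x * indicator A x) + (LINT x|M. U (r l) x * indicator B x)" for l
      using iu[OF ii[OF A], of "r l"] iu[OF ii[OF B], of "r l"]
      by (simp add: indicator_add[OF d, symmetric] distrib_left)
    then show "F (A \<union> B) = F A + F B"
      using tendsto_add[OF F[OF A] F[OF B]] F[of "A \<union> B"] A B by (auto intro: LIMSEQ_unique)
  qed
  then obtain W where W: "W \<in> borel_measurable M" "\<And>x. W x \<in> {0..1}"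
      and WF: "\<And>A. A \<in> sets M \<Longrightarrow> F A = (LINT x|M. W x * indicator A x)" by blast
  have "(\<lambda>l. LINT x|M. U (r l) x * g x) \<longlonglongrightarrow> (LINT x|M. W x * g x)" if "integrable M g" for g
    using that
  proof (induction rule: closed_subspace_induct)
    case (ind m S)
    then show ?case using F[of "c m -` S \<inter> space M"] WF[of "c m -` S \<inter> space M"] by simp
  next
    case (lin u v a b)
    have *: "(LINT x|M. V x * (a * u x + b * v x)) = a * (LINT x|M. V x * u x) + b * (LINT x|M. V x * v x)"
      if "V \<in> borel_measurable M" "\<And>x. x \<in> space M \<Longrightarrow> V x \<in> {0..1}" for V
      using integrable_unit_mult[OF that lin.hyps(1)] integrable_unit_mult[OF that lin.hyps(2)]
      by (simp add: distrib_left mult.left_commute)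
    have 1: "(LINT x|M. U (r l) x * (a * u x + b * v x))
        = a * (LINT x|M. U (r l) x * u x) + b * (LINT x|M. U (r l) x * v x)" for l
      using Um U01 by (rule *)
    have 2: "(LINT x|M. W x * (a * u x + b * v x)) = a * (LINT x|M. W x * u x) + b * (LINT x|M. W x * v x)"
      using W by (rule *)
    show ?case
      unfolding 1 2 by (intro tendsto_intros lin.IH)
  next
    case (clo u s)
    show ?case
    proof (rule tendsto_approx)
      fix e :: real assume "e > 0"
      then obtain i where i: "(LINT x|M. \<bar>u x - s i x\<bar>) < e"
        using order_tendstoD(2)[OF clo.hyps(3), of "e"] by (auto simp: eventually_sequentially)
      have *: "\<bar>(LINT x|M. V x * u x) - (LINT x|M. V x * s i x)\<bar> \<le> e"
        if "V \<in> borel_measurable M" "\<And>x. x \<in> space M \<Longrightarrow> V x \<in> {0..1}" for V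
      proof -
        have "\<bar>(LINT x|M. V x * u x) - (LINT x|M. V x * s i x)\<bar> \<le> (LINT x|M. \<bar>u x - s i x\<bar>)"
          using clo.hyps that by (intro integral_bounded_diff) (auto simp: abs_le_iff intro: order_trans[of _ 0])
        then show ?thesis using i by simp
      qed
      show "\<exists>b L. b \<longlonglongrightarrow> L \<and> \<bar>(LINT x|M. W x * u x) - L\<bar> \<le> e \<and> (\<forall>n. \<bar>(LINT x|M. U (r n) x * u x) - b n\<bar> \<le> e)"
        using clo.IH[of i] *[OF W] *[OF Um U01] by blast
    qed
  qed
  then show ?thesis using W subseq_diagseq unfolding r_def by blast
qed

end

subsection \<open>Strict concavity and averaging\<close>

locale strictly_concave_unit =
  fixes f :: "real \<Rightarrow> real"
  assumes f_cont: "continuous_on {0..1} f"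
    and f_concave: "strictly_concave_on {0..1} f"
begin

text \<open>Only interior points are treated, because at an endpoint the slope may be infinite, as
  for the square root at 0.\<close>

lemma supporting_slope:
  assumes a: "a \<in> {0<..<1}"
  shows "\<exists>s. \<forall>x\<in>{0..1}. f x \<le> f a + s * (x - a)"
proof -
  have cv: "convex_on {0..1} (\<lambda>x. - f x)"
  proof (rule convex_onI)
    fix t x y :: real assume t: "0 < t" "t < 1" and x: "x \<in> {0..1}" and y: "y \<in> {0..1}"
    show "- f ((1 - t) *\<^sub>R x + t *\<^sub>R y) \<le> (1 - t) * - f x + t * - f y"
    proof (cases "x = y")
      case True
      then show ?thesis by (simp add: algebra_simps)
    next
      case False
      then have "(1 - t) * f x + t * f y < f ((1 - t) * x + t * y)"
        using f_concave t x y unfolding strictly_concave_on_def by blast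
      then show ?thesis by simp
    qed
  qed simp
  have "a \<in> interior {0..1}" using a by (simp add: interior_atLeastAtMost_real)
  from convex_le_Inf_differential[OF cv this] obtain s where
    s: "\<And>x. x \<in> {0..1} \<Longrightarrow> - f x \<ge> - f a + s * (x - a)" by blast
  show ?thesis
    by (rule exI[of _ "- s"]) (use s in force)
qed

text \<open>The midpoint defect of \<open>f\<close> is continuous and strictly positive on the
  compact set of pairs at distance at least \<open>\<eta>\<close>, so it has a positive minimum
  there.\<close>

lemma midpoint_gap:
  assumes "\<eta> > 0"
  shows "\<exists>\<kappa>>0. \<forall>x\<in>{0..1}. \<forall>y\<in>{0..1}. \<eta> \<le> \<bar>x - y\<bar> \<longrightarrow> (f x + f y) / 2 + \<kappa> \<le> f ((x + y) / 2)"
proof -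
  define K where "K = {p \<in> {0..1} \<times> {0..1::real}. \<eta> \<le> \<bar>fst p - snd p\<bar>}"
  define h where "h p = f ((fst p + snd p) / 2) - (f (fst p) + f (snd p)) / 2" for p
  have "closed {p :: real \<times> real. \<eta> \<le> \<bar>fst p - snd p\<bar>}"
    by (intro closed_Collect_le continuous_intros)
  moreover have "K = ({0..1} \<times> {0..1}) \<inter> {p. \<eta> \<le> \<bar>fst p - snd p\<bar>}" unfolding K_def by auto
  ultimately have K: "compact K" by (simp add: compact_Times compact_Int_closed)
  have h: "continuous_on K h"
    unfolding h_def K_def
    by (intro continuous_intros continuous_on_compose2[OF f_cont]) auto
  have pos: "h p > 0" if "p \<in> K" for p
  proof -
    have "fst p \<in> {0..1}" "snd p \<in> {0..1}" "fst p \<noteq> snd p" using that assms by (auto simp: K_def)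
    then have "(1 - 1/2) * f (fst p) + (1/2) * f (snd p) < f ((1 - 1/2) * fst p + (1/2) * snd p)"
      using f_concave[unfolded strictly_concave_on_def, THEN conjunct2, rule_format, of "fst p" "snd p" "1/2"] by simp
    moreover have "(1 - 1/2) * fst p + (1/2) * snd p = (fst p + snd p) / 2" by simp
    ultimately show ?thesis unfolding h_def by (simp add: field_simps)
  qed
  show ?thesis
  proof (cases "K = {}")
    case True
    then have "\<not> \<eta> \<le> \<bar>x - y\<bar>" if "x \<in> {0..1}" "y \<in> {0..1}" for x y using that unfolding K_def by force
    \<comment> \<open>If \<open>\<eta>\<close> exceeds 1 no pair qualifies, and any positive
      constant will do.\<close>
    then show ?thesis by (intro exI[of _ 1]) auto
  next
    case False
    from continuous_attains_inf[OF K this h] obtain q where q: "q \<in> K" "\<And>p. p \<in> K \<Longrightarrow> h q \<le> h p" by blast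
    have "(f x + f y) / 2 + h q \<le> f ((x + y) / 2)" if "x \<in> {0..1}" "y \<in> {0..1}" "\<eta> \<le> \<bar>x - y\<bar>" for x y
      using q(2)[of "(x, y)"] that by (simp add: K_def h_def)
    then show ?thesis using pos[OF q(1)] by blast
  qed
qed

text \<open>The correction is affine in the distance to \<open>a\<close>, so that its integral
  involves only the L1-distance to the average. Where the distance is below \<open>\<eta>\<close>
  the correction has the harmless sign and the supporting line is enough.\<close>

lemma concavity_gap:
  assumes "\<eta> > 0"
  shows "\<exists>\<kappa>>0. \<forall>a\<in>{0<..<1}. \<exists>s. \<forall>x\<in>{0..1}. f x \<le> f a + s * (x - a) - \<kappa> * (\<bar>x - a\<bar> - \<eta>)"
proof -
  from midpoint_gap[OF assms] obtain k where k: "k > 0"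
    and gap: "\<And>x y. x \<in> {0..1} \<Longrightarrow> y \<in> {0..1} \<Longrightarrow> \<eta> \<le> \<bar>x - y\<bar> \<Longrightarrow> (f x + f y) / 2 + k \<le> f ((x + y) / 2)"
    by blast
  \<comment> \<open>Solving the midpoint inequality for \<open>f x\<close> doubles the gap
    \<open>k\<close>, with the midpoint value bounded by the supporting line. Distances are at most
    1, so \<open>2 * k\<close> covers the asserted correction.\<close>
  have "\<exists>s. \<forall>x\<in>{0..1}. f x \<le> f a + s * (x - a) - 2 * k * (\<bar>x - a\<bar> - \<eta>)" if a: "a \<in> {0<..<1}" for a
  proof -
    from supporting_slope[OF a] obtain s where s: "\<And>x. x \<in> {0..1} \<Longrightarrow> f x \<le> f a + s * (x - a)" by blast
    have "f x \<le> f a + s * (x - a) - 2 * k * (\<bar>x - a\<bar> - \<eta>)" if x: "x \<in> {0..1}" for x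
    proof (cases "\<eta> \<le> \<bar>x - a\<bar>")
      case True
      have "(f x + f a) / 2 + k \<le> f ((x + a) / 2)" using gap[OF x _ True] a by simp
      also have "\<dots> \<le> f a + s * ((x + a) / 2 - a)" using s[of "(x + a) / 2"] x a by simp
      also have "(x + a) / 2 - a = (x - a) / 2" by (simp add: field_simps)
      finally have "f x \<le> f a + s * (x - a) - 2 * k" by (simp add: field_simps)
      moreover have "\<bar>x - a\<bar> - \<eta> \<le> 1" using x a assms by auto
      then have "2 * k * (\<bar>x - a\<bar> - \<eta>) \<le> 2 * k * 1" using k by (intro mult_left_mono) auto
      ultimately show ?thesis by simp
    next
      case False
      then have "2 * k * (\<bar>x - a\<bar> - \<eta>) \<le> 0" using k by (simp add: mult_nonneg_nonpos)
      then show ?thesis using s[OF x] by simp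
    qed
    then show ?thesis by blast
  qed
  then show ?thesis using k by (intro exI[of _ "2 * k"]) auto
qed

lemma f_bounded: "\<exists>B\<ge>0. \<forall>x\<in>{0..1}. \<bar>f x\<bar> \<le> B"
proof -
  have "bounded (f ` {0..1})"
    by (intro compact_imp_bounded compact_continuous_image f_cont) simp
  then show ?thesis unfolding bounded_pos by (auto intro: less_imp_le)
qed

text \<open>Uniform continuity handles close points and boundedness the others. This form turns
  L1-closeness of functions into closeness of their energies although \<open>f\<close> may have no
  Lipschitz constant.\<close>

lemma f_Lipschitz_up_to:
  assumes "e > 0"
  shows "\<exists>C\<ge>0. \<forall>x\<in>{0..1}. \<forall>y\<in>{0..1}. \<bar>f x - f y\<bar> \<le> e + C * \<bar>x - y\<bar>"
proof -
  obtain B where B: "B \<ge> 0" "\<And>x. x \<in> {0..1} \<Longrightarrow> \<bar>f x\<bar> \<le> B" using f_bounded by blast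
  have "uniformly_continuous_on {0..1} f"
    by (rule compact_uniformly_continuous[OF f_cont]) simp
  then obtain d where d: "d > 0" "\<And>x y. x \<in> {0..1} \<Longrightarrow> y \<in> {0..1} \<Longrightarrow> dist y x < d \<Longrightarrow> dist (f y) (f x) < e"
    unfolding uniformly_continuous_on_def using assms by metis
  have "\<bar>f x - f y\<bar> \<le> e + 2 * B / d * \<bar>x - y\<bar>" if x: "x \<in> {0..1}" and y: "y \<in> {0..1}" for x y
  proof (cases "\<bar>x - y\<bar> < d")
    case True
    then have "\<bar>f x - f y\<bar> < e" using d(2)[OF y x] by (simp add: dist_real_def)
    moreover have "0 \<le> 2 * B / d * \<bar>x - y\<bar>" using B d by simp
    ultimately show ?thesis by linarith
  next
    case False
    then have "2 * B / d * d \<le> 2 * B / d * \<bar>x - y\<bar>" using B d by (intro mult_left_mono) auto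
    then have "2 * B \<le> 2 * B / d * \<bar>x - y\<bar>" using d by simp
    then show ?thesis using B(2)[OF x] B(2)[OF y] assms by linarith
  qed
  then show ?thesis using B d by (intro exI[of _ "2 * B / d"]) auto
qed

lemma f_measurable:
  assumes U: "U \<in> borel_measurable M" and U01: "\<And>x. x \<in> space M \<Longrightarrow> U x \<in> {0..1}"
  shows "(\<lambda>x. f (U x)) \<in> borel_measurable M"
proof -
  have "U \<in> M \<rightarrow>\<^sub>M restrict_space borel {0..1}"
    using U U01 by (intro measurable_restrict_space2) auto
  moreover have "f \<in> borel_measurable (restrict_space borel {0..1})"
    by (rule borel_measurable_continuous_on_restrict[OF f_cont])
  ultimately show ?thesis by (rule measurable_compose)
qed

lemma f_integrable:
  assumes "finite_measure M" and U: "U \<in> borel_measurable M" and U01: "\<And>x. x \<in> space M \<Longrightarrow> U x \<in> {0..1}"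
  shows "integrable M (\<lambda>x. f (U x))"
proof -
  obtain B where B: "\<And>x. x \<in> {0..1} \<Longrightarrow> \<bar>f x\<bar> \<le> B" using f_bounded by blast
  show ?thesis
    by (rule finite_measure.integrable_const_bound[OF assms(1), where B = B])
      (use B U01 f_measurable[OF U U01] in auto)
qed

end

section \<open>Jensen's inequality on the cells of a partition\<close>

lemma (in finite_filtration) cavg_unit:
  assumes U: "U \<in> borel_measurable M" and U01: "\<And>x. x \<in> space M \<Longrightarrow> U x \<in> {0..1}"
  shows "cavg m U k \<in> {0..1}"
proof -
  have "(LINT x|M. indicator (cell m k) x * U x) \<le> (LINT x|M. indicator (cell m k) x)"
    using U U01 by (intro integral_mono) (auto intro!: integrable_ind integrable_cell simp: indicator_def)
  then have 1: "(LINT x|M. indicator (cell m k) x * U x) \<le> measure M (cell m k)"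
    by (simp add: Int_absorb2 sets.sets_into_space)
  have 0: "0 \<le> (LINT x|M. indicator (cell m k) x * U x)"
    using U01 by (intro integral_nonneg_AE AE_I2) (auto simp: indicator_def)
  show ?thesis
  proof (cases "measure M (cell m k) = 0")
    case False
    then have "measure M (cell m k) > 0" by (simp add: less_le)
    then show ?thesis unfolding cavg_def using 0 1 by simp
  qed (simp add: cavg_def)
qed

locale concave_filtration = finite_filtration M c + strictly_concave_unit f
  for M :: "'a measure" and c :: "nat \<Rightarrow> 'a \<Rightarrow> 'b" and f
begin

text \<open>Integrate the bound \<open>gap\<close> taken at the cell average: the linear term
  cancels by the choice of the base point.\<close>

lemma cell_jensen:
  assumes U: "U \<in> borel_measurable M" and U01: "\<And>x. x \<in> space M \<Longrightarrow> U x \<in> {0..1}"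
    and gap: "\<And>a. a \<in> {0<..<1} \<Longrightarrow> \<exists>s. \<forall>x\<in>{0..1}. f x \<le> f a + s * (x - a) - \<kappa> * (\<bar>x - a\<bar> - \<eta>)"
    and "\<kappa> * \<eta> \<ge> 0"
  shows "(LINT x|M. indicator (cell m k) x * f (U x))
    \<le> (LINT x|M. indicator (cell m k) x * (f (cexp m U x) - \<kappa> * (\<bar>U x - cexp m U x\<bar> - \<eta>)))"
proof -
  let ?a = "cavg m U k" and ?I = "\<lambda>x. indicator (cell m k) x :: real"
  note Ui = integrable_unit[OF U U01] and fi = f_integrable[OF finite_measure_axioms U U01]
  have a: "?a \<in> {0..1}" by (rule cavg_unit[OF U U01])
  have eq: "(LINT x|M. ?I x * (f (cexp m U x) - \<kappa> * (\<bar>U x - cexp m U x\<bar> - \<eta>)))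
     = (LINT x|M. ?I x * (f ?a - \<kappa> * (\<bar>U x - ?a\<bar> - \<eta>)))"
    by (intro Bochner_Integration.integral_cong) (auto simp: indicator_def cell_def cexp_def)
  have ai: "integrable M (\<lambda>x. f ?a - \<kappa> * (\<bar>U x - ?a\<bar> - \<eta>))"
    by (intro Bochner_Integration.integrable_diff integrable_const integrable_mult_right integrable_abs Ui)
  have U_a: "(LINT x|M. ?I x * (U x - ?a)) = 0"
  proof -
    have "(LINT x|M. ?I x * (U x - ?a)) = (LINT x|M. ?I x * U x) - (LINT x|M. ?I x * ?a)"
      unfolding right_diff_distrib
      by (intro Bochner_Integration.integral_diff integrable_cell Ui integrable_const cell_sets)
    then show ?thesis
      using cavg_times_measure[of m U k] by (simp add: Int_absorb2 sets.sets_into_space mult.commute)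
  qed
  show ?thesis
  proof (cases "?a \<in> {0<..<1}")
    case True
    from gap[OF this] obtain s where
      s: "\<And>x. x \<in> {0..1} \<Longrightarrow> f x \<le> f ?a + s * (x - ?a) - \<kappa> * (\<bar>x - ?a\<bar> - \<eta>)" by blast
    have "(LINT x|M. ?I x * f (U x)) \<le> (LINT x|M. ?I x * (f ?a - \<kappa> * (\<bar>U x - ?a\<bar> - \<eta>)) + s * (?I x * (U x - ?a)))"
    proof (rule integral_mono)
      show "?I x * f (U x) \<le> ?I x * (f ?a - \<kappa> * (\<bar>U x - ?a\<bar> - \<eta>)) + s * (?I x * (U x - ?a))" if "x \<in> space M" for x
        using s[OF U01[OF that]] by (simp add: indicator_def)
      have "integrable M (\<lambda>x. s * (?I x * (U x - ?a)))"
        by (intro integrable_mult_right integrable_cell Bochner_Integration.integrable_diff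
            integrable_const Ui cell_sets)
      then show "integrable M (\<lambda>x. ?I x * (f ?a - \<kappa> * (\<bar>U x - ?a\<bar> - \<eta>)) + s * (?I x * (U x - ?a)))"
        by (rule Bochner_Integration.integrable_add[OF integrable_cell[OF ai cell_sets]])
    qed (intro integrable_cell fi cell_sets)
    also have "\<dots> = (LINT x|M. ?I x * (f ?a - \<kappa> * (\<bar>U x - ?a\<bar> - \<eta>)))"
      using U_a by (subst Bochner_Integration.integral_add)
       (auto intro!: integrable_cell ai integrable_mult_right Bochner_Integration.integrable_diff Ui)
    finally show ?thesis unfolding eq .
  next
    \<comment> \<open>At an average of 0 or 1 there may be no slope, but \<open>U\<close>, taking
      values in the unit interval, then equals its average almost everywhere on the cell. What
      remains is that \<open>\<kappa> * \<eta>\<close> is nonnegative.\<close>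
    case False
    have "AE x in M. ?I x * (U x - ?a) = 0"
    proof -
      have "AE x in M. ?I x * \<bar>U x - ?a\<bar> = 0"
      proof (subst integral_nonneg_eq_0_iff_AE[symmetric])
        show "integrable M (\<lambda>x. ?I x * \<bar>U x - ?a\<bar>)"
          by (intro integrable_cell integrable_abs Bochner_Integration.integrable_diff integrable_const Ui cell_sets)
        have "?a = 0 \<or> ?a = 1" using False a by auto
        then have "(LINT x|M. ?I x * \<bar>U x - ?a\<bar>) = (LINT x|M. (if ?a = 0 then 1 else -1) * (?I x * (U x - ?a)))"
        proof (intro Bochner_Integration.integral_cong refl)
          fix x assume "x \<in> space M"
          then have "U x \<in> {0..1}" by (rule U01)
          then show "?I x * \<bar>U x - ?a\<bar> = (if ?a = 0 then 1 else -1) * (?I x * (U x - ?a))"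
            using \<open>?a = 0 \<or> ?a = 1\<close> by auto
        qed
        then show "(LINT x|M. ?I x * \<bar>U x - ?a\<bar>) = 0" using U_a by simp
      qed auto
      then show ?thesis by eventually_elim auto
    qed
    then have "AE x in M. ?I x * f (U x) \<le> ?I x * (f ?a - \<kappa> * (\<bar>U x - ?a\<bar> - \<eta>))"
      by eventually_elim (use assms(4) in \<open>auto simp: indicator_def algebra_simps\<close>)
    then show ?thesis unfolding eq
      by (intro integral_mono_AE integrable_cell fi ai cell_sets)
  qed
qed

text \<open>The point is the order of quantifiers: \<open>\<kappa>\<close> depends on
  \<open>f\<close> and \<open>\<eta>\<close> only, and serves all functions and all levels.\<close>

lemma jensen_gap:
  assumes "\<eta> > 0"
  shows "\<exists>\<kappa>>0. \<forall>U m. U \<in> borel_measurable M \<longrightarrow> (\<forall>x\<in>space M. U x \<in> {0..1}) \<longrightarrow>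
     (LINT x|M. f (U x)) \<le> (LINT x|M. f (cexp m U x)) - \<kappa> * ((LINT x|M. \<bar>U x - cexp m U x\<bar>) - \<eta>)"
proof -
  from concavity_gap[OF assms] obtain \<kappa> where k: "\<kappa> > 0"
    and gap: "\<And>a. a \<in> {0<..<1} \<Longrightarrow> \<exists>s. \<forall>x\<in>{0..1}. f x \<le> f a + s * (x - a) - \<kappa> * (\<bar>x - a\<bar> - \<eta>)" by blast
  have "(LINT x|M. f (U x)) \<le> (LINT x|M. f (cexp m U x)) - \<kappa> * ((LINT x|M. \<bar>U x - cexp m U x\<bar>) - \<eta>)"
    if U: "U \<in> borel_measurable M" and U01: "\<And>x. x \<in> space M \<Longrightarrow> U x \<in> {0..1}" for U m
  proof -
    note Ui = integrable_unit[OF U U01] and fi = f_integrable[OF finite_measure_axioms U U01]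
    have fc: "integrable M (\<lambda>x. f (cexp m U x))"
      unfolding cexp_def by (rule integrable_label)
    have d: "integrable M (\<lambda>x. \<bar>U x - cexp m U x\<bar>)"
      by (intro integrable_abs Bochner_Integration.integrable_diff Ui integrable_cexp)
    have i: "integrable M (\<lambda>x. f (cexp m U x) - \<kappa> * (\<bar>U x - cexp m U x\<bar> - \<eta>))"
      by (intro Bochner_Integration.integrable_diff integrable_const integrable_mult_right fc d)
    have "(LINT x|M. f (U x)) = (\<Sum>k\<in>c m ` space M. (LINT x|M. indicator (cell m k) x * f (U x)))"
      by (rule integral_cells[OF fi])
    also have "\<dots> \<le> (\<Sum>k\<in>c m ` space M. (LINT x|M. indicator (cell m k) x * (f (cexp m U x) - \<kappa> * (\<bar>U x - cexp m U x\<bar> - \<eta>))))"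
      using k assms by (intro sum_mono cell_jensen[OF U U01 gap]) auto
    also have "\<dots> = (LINT x|M. f (cexp m U x) - \<kappa> * (\<bar>U x - cexp m U x\<bar> - \<eta>))"
      by (rule integral_cells[OF i, symmetric])
    also have "\<dots> = (LINT x|M. f (cexp m U x)) - \<kappa> * ((LINT x|M. \<bar>U x - cexp m U x\<bar>) - \<eta>)"
      using fc d mass_1 by simp
    finally show ?thesis .
  qed
  then show ?thesis using k by blast
qed

text \<open>Taking \<open>\<eta>\<close> equal to the L1-distance itself makes the correction in
  \<open>jensen_gap\<close> vanish. If that distance is 0, the two integrands agree almost
  everywhere.\<close>

lemma jensen:
  assumes U: "U \<in> borel_measurable M" and U01: "\<And>x. x \<in> space M \<Longrightarrow> U x \<in> {0..1}"
  shows "(LINT x|M. f (U x)) \<le> (LINT x|M. f (cexp m U x))"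
proof (cases "(LINT x|M. \<bar>U x - cexp m U x\<bar>) = 0")
  case True
  have "integrable M (\<lambda>x. \<bar>U x - cexp m U x\<bar>)"
    by (intro integrable_abs Bochner_Integration.integrable_diff integrable_unit[OF U U01] integrable_cexp)
  then have "AE x in M. \<bar>U x - cexp m U x\<bar> = 0" using True by (subst (asm) integral_nonneg_eq_0_iff_AE) auto
  then have ae: "AE x in M. f (U x) = f (cexp m U x)" by eventually_elim simp
  have "(\<lambda>x. f (cexp m U x)) \<in> borel_measurable M"
    unfolding cexp_def by (rule borel_measurable_integrable, rule integrable_label)
  then show ?thesis
    using integral_cong_AE[OF f_measurable[OF U U01] _ ae] by simp
next
  case False
  then have "(LINT x|M. \<bar>U x - cexp m U x\<bar>) > 0" by (simp add: less_le integral_nonneg_AE)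
  from jensen_gap[OF this] show ?thesis using U U01 by (auto dest!: spec[of _ U] spec[of _ m])
qed

lemma integral_f_tendsto:
  assumes U: "\<And>n. U n \<in> borel_measurable M" "\<And>n x. x \<in> space M \<Longrightarrow> U n x \<in> {0..1}"
    and W: "W \<in> borel_measurable M" "\<And>x. x \<in> space M \<Longrightarrow> W x \<in> {0..1}"
    and lim: "(\<lambda>n. LINT x|M. \<bar>W x - U n x\<bar>) \<longlonglongrightarrow> 0"
  shows "(\<lambda>n. LINT x|M. f (U n x)) \<longlonglongrightarrow> (LINT x|M. f (W x))"
proof (rule LIMSEQ_I)
  fix e :: real assume e: "e > 0"
  obtain C where C: "C \<ge> 0" "\<And>x y. x \<in> {0..1} \<Longrightarrow> y \<in> {0..1} \<Longrightarrow> \<bar>f x - f y\<bar> \<le> e / 2 + C * \<bar>x - y\<bar>"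
    using f_Lipschitz_up_to[of "e/2"] e by auto
  have "(\<lambda>n. e / 2 + C * (LINT x|M. \<bar>W x - U n x\<bar>)) \<longlonglongrightarrow> e / 2 + C * 0"
    by (intro tendsto_intros lim)
  from order_tendstoD(2)[OF this, of e] e
  obtain N where N: "\<And>n. n \<ge> N \<Longrightarrow> e / 2 + C * (LINT x|M. \<bar>W x - U n x\<bar>) < e"
    by (auto simp: eventually_sequentially)
  have "norm ((LINT x|M. f (U n x)) - (LINT x|M. f (W x))) < e" if n: "n \<ge> N" for n
  proof -
    note i = f_integrable[OF finite_measure_axioms U, of n] f_integrable[OF finite_measure_axioms W]
    have d: "integrable M (\<lambda>x. \<bar>W x - U n x\<bar>)"
      by (intro integrable_abs Bochner_Integration.integrable_diff integrable_unit U W)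
    have "\<bar>(LINT x|M. f (U n x)) - (LINT x|M. f (W x))\<bar> = \<bar>LINT x|M. f (U n x) - f (W x)\<bar>"
      using i by simp
    also have "\<dots> \<le> (LINT x|M. \<bar>f (U n x) - f (W x)\<bar>)" by (rule integral_abs_bound)
    also have "\<dots> \<le> (LINT x|M. e / 2 + C * \<bar>W x - U n x\<bar>)"
    proof (rule integral_mono)
      show "\<bar>f (U n x) - f (W x)\<bar> \<le> e / 2 + C * \<bar>W x - U n x\<bar>" if "x \<in> space M" for x
        using C(2)[OF U(2)[OF that] W(2)[OF that], of n] by (simp add: abs_minus_commute)
      show "integrable M (\<lambda>x. e / 2 + C * \<bar>W x - U n x\<bar>)"
        by (rule Bochner_Integration.integrable_add[OF integrable_const integrable_mult_right[OF d]])
    qed (intro integrable_abs Bochner_Integration.integrable_diff i)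
    also have "\<dots> = e / 2 + C * (LINT x|M. \<bar>W x - U n x\<bar>)"
      using d mass_1 by simp
    also have "\<dots> < e" by (rule N[OF n])
    finally show ?thesis by simp
  qed
  then show "\<exists>N. \<forall>n\<ge>N. norm ((LINT x|M. f (U n x)) - (LINT x|M. f (W x))) < e" by blast
qed

end

section \<open>The Borel unit interval and the unit square as a product space\<close>

definition I1 :: "real measure" where
  "I1 = restrict_space lborel {0..1}"

text \<open>A product of uncompleted measures, so that Fubini and product measurability apply
  directly. The completions reappear in \<open>lebesgue_on_unit\<close> and
  \<open>lebesgue_on_square\<close>.\<close>

definition I2 :: "(real \<times> real) measure" where
  "I2 = I1 \<Otimes>\<^sub>M I1"

lemma space_I1 [simp]: "space I1 = {0..1}"
  by (simp add: I1_def space_restrict_space)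

lemma space_I2 [simp]: "space I2 = {0..1} \<times> {0..1}"
  by (simp add: I2_def space_pair_measure)

lemma sets_I1: "A \<in> sets I1 \<longleftrightarrow> A \<in> sets borel \<and> A \<subseteq> {0..1}"
  unfolding I1_def by (subst sets_restrict_space_iff) auto

lemma emeasure_I1: "A \<in> sets I1 \<Longrightarrow> emeasure I1 A = emeasure lborel A"
  unfolding sets_I1 unfolding I1_def by (subst emeasure_restrict_space) auto

lemma I1_finite: "finite_measure I1"
  by (rule finite_measureI) (simp add: emeasure_I1 sets_I1)

interpretation I1: finite_measure I1
  by (rule I1_finite)

interpretation I12: pair_sigma_finite I1 I1
  by unfold_locales

lemma measure_I1_space: "measure I1 {0..1} = 1"
  by (simp add: measure_def emeasure_I1 sets_I1)

lemma emeasure_I1_space: "emeasure I1 {0..1} = 1"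
  by (simp add: emeasure_I1 sets_I1)

lemma emeasure_I2_space: "emeasure I2 ({0..1} \<times> {0..1}) = 1"
  unfolding I2_def
  by (subst I1.emeasure_pair_measure_Times) (auto simp: emeasure_I1_space sets_I1)

lemma I2_finite: "finite_measure I2"
  by (rule finite_measureI) (simp add: emeasure_I2_space)

interpretation I2: finite_measure I2
  by (rule I2_finite)

lemma measure_I2_space: "measure I2 ({0..1} \<times> {0..1}) = 1"
  by (simp add: measure_def emeasure_I2_space)

lemma fst_I2 [measurable]: "fst \<in> I2 \<rightarrow>\<^sub>M I1" and snd_I2 [measurable]: "snd \<in> I2 \<rightarrow>\<^sub>M I1"
  unfolding I2_def by measurable

lemma ident_I1: "(\<lambda>x. x) \<in> borel_measurable I1"
  unfolding I1_def by (intro measurable_restrict_space1) simp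

lemma measurable_to_I1: "f \<in> borel_measurable M \<Longrightarrow> (\<And>x. x \<in> space M \<Longrightarrow> f x \<in> {0..1}) \<Longrightarrow> f \<in> M \<rightarrow>\<^sub>M I1"
  unfolding I1_def by (rule measurable_restrict_space2) auto

lemma measurable_from_I1: "f \<in> M \<rightarrow>\<^sub>M I1 \<Longrightarrow> f \<in> borel_measurable M"
  using measurable_compose[of f M I1 "\<lambda>x. x" borel] ident_I1 by simp

subsection \<open>Dyadic partitions\<close>

text \<open>The point 1 gets the label \<open>2 ^ m\<close> and forms a null cell of its own. So the
  labels fill \<open>{..2 ^ m}\<close>, while permutations act on \<open>{..<2 ^ m}\<close>.\<close>

definition dyad :: "nat \<Rightarrow> real \<Rightarrow> nat" where
  "dyad m x = nat \<lfloor>2 ^ m * x\<rfloor>"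

definition dyad2 :: "nat \<Rightarrow> real \<times> real \<Rightarrow> nat \<times> nat" where
  "dyad2 m z = (dyad m (fst z), dyad m (snd z))"

lemma dyad_eq_iff: "x \<ge> 0 \<Longrightarrow> dyad m x = k \<longleftrightarrow> real k \<le> 2 ^ m * x \<and> 2 ^ m * x < real k + 1"
proof -
  assume "x \<ge> 0"
  then have "0 \<le> \<lfloor>2 ^ m * x\<rfloor>" by simp
  then have "dyad m x = k \<longleftrightarrow> \<lfloor>2 ^ m * x\<rfloor> = int k" unfolding dyad_def by linarith
  then show ?thesis by (simp add: floor_eq_iff)
qed

lemma dyad_le: "x \<ge> 0 \<Longrightarrow> real (dyad m x) \<le> 2 ^ m * x"
  using dyad_eq_iff by blast

lemma dyad_gt: "x \<ge> 0 \<Longrightarrow> 2 ^ m * x < real (dyad m x) + 1"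
  using dyad_eq_iff by blast

lemma dyad_le_power: "x \<in> {0..1} \<Longrightarrow> dyad m x \<le> 2 ^ m"
proof -
  assume x: "x \<in> {0..1}"
  then have "real (dyad m x) \<le> 2 ^ m * x" by (intro dyad_le) auto
  also have "\<dots> \<le> 2 ^ m" using x by auto
  finally have "real (dyad m x) \<le> real (2 ^ m)" by simp
  then show ?thesis by (rule of_nat_le_iff[THEN iffD1])
qed

lemma dyad_measurable [measurable]: "dyad m \<in> I1 \<rightarrow>\<^sub>M count_space UNIV"
  unfolding dyad_def using ident_I1 by measurable

lemma dyad_refine:
  assumes "m \<le> n" "x \<ge> 0"
  shows "dyad m x = dyad n x div 2 ^ (n - m)"
proof -
  have "2 ^ m * x = (2 ^ n * x) / real_of_int (2 ^ (n - m))"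
    using power_add[of "2::real" m "n - m"] assms(1) by simp
  then have "\<lfloor>2 ^ m * x\<rfloor> = \<lfloor>2 ^ n * x\<rfloor> div 2 ^ (n - m)"
    using floor_divide_real_eq_div[of "2 ^ (n - m)" "2 ^ n * x"] by simp
  then show ?thesis
    unfolding dyad_def using assms(2) by (simp add: nat_div_distrib nat_power_eq)
qed

text \<open>The right ends of the dyadic intervals around \<open>x\<close> approach \<open>x\<close>
  from above, so \<open>x < a\<close> holds as soon as one of them is at most \<open>a\<close>. This
  expresses half-lines by countably many label conditions.\<close>

lemma less_iff_dyad:
  assumes "x \<ge> 0"
  shows "x < a \<longleftrightarrow> (\<exists>m. real (dyad m x) + 1 \<le> 2 ^ m * a)"
proof
  assume "x < a"
  then obtain m where "1 / (a - x) < 2 ^ m" using real_arch_pow[of 2 "1 / (a - x)"] one_less_numeral_iff semiring_norm(76) by blast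
  then have "1 / (a - x) * (a - x) \<le> 2 ^ m * (a - x)"
    using \<open>x < a\<close> by (intro mult_right_mono less_imp_le) (assumption, simp)
  then have "1 \<le> 2 ^ m * (a - x)" using \<open>x < a\<close> by simp
  then have "2 ^ m * x + 1 \<le> 2 ^ m * a" by (simp add: algebra_simps)
  then show "\<exists>m. real (dyad m x) + 1 \<le> 2 ^ m * a" using dyad_le[OF assms, of m] by (intro exI[of _ m]) linarith
next
  assume "\<exists>m. real (dyad m x) + 1 \<le> 2 ^ m * a"
  then obtain m where "real (dyad m x) + 1 \<le> 2 ^ m * a" ..
  with dyad_gt[OF assms, of m] have "2 ^ m * x < 2 ^ m * a" by linarith
  then show "x < a" by simp
qed

lemma borel_measurable_from_dyads:
  assumes "\<And>m S. {z\<in>space N. dyad m (g z) \<in> S} \<in> sets N" and "\<And>z. z \<in> space N \<Longrightarrow> g z \<in> {0..1}"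
  shows "g \<in> borel_measurable N"
proof (rule borel_measurable_iff_less[THEN iffD2], rule allI)
  fix a
  have "{z\<in>space N. g z < a} = (\<Union>m. {z\<in>space N. dyad m (g z) \<in> {k. real k + 1 \<le> 2 ^ m * a}})"
    using less_iff_dyad assms(2) by fastforce
  also have "\<dots> \<in> sets N" by (rule sets.countable_UN) (rule image_subsetI, rule assms(1))
  finally show "{z\<in>space N. g z < a} \<in> sets N" .
qed

text \<open>The identity is Borel measurable on the sigma-algebra generated by the labels, so every
  Borel subset of the interval belongs to it as a preimage. \<open>dyad2_generates\<close> argues in
  the same way with both projections.\<close>

lemma dyad_generates: "sets I1 \<subseteq> sigma_sets (space I1) {dyad m -` S \<inter> space I1 | m S. True}"
proof -
  define G where "G = {dyad m -` S \<inter> space I1 | m S. True}"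
  define N where "N = sigma (space I1) G"
  have "G \<subseteq> Pow (space I1)" unfolding G_def by auto
  then have sp: "space N = space I1" and st: "sets N = sigma_sets (space I1) G"
    unfolding N_def by (simp_all add: space_measure_of sets_measure_of)
  have id: "(\<lambda>x. x) \<in> borel_measurable N"
  proof (rule borel_measurable_from_dyads)
    fix m S
    have "{z\<in>space N. dyad m z \<in> S} = dyad m -` S \<inter> space I1" unfolding sp by blast
    also have "\<dots> \<in> sets N" unfolding st G_def by blast
    finally show "{z\<in>space N. dyad m z \<in> S} \<in> sets N" .
  qed (simp add: sp)
  have "A \<in> sigma_sets (space I1) G" if A: "A \<in> sets I1" for A
  proof -
    have "(\<lambda>x. x) -` A \<inter> space N \<in> sets N" by (intro measurable_sets[OF id]) (use A in \<open>simp add: sets_I1\<close>)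
    moreover have "(\<lambda>x. x) -` A \<inter> space N = A" using sets.sets_into_space[OF A] sp by auto
    ultimately show ?thesis by (simp add: st)
  qed
  then show ?thesis unfolding G_def by blast
qed

lemma dyad2_generates: "sets I2 \<subseteq> sigma_sets (space I2) {dyad2 m -` S \<inter> space I2 | m S. True}"
proof -
  define G where "G = {dyad2 m -` S \<inter> space I2 | m S. True}"
  define N where "N = sigma (space I2) G"
  have "G \<subseteq> Pow (space I2)" unfolding G_def by auto
  then have sp: "space N = space I2" and st: "sets N = sigma_sets (space I2) G"
    unfolding N_def by (simp_all add: space_measure_of sets_measure_of)
  have G: "dyad2 m -` S \<inter> space I2 \<in> sets N" for m S
    unfolding st G_def by blast
  have proj: "g \<in> N \<rightarrow>\<^sub>M I1" if g: "g = fst \<or> g = snd" for g :: "real \<times> real \<Rightarrow> real"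
  proof (rule measurable_to_I1)
    show g01: "g z \<in> {0..1}" if "z \<in> space N" for z
      using that g by (auto simp: sp)
    show "g \<in> borel_measurable N"
    proof (rule borel_measurable_from_dyads[OF _ g01])
      fix m S
      have "{z\<in>space N. dyad m (g z) \<in> S} = dyad2 m -` (if g = fst then S \<times> UNIV else UNIV \<times> S) \<inter> space I2"
        using g unfolding sp dyad2_def by auto
      also have "\<dots> \<in> sets N" by (rule G)
      finally show "{z\<in>space N. dyad m (g z) \<in> S} \<in> sets N" .
    qed
  qed
  have id: "(\<lambda>z. z) \<in> N \<rightarrow>\<^sub>M I2"
    using measurable_Pair[OF proj[of fst] proj[of snd]] unfolding I2_def by simp
  have "A \<in> sigma_sets (space I2) G" if A: "A \<in> sets I2" for A
  proof -
    have "(\<lambda>x. x) -` A \<inter> space N \<in> sets N" by (intro measurable_sets[OF id A])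
    moreover have "(\<lambda>x. x) -` A \<inter> space N = A" using sets.sets_into_space[OF A] sp by auto
    ultimately show ?thesis by (simp add: st)
  qed
  then show ?thesis unfolding G_def by blast
qed

lemma dyad2_measurable [measurable]: "dyad2 m \<in> I2 \<rightarrow>\<^sub>M count_space UNIV"
proof -
  have "dyad2 m \<in> I2 \<rightarrow>\<^sub>M count_space UNIV \<Otimes>\<^sub>M count_space UNIV"
    unfolding dyad2_def by measurable
  then show ?thesis by (simp add: pair_measure_countable)
qed

interpretation D1: finite_filtration I1 dyad
proof
  show "finite (dyad m ` space I1)" for m
    by (rule finite_subset[of _ "{..2 ^ m}"]) (auto intro: dyad_le_power)
  show "dyad m x = dyad m y" if "m \<le> n" "x \<in> space I1" "y \<in> space I1" "dyad n x = dyad n y" for m n x y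
    using that by (simp add: dyad_refine)
qed (use dyad_generates in \<open>auto simp: measure_I1_space\<close>)

interpretation D2: finite_filtration I2 dyad2
proof
  show "finite (dyad2 m ` space I2)" for m
    by (rule finite_subset[of _ "{..2 ^ m} \<times> {..2 ^ m}"]) (auto simp: dyad2_def intro: dyad_le_power)
  show "dyad2 m x = dyad2 m y" if "m \<le> n" "x \<in> space I2" "y \<in> space I2" "dyad2 n x = dyad2 n y" for m n x y
    using that by (auto simp: dyad_refine[of m n] dyad2_def)
qed (use dyad2_generates in \<open>auto simp: measure_I2_space\<close>)

lemma dyad_cell: "D1.cell m k = {x\<in>{0..1}. dyad m x = k}"
  by (auto simp: D1.cell_def)

lemma measure_dyad_cell: "measure I1 (D1.cell m k) = (if k < 2 ^ m then 1 / 2 ^ m else 0)"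
proof -
  consider "k < 2 ^ m" | "k = 2 ^ m" | "k > 2 ^ m" by linarith
  then show ?thesis
  proof cases
    case 1
    have "D1.cell m k = {real k / 2 ^ m ..< (real k + 1) / 2 ^ m}"
    proof -
      have hi: "(real k + 1) / 2 ^ m \<le> 1"
        using of_nat_mono[OF Suc_leI[OF 1], where 'a = real] by (simp add: add.commute)
      have lo: "0 \<le> real k / 2 ^ m" by simp
      have eq: "dyad m x = k \<longleftrightarrow> real k / 2 ^ m \<le> x \<and> x < (real k + 1) / 2 ^ m" if "x \<ge> 0" for x
        using that by (simp add: dyad_eq_iff pos_divide_le_eq pos_less_divide_eq mult.commute)
      show ?thesis unfolding dyad_cell
      proof (intro set_eqI iffI)
        fix x assume "x \<in> {x \<in> {0..1}. dyad m x = k}"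
        then show "x \<in> {real k / 2 ^ m ..< (real k + 1) / 2 ^ m}" using eq[of x] by simp
      next
        fix x assume "x \<in> {real k / 2 ^ m ..< (real k + 1) / 2 ^ m}"
        then have x: "real k / 2 ^ m \<le> x" "x < (real k + 1) / 2 ^ m" by simp_all
        then have "0 \<le> x" "x \<le> 1" using hi lo by linarith+
        then show "x \<in> {x \<in> {0..1}. dyad m x = k}" using eq[of x] x by simp
      qed
    qed
    moreover from this have "{real k / 2 ^ m ..< (real k + 1) / 2 ^ m} \<in> sets I1"
      using D1.cell_sets[of m k] by simp
    ultimately show ?thesis using 1
      by (simp add: measure_def emeasure_I1 divide_right_mono diff_divide_distrib[symmetric])
  next
    case 2
    have "D1.cell m k \<subseteq> {1}"
    proof
      fix x assume "x \<in> D1.cell m k"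
      then have "x \<in> {0..1}" "dyad m x = 2 ^ m" using 2 by (auto simp: dyad_cell)
      then have "(2::real) ^ m \<le> 2 ^ m * x" using dyad_le[of x m] by simp
      then show "x \<in> {1}" using \<open>x \<in> {0..1}\<close> by simp
    qed
    then have "measure I1 (D1.cell m k) \<le> measure I1 {1}"
      by (intro I1.finite_measure_mono) (auto simp: sets_I1)
    also have "\<dots> = 0" by (simp add: measure_def emeasure_I1 sets_I1)
    finally show ?thesis using 2 by (simp add: antisym)
  next
    case 3
    have "dyad m x \<noteq> k" if "x \<in> {0..1}" for x using 3 dyad_le_power[OF that, of m] by linarith
    then have "D1.cell m k = {}" unfolding dyad_cell by blast
    then show ?thesis using 3 by simp
  qed
qed

lemma dyad_surj: "k \<le> 2 ^ m \<Longrightarrow> k \<in> dyad m ` {0..1}"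
proof
  assume k: "k \<le> 2 ^ m"
  show "k = dyad m (real k / 2 ^ m)" by (simp add: dyad_def)
  have "real k \<le> 2 ^ m" using of_nat_mono[OF k, where 'a = real] by simp
  then show "real k / 2 ^ m \<in> {0..1}" by simp
qed

lemma dyad_image: "dyad m ` {0..1} = {..2 ^ m}"
  using dyad_surj dyad_le_power by auto

lemma measure_dyad_vimage: "measure I1 {x\<in>{0..1}. dyad m x \<in> T} = real (card (T \<inter> {..<2 ^ m})) / 2 ^ m"
proof -
  have "{x\<in>{0..1}. dyad m x \<in> T} = dyad m -` T \<inter> space I1" by auto
  then have s: "{x\<in>{0..1}. dyad m x \<in> T} \<in> sets I1" by (simp only: D1.label_set)
  have "measure I1 {x\<in>{0..1}. dyad m x \<in> T} = (LINT x|I1. indicator {x\<in>{0..1}. dyad m x \<in> T} x)"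
    by (subst Bochner_Integration.integral_indicator) (use s in \<open>auto simp: Int_absorb2 intro!: arg_cong[where f = "measure I1"]\<close>)
  also have "\<dots> = (LINT x|I1. indicator T (dyad m x))"
    by (intro Bochner_Integration.integral_cong) (auto simp: indicator_def)
  also have "\<dots> = (\<Sum>k\<in>{..2 ^ m}. indicator T k * (if k < 2 ^ m then 1 / 2 ^ m else 0))"
    by (subst D1.integral_label) (simp add: dyad_image measure_dyad_cell)
  also have "\<dots> = (\<Sum>k\<in>T \<inter> {..<2 ^ m}. 1 / 2 ^ m)"
    by (intro sum.mono_neutral_cong_right) (auto simp: indicator_def)
  finally show ?thesis by simp
qed

subsection \<open>Automorphisms of the unit interval\<close>

definition mpt :: "(real \<Rightarrow> real) \<Rightarrow> bool" where
  "mpt \<phi> \<longleftrightarrow> \<phi> \<in> I1 \<rightarrow>\<^sub>M I1 \<and> distr I1 I1 \<phi> = I1"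

text \<open>Unlike almost-bijections, whose inverses are only defined through \<^const>\<open>inv_into\<close>, these maps visibly
  form a group.\<close>

definition aut :: "(real \<Rightarrow> real) \<Rightarrow> bool" where
  "aut \<phi> \<longleftrightarrow> mpt \<phi> \<and> (\<exists>\<psi>. mpt \<psi> \<and> (\<forall>x\<in>{0..1}. \<psi> (\<phi> x) = x \<and> \<phi> (\<psi> x) = x))"

text \<open>For \<open>aut \<phi>\<close> this is the version of \<open>U\<close> under the inverse of \<open>\<phi>\<close>.\<close>

definition pull :: "(real \<Rightarrow> real) \<Rightarrow> (real \<times> real \<Rightarrow> real) \<Rightarrow> real \<times> real \<Rightarrow> real" where
  "pull \<phi> U z = U (\<phi> (fst z), \<phi> (snd z))"

lemma mpt_measurable [measurable_dest]: "mpt \<phi> \<Longrightarrow> \<phi> \<in> I1 \<rightarrow>\<^sub>M I1"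
  by (simp add: mpt_def)

lemma mpt_unit: "mpt \<phi> \<Longrightarrow> x \<in> {0..1} \<Longrightarrow> \<phi> x \<in> {0..1}"
  using measurable_space[of \<phi> I1 I1 x] by (simp add: mpt_def)

lemma mpt_comp: "mpt \<phi> \<Longrightarrow> mpt \<psi> \<Longrightarrow> mpt (\<lambda>x. \<phi> (\<psi> x))"
  unfolding mpt_def using distr_distr[of \<phi> I1 I1 \<psi> I1] by (auto simp: comp_def)

lemma mpt_id: "mpt (\<lambda>x. x)"
  by (simp add: mpt_def distr_id)

lemma aut_mpt: "aut \<phi> \<Longrightarrow> mpt \<phi>"
  by (simp add: aut_def)

lemma aut_id: "aut (\<lambda>x. x)"
  unfolding aut_def using mpt_id by blast

lemma aut_comp:
  assumes "aut \<phi>" "aut \<psi>"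
  shows "aut (\<lambda>x. \<phi> (\<psi> x))"
proof -
  obtain \<phi>' \<psi>' where 1: "mpt \<phi>'" "\<And>x. x \<in> {0..1} \<Longrightarrow> \<phi>' (\<phi> x) = x \<and> \<phi> (\<phi>' x) = x"
    and 2: "mpt \<psi>'" "\<And>x. x \<in> {0..1} \<Longrightarrow> \<psi>' (\<psi> x) = x \<and> \<psi> (\<psi>' x) = x"
    using assms unfolding aut_def by blast
  have "mpt (\<lambda>x. \<phi> (\<psi> x))" "mpt (\<lambda>x. \<psi>' (\<phi>' x))"
    using 1(1) 2(1) assms by (auto intro: mpt_comp aut_mpt)
  moreover have "\<psi>' (\<phi>' (\<phi> (\<psi> x))) = x \<and> \<phi> (\<psi> (\<psi>' (\<phi>' x))) = x" if "x \<in> {0..1}" for x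
    using that 1(2) 2(2) mpt_unit[OF aut_mpt[OF assms(2)]] mpt_unit[OF 1(1)] by metis
  ultimately show ?thesis unfolding aut_def by blast
qed

lemma aut_inverse:
  assumes "aut \<phi>"
  shows "\<exists>\<psi>. aut \<psi> \<and> (\<forall>x\<in>{0..1}. \<psi> (\<phi> x) = x \<and> \<phi> (\<psi> x) = x)"
  using assms unfolding aut_def by blast

lemma mpt_vimage_measure:
  assumes "mpt \<phi>" "A \<in> sets I1"
  shows "measure I1 {x\<in>{0..1}. \<phi> x \<in> A} = measure I1 A"
proof -
  have "measure I1 A = measure (distr I1 I1 \<phi>) A" using assms by (simp add: mpt_def)
  also have "\<dots> = measure I1 (\<phi> -` A \<inter> space I1)" using assms by (intro measure_distr) (simp_all add: mpt_def)
  also have "\<phi> -` A \<inter> space I1 = {x\<in>{0..1}. \<phi> x \<in> A}" by auto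
  finally show ?thesis by simp
qed

lemma mpt_square:
  assumes "mpt \<phi>"
  shows "(\<lambda>z. (\<phi> (fst z), \<phi> (snd z))) \<in> I2 \<rightarrow>\<^sub>M I2"
    and "distr I2 I2 (\<lambda>z. (\<phi> (fst z), \<phi> (snd z))) = I2"
proof -
  have \<phi>: "\<phi> \<in> I1 \<rightarrow>\<^sub>M I1" "distr I1 I1 \<phi> = I1" using assms by (simp_all add: mpt_def)
  show "(\<lambda>z. (\<phi> (fst z), \<phi> (snd z))) \<in> I2 \<rightarrow>\<^sub>M I2"
    unfolding I2_def using \<phi>(1) by measurable
  have "distr I1 I1 \<phi> \<Otimes>\<^sub>M distr I1 I1 \<phi> = distr (I1 \<Otimes>\<^sub>M I1) (I1 \<Otimes>\<^sub>M I1) (\<lambda>(x, y). (\<phi> x, \<phi> y))"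
    by (rule pair_measure_distr[OF \<phi>(1) \<phi>(1)]) (simp add: \<phi>(2) I1.sigma_finite_measure_axioms)
  then show "distr I2 I2 (\<lambda>z. (\<phi> (fst z), \<phi> (snd z))) = I2"
    by (simp add: \<phi>(2) I2_def case_prod_beta')
qed

lemma pull_measurable [measurable]:
  "mpt \<phi> \<Longrightarrow> U \<in> borel_measurable I2 \<Longrightarrow> pull \<phi> U \<in> borel_measurable I2"
  unfolding pull_def by (rule measurable_compose[OF mpt_square(1)])

lemma integral_pull:
  "mpt \<phi> \<Longrightarrow> U \<in> borel_measurable I2 \<Longrightarrow> (LINT z|I2. pull \<phi> U z) = (LINT z|I2. U z)"
  unfolding pull_def
  by (subst mpt_square(2)[of \<phi>, symmetric], assumption, subst integral_distr[OF mpt_square(1)])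
    simp_all

lemma swap_I2: "(\<lambda>z. (snd z, fst z)) \<in> I2 \<rightarrow>\<^sub>M I2" "distr I2 I2 (\<lambda>z. (snd z, fst z)) = I2"
proof -
  show "(\<lambda>z. (snd z, fst z)) \<in> I2 \<rightarrow>\<^sub>M I2" unfolding I2_def by measurable
  show "distr I2 I2 (\<lambda>z. (snd z, fst z)) = I2"
    using I12.distr_pair_swap unfolding I2_def by (simp add: case_prod_beta')
qed

lemma integral_swap:
  fixes U :: "real \<times> real \<Rightarrow> real"
  assumes "U \<in> borel_measurable I2"
  shows "(LINT z|I2. U (snd z, fst z)) = (LINT z|I2. U z)"
  using integral_distr[OF swap_I2(1) assms] by (simp add: swap_I2(2))

lemma I2_strip:
  assumes N: "N \<in> sets I1"
  shows "measure I2 {z\<in>space I2. fst z \<in> N \<or> snd z \<in> N} \<le> 2 * measure I1 N"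
proof -
  have N': "N \<subseteq> {0..1}" using sets.sets_into_space[OF N] by simp
  have s: "N \<times> {0..1} \<in> sets I2" "{0..1} \<times> N \<in> sets I2"
    unfolding I2_def using N by (auto intro!: pair_measureI simp: sets_I1)
  have m: "measure I2 (N \<times> {0..1}) = measure I1 N" "measure I2 ({0..1} \<times> N) = measure I1 N"
    unfolding measure_def I2_def using N
    by (simp_all add: I1.emeasure_pair_measure_Times sets_I1 emeasure_I1_space)
  have "{z\<in>space I2. fst z \<in> N \<or> snd z \<in> N} = N \<times> {0..1} \<union> {0..1} \<times> N" using N' by auto
  then show ?thesis using measure_Un_le[OF s] m by simp
qed

text \<open>Rearrangements go wrong on a small set \<open>N\<close> of points. The pairs with a
  coordinate in \<open>N\<close> fill two strips, which gives the factor 2.\<close>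

lemma integral_diff_off_strip:
  fixes g h :: "real \<times> real \<Rightarrow> real"
  assumes N: "N \<in> sets I1" and g: "g \<in> borel_measurable I2" and h: "h \<in> borel_measurable I2"
    and b: "\<And>z. z \<in> space I2 \<Longrightarrow> \<bar>g z - h z\<bar> \<le> B"
    and eq: "\<And>x y. x \<in> {0..1} - N \<Longrightarrow> y \<in> {0..1} - N \<Longrightarrow> g (x, y) = h (x, y)"
  shows "(LINT z|I2. \<bar>g z - h z\<bar>) \<le> 2 * B * measure I1 N"
proof -
  let ?S = "{z\<in>space I2. fst z \<in> N \<or> snd z \<in> N}"
  have S: "?S \<in> sets I2" using N by measurable
  have "B \<ge> 0" using b[of "(0, 0)"] by simp
  have "(LINT z|I2. \<bar>g z - h z\<bar>) \<le> (LINT z|I2. B * indicator ?S z)"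
  proof (rule integral_mono)
    show "integrable I2 (\<lambda>z. \<bar>g z - h z\<bar>)"
      using g h b by (intro D2.integrable_bounded[of _ B]) auto
    show "integrable I2 (\<lambda>z. B * indicator ?S z)"
      by (intro integrable_mult_right D2.integrable_ind S)
    show "\<bar>g z - h z\<bar> \<le> B * indicator ?S z" if "z \<in> space I2" for z
      using b[OF that] eq[of "fst z" "snd z"] that by (auto simp: indicator_def)
  qed
  also have "\<dots> = B * measure I2 ?S" using S sets.sets_into_space[OF S] by (simp add: Int_absorb2)
  also have "\<dots> \<le> B * (2 * measure I1 N)" by (intro mult_left_mono I2_strip N \<open>B \<ge> 0\<close>)
  finally show ?thesis by simp
qed

subsection \<open>Permuting dyadic intervals\<close>

text \<open>Each dyadic interval is translated onto its image. Translation invariance preserves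
  measure cell by cell, and summing over the cells only permutes the summands.\<close>

lemma permute_dyads_mpt:
  assumes \<sigma>: "\<sigma> permutes {..<2 ^ m}"
  defines "\<phi> \<equiv> \<lambda>x. x + (real (\<sigma> (dyad m x)) - real (dyad m x)) / 2 ^ m"
  shows "mpt \<phi>" and "\<And>x. x \<in> {0..1} \<Longrightarrow> dyad m (\<phi> x) = \<sigma> (dyad m x)"
    and "\<And>x. x \<in> {0..1} \<Longrightarrow> \<phi> x \<in> {0..1}"
proof -
  show unit: "\<phi> x \<in> {0..1}" and dy: "dyad m (\<phi> x) = \<sigma> (dyad m x)" if x: "x \<in> {0..1}" for x
  proof -
    let ?k = "dyad m x"
    have le: "real ?k \<le> 2 ^ m * x" "2 ^ m * x < real ?k + 1"
      using x by (auto intro: dyad_le dyad_gt)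
    have e: "2 ^ m * \<phi> x = 2 ^ m * x + (real (\<sigma> ?k) - real ?k)"
      unfolding \<phi>_def by (simp add: distrib_left)
    then have e': "real (\<sigma> ?k) \<le> 2 ^ m * \<phi> x" "2 ^ m * \<phi> x < real (\<sigma> ?k) + 1" using le by linarith+
    have "0 \<le> 2 ^ m * \<phi> x" using e'(1) of_nat_0_le_iff[of "\<sigma> ?k"] by linarith
    then have 0: "0 \<le> \<phi> x" using zero_le_mult_iff[of "2 ^ m" "\<phi> x"] zero_less_power[of "2::real" m] by linarith
    have "2 ^ m * \<phi> x \<le> 2 ^ m"
    proof (cases "?k < 2 ^ m")
      case True
      then have "\<sigma> ?k < 2 ^ m" using permutes_in_image[OF \<sigma>, of ?k] by simp
      then have "real (\<sigma> ?k) + 1 \<le> 2 ^ m" using of_nat_mono[OF Suc_leI, where 'a = real] by fastforce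
      then show ?thesis using e'(2) by linarith
    next
      case False
      then have "\<sigma> ?k = ?k" using \<sigma> by (simp add: permutes_not_in)
      then show ?thesis using e x by simp
    qed
    then have 1: "\<phi> x \<le> 1" by simp
    show "\<phi> x \<in> {0..1}" using 0 1 by simp
    show "dyad m (\<phi> x) = \<sigma> ?k" using e' dyad_eq_iff[OF 0] by blast
  qed
  have meas: "\<phi> \<in> I1 \<rightarrow>\<^sub>M I1"
  proof (rule measurable_to_I1)
    have "(\<lambda>x. (real (\<sigma> (dyad m x)) - real (dyad m x)) / 2 ^ m) \<in> borel_measurable I1"
      by (rule measurable_compose[OF dyad_measurable, where g = "\<lambda>k. (real (\<sigma> k) - real k) / 2 ^ m"]) simp
    then show "\<phi> \<in> borel_measurable I1"
      unfolding \<phi>_def by (intro borel_measurable_add ident_I1)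
  qed (use unit in auto)
  \<comment> \<open>The sum over cells includes the label \<open>2 ^ m\<close> of the point 1, which
    \<open>\<sigma>\<close> fixes.\<close>
  have \<sigma>': "\<sigma> permutes {..2 ^ m}" by (rule permutes_subset[OF \<sigma>]) auto
  have "distr I1 I1 \<phi> = I1"
  proof (rule measure_eqI)
    fix A assume "A \<in> sets (distr I1 I1 \<phi>)"
    then have A: "A \<in> sets I1" by simp
    have split: "emeasure I1 B = (\<Sum>k\<le>2 ^ m. emeasure I1 (B \<inter> D1.cell m k))" if B: "B \<in> sets I1" for B
    proof -
      have "(\<Sum>k\<le>2 ^ m. emeasure I1 (B \<inter> D1.cell m k)) = emeasure I1 (\<Union>k\<le>2 ^ m. B \<inter> D1.cell m k)"
      proof (rule sum_emeasure)
        show "(\<lambda>k. B \<inter> D1.cell m k) ` {..2 ^ m} \<subseteq> sets I1" using B by auto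
        show "disjoint_family_on (\<lambda>k. B \<inter> D1.cell m k) {..2 ^ m}"
          by (auto simp: disjoint_family_on_def dyad_cell)
      qed simp
      also have "(\<Union>k\<le>2 ^ m. B \<inter> D1.cell m k) = B"
        using sets.sets_into_space[OF B] dyad_le_power by (auto simp: D1.cell_def)
      finally show ?thesis by simp
    qed
    have piece: "emeasure I1 ((\<phi> -` A \<inter> space I1) \<inter> D1.cell m k) = emeasure I1 (A \<inter> D1.cell m (\<sigma> k))" for k
    proof -
      let ?t = "(real (\<sigma> k) - real k) / 2 ^ m"
      have "(\<phi> -` A \<inter> space I1) \<inter> D1.cell m k = (+) ?t -` (A \<inter> D1.cell m (\<sigma> k))"
      proof (intro set_eqI iffI)
        fix x assume x: "x \<in> (\<phi> -` A \<inter> space I1) \<inter> D1.cell m k"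
        then have "dyad m x = k" "x \<in> {0..1}" by (auto simp: dyad_cell)
        moreover from this have "\<phi> x = ?t + x" by (simp add: \<phi>_def)
        ultimately show "x \<in> (+) ?t -` (A \<inter> D1.cell m (\<sigma> k))"
          using x dy[of x] unit[of x] by (auto simp: dyad_cell)
      next
        fix x assume "x \<in> (+) ?t -` (A \<inter> D1.cell m (\<sigma> k))"
        then have y: "?t + x \<in> A" "?t + x \<in> {0..1}" "dyad m (?t + x) = \<sigma> k" by (auto simp: dyad_cell)
        have "2 ^ m * (?t + x) = real (\<sigma> k) - real k + 2 ^ m * x" by (simp add: distrib_left)
        moreover have "real (\<sigma> k) \<le> 2 ^ m * (?t + x)" "2 ^ m * (?t + x) < real (\<sigma> k) + 1"
          using y(2,3) dyad_eq_iff[of "?t + x" m "\<sigma> k"] by auto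
        ultimately have k: "real k \<le> 2 ^ m * x" "2 ^ m * x < real k + 1" by linarith+
        then have "0 \<le> 2 ^ m * x" using of_nat_0_le_iff[of k] by linarith
        then have x0: "0 \<le> x" using zero_le_mult_iff[of "2 ^ m" x] zero_less_power[of "2::real" m] by linarith
        have dx: "dyad m x = k" using k dyad_eq_iff[OF x0] by blast
        have "x \<le> 1"
        proof (cases "k < 2 ^ m")
          case True
          then have "real k + 1 \<le> 2 ^ m" using of_nat_mono[OF Suc_leI, where 'a = real] by fastforce
          then have "2 ^ m * x \<le> 2 ^ m" using k by linarith
          then show ?thesis by simp
        next
          case False
          then have "\<sigma> k = k" using \<sigma> by (simp add: permutes_not_in)
          then show ?thesis using y(2) by simp
        qed
        moreover have "\<phi> x = ?t + x" using dx by (simp add: \<phi>_def)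
        ultimately show "x \<in> (\<phi> -` A \<inter> space I1) \<inter> D1.cell m k"
          using x0 dx y by (auto simp: dyad_cell)
      qed
      moreover have B: "A \<inter> D1.cell m (\<sigma> k) \<in> sets borel" using A D1.cell_sets[of m "\<sigma> k"] by (auto simp: sets_I1)
      moreover have "emeasure lborel ((+) ?t -` (A \<inter> D1.cell m (\<sigma> k))) = emeasure lborel (A \<inter> D1.cell m (\<sigma> k))"
      proof -
        have "emeasure (distr lborel borel ((+) ?t)) (A \<inter> D1.cell m (\<sigma> k))
            = emeasure lborel ((+) ?t -` (A \<inter> D1.cell m (\<sigma> k)) \<inter> space lborel)"
          by (rule emeasure_distr) (use B in auto)
        then show ?thesis by (simp add: lborel_distr_plus)
      qed
      moreover have "(\<phi> -` A \<inter> space I1) \<inter> D1.cell m k \<in> sets I1"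
        by (rule sets.Int[OF measurable_sets[OF meas A] D1.cell_sets])
      moreover have "A \<inter> D1.cell m (\<sigma> k) \<in> sets I1" using A by auto
      ultimately show ?thesis by (simp add: emeasure_I1)
    qed
    have "emeasure (distr I1 I1 \<phi>) A = emeasure I1 (\<phi> -` A \<inter> space I1)"
      by (rule emeasure_distr[OF meas A])
    also have "\<dots> = (\<Sum>k\<le>2 ^ m. emeasure I1 (A \<inter> D1.cell m (\<sigma> k)))"
      by (subst split[OF measurable_sets[OF meas A]]) (simp only: piece)
    also have "\<dots> = (\<Sum>k\<le>2 ^ m. emeasure I1 (A \<inter> D1.cell m k))"
      using sum.permute[OF \<sigma>', of "\<lambda>k. emeasure I1 (A \<inter> D1.cell m k)"] by (simp add: comp_def)
    also have "\<dots> = emeasure I1 A" by (rule split[OF A, symmetric])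
    finally show "emeasure (distr I1 I1 \<phi>) A = emeasure I1 A" .
  qed simp
  with meas show "mpt \<phi>" by (simp add: mpt_def)
qed

lemma permute_dyads:
  assumes \<sigma>: "\<sigma> permutes {..<2 ^ m}"
  shows "\<exists>\<phi>. aut \<phi> \<and> (\<forall>x\<in>{0..1}. dyad m (\<phi> x) = \<sigma> (dyad m x))"
proof -
  define shift where "shift \<sigma> x = x + (real (\<sigma> (dyad m x)) - real (dyad m x)) / 2 ^ m" for \<sigma> :: "nat \<Rightarrow> nat" and x
  have shift: "mpt (shift \<tau>)" "\<And>x. x \<in> {0..1} \<Longrightarrow> dyad m (shift \<tau> x) = \<tau> (dyad m x)"
    if "\<tau> permutes {..<2 ^ m}" for \<tau>
    using permute_dyads_mpt[OF that] unfolding shift_def by blast+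
  have inv: "shift \<tau> (shift \<tau>' x) = x"
    if "\<tau>' permutes {..<2 ^ m}" "\<And>k. \<tau> (\<tau>' k) = k" "x \<in> {0..1}" for \<tau> \<tau>' x
  proof -
    have "shift \<tau> (shift \<tau>' x)
        = shift \<tau>' x + (real (\<tau> (\<tau>' (dyad m x))) - real (\<tau>' (dyad m x))) / 2 ^ m"
      unfolding shift_def[of \<tau>] by (simp only: shift(2)[OF that(1,3)])
    also have "\<dots> = x" unfolding that(2) shift_def by (simp add: diff_divide_distrib)
    finally show ?thesis .
  qed
  note \<sigma>' = permutes_inv[OF \<sigma>]
  have "aut (shift \<sigma>)"
    unfolding aut_def
  proof (intro conjI exI[of _ "shift (inv \<sigma>)"] ballI)
    fix x :: real assume x: "x \<in> {0..1}"
    show "shift (inv \<sigma>) (shift \<sigma> x) = x" using \<sigma> x by (intro inv) (simp_all add: permutes_inverses)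
    show "shift \<sigma> (shift (inv \<sigma>) x) = x" using \<sigma> \<sigma>' x by (intro inv) (simp_all add: permutes_inverses)
  qed (intro shift \<sigma> \<sigma>')+
  then show ?thesis using shift(2)[OF \<sigma>] by blast
qed

lemma label_sets:
  assumes "p \<in> I1 \<rightarrow>\<^sub>M count_space UNIV"
  shows "{x\<in>{0..1}. p x \<in> T} \<in> sets I1"
proof -
  have "{x\<in>{0..1}. p x \<in> T} = p -` T \<inter> space I1" by auto
  then show ?thesis using measurable_sets[OF assms, of T] by simp
qed

text \<open>The labels may come from an uncountable type, so the set is assembled from the finitely
  many values in \<open>S\<close>.\<close>

lemma label_neq_sets:
  assumes S: "finite S" and p: "p \<in> I1 \<rightarrow>\<^sub>M count_space UNIV" and q: "q \<in> I1 \<rightarrow>\<^sub>M count_space UNIV"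
    and pS: "\<And>x. x \<in> {0..1} \<Longrightarrow> p x \<in> S"
  shows "{x\<in>{0..1}. p x \<noteq> q x} \<in> sets I1"
proof -
  have "{x\<in>{0..1}. p x \<noteq> q x} = (\<Union>k\<in>S. {x\<in>{0..1}. p x \<in> {k}} \<inter> {x\<in>{0..1}. q x \<in> - {k}})"
    using pS by auto
  also have "\<dots> \<in> sets I1"
    by (intro sets.finite_UN S sets.Int label_sets p q)
  finally show ?thesis .
qed

text \<open>Majority vote: each dyadic cell takes a label occupying more than half of it. Where
  \<open>p\<close> disagrees with the vote, the indicator of some label differs from its cell
  average by at least 1/2. So the bad set measures at most twice the sum of the averaging errors,
  which tends to 0.\<close>

lemma dyad_label_approx:
  assumes S: "finite S" and p: "p \<in> I1 \<rightarrow>\<^sub>M count_space UNIV" and pS: "\<And>x. x \<in> {0..1} \<Longrightarrow> p x \<in> S"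
    and "\<eta> > 0"
  shows "\<exists>N. \<forall>m\<ge>N. \<exists>P. (\<forall>i. P i \<in> S) \<and> measure I1 {x\<in>{0..1}. p x \<noteq> P (dyad m x)} \<le> \<eta>"
proof -
  define u where "u k x = (indicator {k} (p x) :: real)" for k x
  have um: "u k \<in> borel_measurable I1" for k
    unfolding u_def by (rule measurable_compose[OF p]) simp
  have ui: "integrable I1 (u k)" for k
    using um by (intro D1.integrable_bounded[of _ 1]) (auto simp: u_def indicator_def)
  have "(\<lambda>m. 2 * (\<Sum>k\<in>S. LINT x|I1. \<bar>u k x - D1.cexp m (u k) x\<bar>)) \<longlonglongrightarrow> 2 * (\<Sum>k\<in>S. 0)"
    by (intro tendsto_intros D1.cexp_tendsto ui)
  from order_tendstoD(2)[OF this, of \<eta>] \<open>\<eta> > 0\<close>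
  obtain N where N: "\<And>m. m \<ge> N \<Longrightarrow> 2 * (\<Sum>k\<in>S. LINT x|I1. \<bar>u k x - D1.cexp m (u k) x\<bar>) < \<eta>"
    by (auto simp: eventually_sequentially)
  show ?thesis
  proof (intro exI[of _ N] allI impI)
    fix m assume "N \<le> m"
    \<comment> \<open>Cells without a majority take the arbitrary label \<open>p 0\<close>, which
      lies in \<open>S\<close>; all of their points count as errors already.\<close>
    define P where "P i = (if \<exists>k\<in>S. D1.cavg m (u k) i > 1 / 2 then SOME k. k \<in> S \<and> D1.cavg m (u k) i > 1 / 2 else p 0)" for i
    have Pc: "P i \<in> S \<and> D1.cavg m (u (P i)) i > 1 / 2" if "\<exists>k\<in>S. D1.cavg m (u k) i > 1 / 2" for i
      using that someI_ex[of "\<lambda>k. k \<in> S \<and> D1.cavg m (u k) i > 1 / 2"] unfolding P_def by auto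
    have PS: "P i \<in> S" for i using Pc[of i] pS[of 0] by (cases "\<exists>k\<in>S. D1.cavg m (u k) i > 1 / 2") (auto simp: P_def)
    let ?B = "{x\<in>{0..1}. p x \<noteq> P (dyad m x)}"
    have B: "?B \<in> sets I1"
      by (rule label_neq_sets[OF S p measurable_compose[OF dyad_measurable] pS]) simp_all
    have "measure I1 ?B = (LINT x|I1. indicator ?B x)" using sets.sets_into_space[OF B] by (simp add: B Int_absorb2)
    also have "\<dots> \<le> (LINT x|I1. 2 * (\<Sum>k\<in>S. \<bar>u k x - D1.cexp m (u k) x\<bar>))"
    proof (rule integral_mono)
      show "integrable I1 (\<lambda>x. 2 * (\<Sum>k\<in>S. \<bar>u k x - D1.cexp m (u k) x\<bar>))"
        by (intro integrable_mult_right Bochner_Integration.integrable_sum integrable_abs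
            Bochner_Integration.integrable_diff ui D1.integrable_cexp)
      fix x assume "x \<in> space I1"
      then have x: "x \<in> {0..1}" by simp
      have nn: "0 \<le> (\<Sum>k\<in>S. \<bar>u k x - D1.cexp m (u k) x\<bar>)" by (intro sum_nonneg) simp
      have mem: "\<bar>u k x - D1.cexp m (u k) x\<bar> \<le> (\<Sum>k\<in>S. \<bar>u k x - D1.cexp m (u k) x\<bar>)" if "k \<in> S" for k
        using S that by (intro member_le_sum) auto
      show "indicator ?B x \<le> 2 * (\<Sum>k\<in>S. \<bar>u k x - D1.cexp m (u k) x\<bar>)"
      proof (cases "x \<in> ?B")
        case True
        then have ne: "p x \<noteq> P (dyad m x)" by simp
        have "\<exists>k\<in>S. \<bar>u k x - D1.cexp m (u k) x\<bar> \<ge> 1 / 2"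
        proof (cases "D1.cavg m (u (p x)) (dyad m x) > 1 / 2")
          case True
          then have ex: "\<exists>k\<in>S. D1.cavg m (u k) (dyad m x) > 1 / 2" using pS[OF x] by blast
          have "u (P (dyad m x)) x = 0" using ne by (auto simp: u_def indicator_def)
          then show ?thesis using Pc[OF ex] by (intro bexI[of _ "P (dyad m x)"]) (auto simp: D1.cexp_def)
        next
          case False
          then show ?thesis using pS[OF x] by (intro bexI[of _ "p x"]) (auto simp: D1.cexp_def u_def)
        qed
        then obtain k where "k \<in> S" "\<bar>u k x - D1.cexp m (u k) x\<bar> \<ge> 1 / 2" by blast
        with mem[of k] True show ?thesis by simp
      qed (use nn in auto)
    qed (use B in \<open>auto intro: D1.integrable_ind\<close>)
    also have "\<dots> = 2 * (\<Sum>k\<in>S. LINT x|I1. \<bar>u k x - D1.cexp m (u k) x\<bar>)"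
      by (subst integral_mult_right_zero, subst Bochner_Integration.integral_sum)
        (auto intro!: integrable_abs Bochner_Integration.integrable_diff ui D1.integrable_cexp)
    also have "\<dots> \<le> \<eta>" using N[OF \<open>N \<le> m\<close>] by simp
    finally show "\<exists>P. (\<forall>i. P i \<in> S) \<and> measure I1 {x\<in>{0..1}. p x \<noteq> P (dyad m x)} \<le> \<eta>"
      using PS by (intro exI[of _ P]) auto
  qed
qed

text \<open>For each label, as many positions as possible with \<open>Q\<close>-value
  \<open>k\<close> are sent injectively to positions with \<open>P\<close>-value \<open>k\<close>,
  and any bijection matches the rest. Mismatches occur only among the surplus of
  \<open>Q\<close>-positions for each label.\<close>

lemma match_permutation:
  fixes P Q :: "nat \<Rightarrow> 'b"
  assumes S: "finite S" and PS: "\<And>i. P i \<in> S" and QS: "\<And>i. Q i \<in> S"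
  shows "\<exists>\<sigma>. \<sigma> permutes {..<n} \<and> real (card {i\<in>{..<n}. P (\<sigma> i) \<noteq> Q i})
    \<le> (\<Sum>k\<in>S. \<bar>real (card {i\<in>{..<n}. P i = k}) - real (card {i\<in>{..<n}. Q i = k})\<bar>)"
proof -
  define A where "A k = {i\<in>{..<n}. Q i = k}" for k
  define B where "B k = {i\<in>{..<n}. P i = k}" for k
  have finAB: "finite (A k)" "finite (B k)" for k by (simp_all add: A_def B_def)
  have "\<exists>A' g. A' \<subseteq> A k \<and> inj_on g A' \<and> g ` A' \<subseteq> B k \<and> card A' = min (card (A k)) (card (B k))" for k
  proof -
    have "min (card (A k)) (card (B k)) \<le> card (A k)" by simp
    then obtain A' where A': "A' \<subseteq> A k" "card A' = min (card (A k)) (card (B k))"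
      by (rule obtain_subset_with_card_n)
    have "finite A'" using A'(1) finAB finite_subset by blast
    moreover have "card A' \<le> card (B k)" using A' by simp
    ultimately obtain g where "g ` A' \<subseteq> B k" "inj_on g A'"
      using card_le_inj[of A' "B k"] finAB by blast
    then show ?thesis using A' by blast
  qed
  then obtain A' g where A': "\<And>k. A' k \<subseteq> A k" and inj: "\<And>k. inj_on (g k) (A' k)"
    and gB: "\<And>k. g k ` A' k \<subseteq> B k" and cA': "\<And>k. card (A' k) = min (card (A k)) (card (B k))"
    by metis
  define D where "D = (\<Union>k\<in>S. A' k)"
  define h where "h i = g (Q i) i" for i
  have D_mem: "i \<in> A' (Q i)" "i < n" if "i \<in> D" for i
    using that A' unfolding D_def A_def by auto
  have Ph: "P (h i) = Q i" "h i < n" if "i \<in> D" for i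
    using gB[of "Q i"] D_mem[OF that] unfolding h_def B_def by auto
  have inj_h: "inj_on h D"
  proof (rule inj_onI)
    fix i j assume ij: "i \<in> D" "j \<in> D" "h i = h j"
    then have "Q i = Q j" using Ph by metis
    then show "i = j" using ij D_mem inj unfolding h_def inj_on_def by metis
  qed
  have D_sub: "D \<subseteq> {..<n}" using D_mem by auto
  have hD_sub: "h ` D \<subseteq> {..<n}" using Ph by auto
  have "finite D" using D_sub finite_subset by blast
  then have "card ({..<n} - D) = card ({..<n} - h ` D)"
    using D_sub hD_sub by (simp add: card_Diff_subset card_image[OF inj_h])
  then obtain r where r: "bij_betw r ({..<n} - D) ({..<n} - h ` D)"
    using finite_same_card_bij[of "{..<n} - D" "{..<n} - h ` D"] by auto
  define \<sigma> where "\<sigma> i = (if i \<in> D then h i else if i < n then r i else i)" for i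
  have "bij_betw \<sigma> (D \<union> ({..<n} - D)) (h ` D \<union> ({..<n} - h ` D))"
  proof (rule bij_betw_combine)
    show "bij_betw \<sigma> D (h ` D)"
      using inj_h by (subst bij_betw_cong[of D \<sigma> h]) (auto simp: \<sigma>_def bij_betw_def)
    show "bij_betw \<sigma> ({..<n} - D) ({..<n} - h ` D)"
      using r by (subst bij_betw_cong[of _ \<sigma> r]) (auto simp: \<sigma>_def)
  qed auto
  then have "bij_betw \<sigma> {..<n} {..<n}" using D_sub hD_sub by (simp add: Un_absorb1)
  then have perm: "\<sigma> permutes {..<n}"
    by (rule bij_imp_permutes) (use D_sub in \<open>auto simp: \<sigma>_def\<close>)
  have "{i\<in>{..<n}. P (\<sigma> i) \<noteq> Q i} \<subseteq> (\<Union>k\<in>S. A k - A' k)"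
  proof
    fix i assume i: "i \<in> {i\<in>{..<n}. P (\<sigma> i) \<noteq> Q i}"
    then have "i \<notin> D" using Ph by (auto simp: \<sigma>_def)
    then show "i \<in> (\<Union>k\<in>S. A k - A' k)" using i QS by (auto simp: D_def A_def)
  qed
  then have "card {i\<in>{..<n}. P (\<sigma> i) \<noteq> Q i} \<le> card (\<Union>k\<in>S. A k - A' k)"
    using S finAB by (intro card_mono) auto
  also have "\<dots> \<le> (\<Sum>k\<in>S. card (A k - A' k))" by (rule card_UN_le[OF S])
  finally have "real (card {i\<in>{..<n}. P (\<sigma> i) \<noteq> Q i}) \<le> (\<Sum>k\<in>S. real (card (A k - A' k)))"
    by (simp flip: of_nat_sum)
  also have "\<dots> \<le> (\<Sum>k\<in>S. \<bar>real (card (B k)) - real (card (A k))\<bar>)"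
  proof (rule sum_mono)
    fix k
    have "card (A k - A' k) = card (A k) - card (A' k)"
      by (rule card_Diff_subset) (use A' finAB finite_subset in blast)+
    then show "real (card (A k - A' k)) \<le> \<bar>real (card (B k)) - real (card (A k))\<bar>"
      unfolding cA' by auto
  qed
  finally show ?thesis using perm unfolding A_def B_def by blast
qed

lemma measure_label_diff:
  assumes S: "finite S" and p: "p \<in> I1 \<rightarrow>\<^sub>M count_space UNIV" and q: "q \<in> I1 \<rightarrow>\<^sub>M count_space UNIV"
    and pS: "\<And>x. x \<in> {0..1} \<Longrightarrow> p x \<in> S"
  shows "\<bar>measure I1 {x\<in>{0..1}. p x \<in> T} - measure I1 {x\<in>{0..1}. q x \<in> T}\<bar> \<le> measure I1 {x\<in>{0..1}. p x \<noteq> q x}"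
proof -
  let ?D = "{x\<in>{0..1}. p x \<noteq> q x}" and ?p = "{x\<in>{0..1}. p x \<in> T}" and ?q = "{x\<in>{0..1}. q x \<in> T}"
  have m: "?D \<in> sets I1" "?p \<in> sets I1" "?q \<in> sets I1"
    by (rule label_neq_sets[OF S p q pS] label_sets[OF p] label_sets[OF q]; simp)+
  have "measure I1 ?p \<le> measure I1 (?q \<union> ?D)" "measure I1 ?q \<le> measure I1 (?p \<union> ?D)"
    using m by (intro I1.finite_measure_mono; auto)+
  moreover have "measure I1 (?q \<union> ?D) \<le> measure I1 ?q + measure I1 ?D"
    "measure I1 (?p \<union> ?D) \<le> measure I1 ?p + measure I1 ?D"
    using m by (auto intro!: measure_Un_le)
  ultimately show ?thesis by linarith
qed

text \<open>Both labellings are close to dyadic step functions; counting the dyadic intervals with each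
  label gives a permutation of intervals that matches the step functions.\<close>

lemma conjugate_labels:
  assumes S: "finite S" and p: "p \<in> I1 \<rightarrow>\<^sub>M count_space UNIV" and q: "q \<in> I1 \<rightarrow>\<^sub>M count_space UNIV"
    and pS: "\<And>x. x \<in> {0..1} \<Longrightarrow> p x \<in> S" and qS: "\<And>x. x \<in> {0..1} \<Longrightarrow> q x \<in> S"
    and e: "e > 0"
  shows "\<exists>\<phi>. aut \<phi> \<and> measure I1 {x\<in>{0..1}. p (\<phi> x) \<noteq> q x}
    \<le> e + (\<Sum>k\<in>S. \<bar>measure I1 {x\<in>{0..1}. p x = k} - measure I1 {x\<in>{0..1}. q x = k}\<bar>)"
proof -
  \<comment> \<open>Approximating the two labellings costs \<open>2 * \<eta>\<close> directly, and
    another \<open>2 * \<eta>\<close> for each label when measures are replaced by counts.\<close>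
  define \<eta> where "\<eta> = e / (2 + 2 * real (card S))"
  have \<eta>: "\<eta> > 0" using e by (simp add: \<eta>_def add_pos_nonneg)
  obtain N1 where N1: "\<And>m. m \<ge> N1 \<Longrightarrow> \<exists>P. (\<forall>i. P i \<in> S) \<and> measure I1 {x\<in>{0..1}. p x \<noteq> P (dyad m x)} \<le> \<eta>"
    using dyad_label_approx[OF S p pS \<eta>] by blast
  obtain N2 where N2: "\<And>m. m \<ge> N2 \<Longrightarrow> \<exists>P. (\<forall>i. P i \<in> S) \<and> measure I1 {x\<in>{0..1}. q x \<noteq> P (dyad m x)} \<le> \<eta>"
    using dyad_label_approx[OF S q qS \<eta>] by blast
  define m where "m = max N1 N2"
  obtain P where P: "\<And>i. P i \<in> S" "measure I1 {x\<in>{0..1}. p x \<noteq> P (dyad m x)} \<le> \<eta>"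
    using N1[of m] by (auto simp: m_def)
  obtain Q where Q: "\<And>i. Q i \<in> S" "measure I1 {x\<in>{0..1}. q x \<noteq> Q (dyad m x)} \<le> \<eta>"
    using N2[of m] by (auto simp: m_def)
  obtain \<sigma> where \<sigma>: "\<sigma> permutes {..<2 ^ m}" and mis: "real (card {i\<in>{..<2 ^ m}. P (\<sigma> i) \<noteq> Q i})
    \<le> (\<Sum>k\<in>S. \<bar>real (card {i\<in>{..<2 ^ m}. P i = k}) - real (card {i\<in>{..<2 ^ m}. Q i = k})\<bar>)"
    using match_permutation[of S P Q "2 ^ m", OF S P(1) Q(1)] by blast
  obtain \<phi> where \<phi>: "aut \<phi>" "\<And>x. x \<in> {0..1} \<Longrightarrow> dyad m (\<phi> x) = \<sigma> (dyad m x)"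
    using permute_dyads[OF \<sigma>] by blast
  have mpt: "mpt \<phi>" by (rule aut_mpt[OF \<phi>(1)])
  have lab: "(\<lambda>x. R (dyad m x)) \<in> I1 \<rightarrow>\<^sub>M count_space UNIV" for R :: "nat \<Rightarrow> 'a"
    by (rule measurable_compose[OF dyad_measurable]) simp
  let ?A = "{x\<in>{0..1}. \<phi> x \<in> {x\<in>{0..1}. p x \<noteq> P (dyad m x)}}"
  let ?B = "{x\<in>{0..1}. dyad m x \<in> {i. P (\<sigma> i) \<noteq> Q i}}"
  let ?C = "{x\<in>{0..1}. q x \<noteq> Q (dyad m x)}"
  have pP: "{x\<in>{0..1}. p x \<noteq> P (dyad m x)} \<in> sets I1" by (rule label_neq_sets[OF S p lab pS])
  have A: "?A \<in> sets I1"
  proof -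
    have "\<phi> -` {x\<in>{0..1}. p x \<noteq> P (dyad m x)} \<inter> space I1 \<in> sets I1"
      using mpt pP by (intro measurable_sets) (auto simp: mpt_def)
    moreover have "?A = \<phi> -` {x\<in>{0..1}. p x \<noteq> P (dyad m x)} \<inter> space I1" by auto
    ultimately show ?thesis by (simp only:)
  qed
  have B: "?B \<in> sets I1" by (rule label_sets) simp
  have C: "?C \<in> sets I1" by (rule label_neq_sets[OF S q lab qS])
  have PQ: "\<bar>real (card {i\<in>{..<2 ^ m}. P i = k}) - real (card {i\<in>{..<2 ^ m}. Q i = k})\<bar> / 2 ^ m
      \<le> \<bar>measure I1 {x\<in>{0..1}. p x = k} - measure I1 {x\<in>{0..1}. q x = k}\<bar> + 2 * \<eta>" for k
  proof -
    have e: "real (card {i\<in>{..<2 ^ m}. R i = k}) / 2 ^ m = measure I1 {x\<in>{0..1}. R (dyad m x) \<in> {k}}" for R :: "nat \<Rightarrow> 'a"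
    proof -
      have "{i. R i = k} \<inter> {..<2 ^ m} = {i\<in>{..<2 ^ m}. R i = k}" by auto
      then show ?thesis using measure_dyad_vimage[of m "{i. R i = k}"] by simp
    qed
    have "\<bar>real (card {i\<in>{..<2 ^ m}. P i = k}) - real (card {i\<in>{..<2 ^ m}. Q i = k})\<bar> / 2 ^ m
        = \<bar>measure I1 {x\<in>{0..1}. P (dyad m x) \<in> {k}} - measure I1 {x\<in>{0..1}. Q (dyad m x) \<in> {k}}\<bar>"
      unfolding e[symmetric] diff_divide_distrib[symmetric] abs_divide by simp
    moreover have "\<bar>measure I1 {x\<in>{0..1}. p x \<in> {k}} - measure I1 {x\<in>{0..1}. P (dyad m x) \<in> {k}}\<bar> \<le> \<eta>"
      using measure_label_diff[OF S p lab pS, of "{k}" P] P(2) by linarith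
    moreover have "\<bar>measure I1 {x\<in>{0..1}. q x \<in> {k}} - measure I1 {x\<in>{0..1}. Q (dyad m x) \<in> {k}}\<bar> \<le> \<eta>"
      using measure_label_diff[OF S q lab qS, of "{k}" Q] Q(2) by linarith
    ultimately show ?thesis unfolding singleton_iff by linarith
  qed
  have "measure I1 ?B = real (card {i\<in>{..<2 ^ m}. P (\<sigma> i) \<noteq> Q i}) / 2 ^ m"
  proof -
    have "{i. P (\<sigma> i) \<noteq> Q i} \<inter> {..<2 ^ m} = {i\<in>{..<2 ^ m}. P (\<sigma> i) \<noteq> Q i}" by auto
    then show ?thesis using measure_dyad_vimage[of m "{i. P (\<sigma> i) \<noteq> Q i}"] by (simp only:)
  qed
  also have "\<dots> \<le> (\<Sum>k\<in>S. \<bar>real (card {i\<in>{..<2 ^ m}. P i = k}) - real (card {i\<in>{..<2 ^ m}. Q i = k})\<bar>) / 2 ^ m"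
    using mis by (intro divide_right_mono) simp_all
  also have "\<dots> \<le> (\<Sum>k\<in>S. \<bar>measure I1 {x\<in>{0..1}. p x = k} - measure I1 {x\<in>{0..1}. q x = k}\<bar> + 2 * \<eta>)"
    unfolding sum_divide_distrib by (intro sum_mono PQ)
  finally have mB: "measure I1 ?B \<le> (\<Sum>k\<in>S. \<bar>measure I1 {x\<in>{0..1}. p x = k} - measure I1 {x\<in>{0..1}. q x = k}\<bar>) + 2 * real (card S) * \<eta>"
    by (simp add: sum.distrib)
  have mA: "measure I1 ?A \<le> \<eta>" using mpt_vimage_measure[OF mpt pP] P(2) by simp
  \<comment> \<open>A mismatch at \<open>x\<close> needs one of three failures: the step function
    for \<open>p\<close> at \<open>\<phi> x\<close>, the matching of the steps, or the step function
    for \<open>q\<close> at \<open>x\<close>.\<close>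
  have sub: "{x\<in>{0..1}. p (\<phi> x) \<noteq> q x} \<subseteq> (?A \<union> ?B) \<union> ?C"
  proof
    fix x assume x: "x \<in> {x\<in>{0..1}. p (\<phi> x) \<noteq> q x}"
    then have "x \<in> {0..1}" by simp
    from x \<phi>(2)[OF this] mpt_unit[OF mpt this] show "x \<in> (?A \<union> ?B) \<union> ?C" by auto
  qed
  have "measure I1 {x\<in>{0..1}. p (\<phi> x) \<noteq> q x} \<le> measure I1 ((?A \<union> ?B) \<union> ?C)"
    by (rule I1.finite_measure_mono[OF sub]) (intro sets.Un A B C)
  also have "\<dots> \<le> (measure I1 ?A + measure I1 ?B) + measure I1 ?C"
    using measure_Un_le[OF sets.Un[OF A B] C] measure_Un_le[OF A B] by linarith
  also have "\<dots> \<le> (2 + 2 * real (card S)) * \<eta> + (\<Sum>k\<in>S. \<bar>measure I1 {x\<in>{0..1}. p x = k} - measure I1 {x\<in>{0..1}. q x = k}\<bar>)"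
    using mA mB Q(2) by (simp add: algebra_simps)
  also have "(2 + 2 * real (card S)) * \<eta> = e" unfolding \<eta>_def by (simp add: add_nonneg_eq_0_iff)
  finally show ?thesis using \<phi>(1) by blast
qed

subsection \<open>Borel graphons, weak-star convergence and the cut norm\<close>

definition bgraphon :: "(real \<times> real \<Rightarrow> real) \<Rightarrow> bool" where
  "bgraphon U \<longleftrightarrow> U \<in> borel_measurable I2 \<and> (\<forall>z\<in>space I2. U z \<in> {0..1}) \<and>
     (\<forall>x\<in>{0..1}. \<forall>y\<in>{0..1}. U (x, y) = U (y, x))"

definition wconv :: "(nat \<Rightarrow> real \<times> real \<Rightarrow> real) \<Rightarrow> (real \<times> real \<Rightarrow> real) \<Rightarrow> bool" where
  "wconv U W \<longleftrightarrow> (\<forall>g. integrable I2 g \<longrightarrow>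
     (\<lambda>n. LINT z|I2. U n z * g z) \<longlonglongrightarrow> (LINT z|I2. W z * g z))"

definition rect :: "real set \<Rightarrow> real set \<Rightarrow> real \<times> real \<Rightarrow> real" where
  "rect A B z = indicator A (fst z) * indicator B (snd z)"

definition cutI :: "(real \<times> real \<Rightarrow> real) \<Rightarrow> real set \<Rightarrow> real" where
  "cutI U A = (LINT z|I2. rect A A z * U z)"

text \<open>A bound on the cut norm stated without a supremum, which avoids side conditions on
  boundedness.\<close>

definition cutle :: "(real \<times> real \<Rightarrow> real) \<Rightarrow> real \<Rightarrow> bool" where
  "cutle U e \<longleftrightarrow> (\<forall>A\<in>sets I1. \<bar>cutI U A\<bar> \<le> e)"

lemma bgraphon_measurable [measurable_dest]: "bgraphon U \<Longrightarrow> U \<in> borel_measurable I2"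
  by (simp add: bgraphon_def)

lemma bgraphon_unit: "bgraphon U \<Longrightarrow> z \<in> space I2 \<Longrightarrow> U z \<in> {0..1}"
  unfolding bgraphon_def by blast

lemma bgraphon_integrable: "bgraphon U \<Longrightarrow> integrable I2 U"
  by (rule D2.integrable_unit) (auto simp: bgraphon_def)

lemma bgraphon_cavg: "bgraphon U \<Longrightarrow> D2.cavg m U k \<in> {0..1}"
  by (rule D2.cavg_unit) (auto simp: bgraphon_def)

lemma square_mpt:
  "mpt \<phi> \<Longrightarrow> z \<in> space I2 \<Longrightarrow> (\<phi> (fst z), \<phi> (snd z)) \<in> space I2"
  using mpt_unit[of \<phi> "fst z"] mpt_unit[of \<phi> "snd z"] by auto

lemma bgraphon_pull: "bgraphon U \<Longrightarrow> mpt \<phi> \<Longrightarrow> bgraphon (pull \<phi> U)"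
  unfolding bgraphon_def
  using pull_measurable[of \<phi> U] square_mpt[of \<phi>] mpt_unit[of \<phi>]
  by (auto simp: pull_def)

lemma pull_pull: "pull \<psi> (pull \<phi> U) = pull (\<lambda>x. \<phi> (\<psi> x)) U"
  by (simp add: pull_def fun_eq_iff)

lemma rect_measurable [measurable]: "A \<in> sets I1 \<Longrightarrow> B \<in> sets I1 \<Longrightarrow> rect A B \<in> borel_measurable I2"
  unfolding rect_def
  by (intro borel_measurable_times measurable_compose[OF fst_I2 borel_measurable_indicator]
      measurable_compose[OF snd_I2 borel_measurable_indicator])

lemma rect_unit: "rect A B z \<in> {0..1}"
  by (simp add: rect_def indicator_def)

lemma integrable_rect: "A \<in> sets I1 \<Longrightarrow> B \<in> sets I1 \<Longrightarrow> integrable I2 (rect A B)"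
  by (intro D2.integrable_unit rect_measurable rect_unit)

lemma integrable_rect_mult:
  "A \<in> sets I1 \<Longrightarrow> B \<in> sets I1 \<Longrightarrow> integrable I2 U \<Longrightarrow> integrable I2 (\<lambda>z. rect A B z * U z)"
  by (intro D2.integrable_unit_mult rect_measurable rect_unit)

lemma wconv_subseq: "wconv U W \<Longrightarrow> strict_mono r \<Longrightarrow> wconv (\<lambda>n. U (r n)) W"
  unfolding wconv_def using LIMSEQ_subseq_LIMSEQ[of _ _ r, unfolded comp_def] by blast

lemma wconv_rect:
  assumes "wconv U W" "A \<in> sets I1" "B \<in> sets I1"
  shows "(\<lambda>n. LINT z|I2. rect A B z * U n z) \<longlonglongrightarrow> (LINT z|I2. rect A B z * W z)"
proof -
  have "(\<lambda>n. LINT z|I2. U n z * rect A B z) \<longlonglongrightarrow> (LINT z|I2. W z * rect A B z)"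
    using assms(1) integrable_rect[OF assms(2,3)] unfolding wconv_def by blast
  then show ?thesis by (simp add: mult.commute)
qed

lemma cutI_diff:
  assumes "integrable I2 U" "integrable I2 V" "A \<in> sets I1"
  shows "cutI (\<lambda>z. U z - V z) A = cutI U A - cutI V A"
  using integrable_rect_mult[OF assms(3,3,1)] integrable_rect_mult[OF assms(3,3,2)]
  unfolding cutI_def by (simp add: right_diff_distrib)

lemma wconv_cutI:
  assumes "wconv U W" "\<And>n. integrable I2 (U n)" "integrable I2 W" "integrable I2 V" "A \<in> sets I1"
  shows "(\<lambda>n. cutI (\<lambda>z. U n z - V z) A) \<longlonglongrightarrow> cutI (\<lambda>z. W z - V z) A"
proof -
  have "(\<lambda>n. cutI (U n) A - cutI V A) \<longlonglongrightarrow> cutI W A - cutI V A"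
    using wconv_rect[OF assms(1,5,5)] unfolding cutI_def by (intro tendsto_intros)
  then show ?thesis using assms by (simp add: cutI_diff)
qed

lemma cutI_le_L1:
  assumes "integrable I2 U" "A \<in> sets I1"
  shows "\<bar>cutI U A\<bar> \<le> (LINT z|I2. \<bar>U z\<bar>)"
proof -
  have "\<bar>cutI U A\<bar> \<le> (LINT z|I2. \<bar>rect A A z * U z\<bar>)"
    unfolding cutI_def by (rule integral_abs_bound)
  also have "\<dots> \<le> (LINT z|I2. \<bar>U z\<bar>)"
    by (intro integral_mono integrable_abs integrable_rect_mult assms)
      (simp add: abs_mult rect_def indicator_def)
  finally show ?thesis .
qed

text \<open>The weak limit \<open>V\<close> need not be symmetric pointwise, so it is averaged with
  its reflection. Since the \<open>U n\<close> are symmetric, testing against \<open>g\<close> or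
  its reflection gives the same numbers, and the average is still the limit.\<close>

lemma bgraphon_compact:
  fixes U :: "nat \<Rightarrow> real \<times> real \<Rightarrow> real"
  assumes U: "\<And>n. bgraphon (U n)"
  shows "\<exists>r W. strict_mono r \<and> bgraphon W \<and> wconv (\<lambda>n. U (r n)) W"
proof -
  obtain r V where r: "strict_mono r" and Vm: "V \<in> borel_measurable I2" and V01: "\<And>z. V z \<in> {0..1}"
    and lim: "\<And>g. integrable I2 g \<Longrightarrow> (\<lambda>n. LINT z|I2. U (r n) z * g z) \<longlonglongrightarrow> (LINT z|I2. V z * g z)"
    using D2.weak_compactness[of U] U by (auto simp: bgraphon_def)
  let ?s = "\<lambda>z :: real \<times> real. (snd z, fst z)"
  define W where "W z = (V z + V (?s z)) / 2" for z
  have Vs: "(\<lambda>z. V (?s z)) \<in> borel_measurable I2" by (rule measurable_compose[OF swap_I2(1) Vm])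
  have W: "bgraphon W"
    unfolding bgraphon_def
  proof (intro conjI ballI)
    show "W \<in> borel_measurable I2" unfolding W_def using Vm Vs by measurable
    show "W z \<in> {0..1}" for z using V01[of z] V01[of "?s z"] by (auto simp: W_def)
    show "W (x, y) = W (y, x)" for x y by (simp add: W_def)
  qed
  have "wconv (\<lambda>n. U (r n)) W"
    unfolding wconv_def
  proof (intro allI impI)
    fix g :: "real \<times> real \<Rightarrow> real" assume g: "integrable I2 g"
    have gs: "integrable I2 (\<lambda>z. g (?s z))"
      using g integrable_distr[OF swap_I2(1), of g] by (simp add: swap_I2(2))
    have sym: "(LINT z|I2. U n z * g (?s z)) = (LINT z|I2. U n z * g z)" for n
    proof -
      have "(LINT z|I2. U n z * g z) = (LINT z|I2. U n (?s z) * g (?s z))"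
        by (subst integral_swap[symmetric])
          (intro borel_measurable_times bgraphon_measurable U borel_measurable_integrable[OF g], simp)
      also have "\<dots> = (LINT z|I2. U n z * g (?s z))"
        using U[of n] by (intro Bochner_Integration.integral_cong) (auto simp: bgraphon_def)
      finally show ?thesis by simp
    qed
    have swV: "(LINT z|I2. V z * g (?s z)) = (LINT z|I2. V (?s z) * g z)"
      using integral_swap[of "\<lambda>z. V (?s z) * g z"] Vs g by simp
    have "(\<lambda>n. ((LINT z|I2. U (r n) z * g z) + (LINT z|I2. U (r n) z * g (?s z))) / 2)
        \<longlonglongrightarrow> ((LINT z|I2. V z * g z) + (LINT z|I2. V z * g (?s z))) / 2"
      by (intro tendsto_intros lim g gs) simp
    moreover have "((LINT z|I2. V z * g z) + (LINT z|I2. V z * g (?s z))) / 2 = (LINT z|I2. W z * g z)"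
    proof -
      have "integrable I2 (\<lambda>z. V z * g z)" "integrable I2 (\<lambda>z. V (?s z) * g z)"
        using V01 by (intro D2.integrable_unit_mult Vm Vs g; simp)+
      then show ?thesis unfolding swV W_def by (simp add: distrib_right)
    qed
    ultimately show "(\<lambda>n. LINT z|I2. U (r n) z * g z) \<longlonglongrightarrow> (LINT z|I2. W z * g z)"
      by (simp add: sym)
  qed
  then show ?thesis using r W by blast
qed

text \<open>Pull \<open>G\<close> back without changing its integral and compare off
  \<open>N\<close>: the difference is at most 2, on two strips.\<close>

lemma transport_integral:
  assumes \<phi>: "mpt \<phi>" and N: "N \<in> sets I1"
    and G: "G \<in> borel_measurable I2" "\<And>z. z \<in> space I2 \<Longrightarrow> \<bar>G z\<bar> \<le> 1"
    and H: "H \<in> borel_measurable I2" "\<And>z. z \<in> space I2 \<Longrightarrow> \<bar>H z\<bar> \<le> 1"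
    and eq: "\<And>x y. x \<in> {0..1} - N \<Longrightarrow> y \<in> {0..1} - N \<Longrightarrow> G (\<phi> x, \<phi> y) = H (x, y)"
  shows "\<bar>(LINT z|I2. G z) - (LINT z|I2. H z)\<bar> \<le> 4 * measure I1 N"
proof -
  have pG: "pull \<phi> G \<in> borel_measurable I2" by (rule pull_measurable[OF \<phi> G(1)])
  have b: "\<bar>pull \<phi> G z\<bar> \<le> 1" if "z \<in> space I2" for z
    using G(2)[OF square_mpt[OF \<phi> that]] by (simp add: pull_def)
  have i: "integrable I2 (pull \<phi> G)" "integrable I2 H"
    by (rule D2.integrable_bounded[OF pG b] D2.integrable_bounded[OF H]; assumption)+
  have "\<bar>(LINT z|I2. G z) - (LINT z|I2. H z)\<bar> = \<bar>LINT z|I2. pull \<phi> G z - H z\<bar>"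
    using i integral_pull[OF \<phi> G(1)] by simp
  also have "\<dots> \<le> (LINT z|I2. \<bar>pull \<phi> G z - H z\<bar>)" by (rule integral_abs_bound)
  also have "\<dots> \<le> 2 * 2 * measure I1 N"
  proof (rule integral_diff_off_strip[OF N pG H(1)])
    show "\<bar>pull \<phi> G z - H z\<bar> \<le> 2" if "z \<in> space I2" for z
      using b[OF that] H(2)[OF that] by linarith
    show "pull \<phi> G (x, y) = H (x, y)" if "x \<in> {0..1} - N" "y \<in> {0..1} - N" for x y
      using eq[OF that] by (simp add: pull_def)
  qed
  finally show ?thesis by simp
qed

text \<open>Replace \<open>K'\<close> by a dyadic step function. Composed with
  \<open>\<gamma>\<close> it depends only on the labels \<open>dyad m (\<gamma> x)\<close>, which
  have the same distribution as \<open>dyad m x\<close>. An automorphism therefore nearly matches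
  the two labellings, so it nearly inverts \<open>\<gamma>\<close> at this resolution.\<close>

lemma version_approx:
  assumes \<gamma>: "mpt \<gamma>" and K: "bgraphon K" and K': "bgraphon K'"
    and ae: "AE z in I2. K z = pull \<gamma> K' z" and e: "e > 0"
  shows "\<exists>\<phi>. aut \<phi> \<and> (LINT z|I2. \<bar>pull \<phi> K z - K' z\<bar>) \<le> e"
proof -
  note iK' = bgraphon_integrable[OF K'] and iK = bgraphon_integrable[OF K]
  have "eventually (\<lambda>m. (LINT z|I2. \<bar>K' z - D2.cexp m K' z\<bar>) < e / 4) sequentially"
    by (rule order_tendstoD(2)[OF D2.cexp_tendsto[OF iK']]) (use e in simp)
  then obtain m where m: "(LINT z|I2. \<bar>K' z - D2.cexp m K' z\<bar>) < e / 4"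
    by (auto simp: eventually_sequentially)
  define E where "E = D2.cexp m K'"
  have iE: "integrable I2 E" unfolding E_def by (rule D2.integrable_cexp)
  then have Em: "E \<in> borel_measurable I2" by (rule borel_measurable_integrable)
  have E01: "E z \<in> {0..1}" for z
    unfolding E_def D2.cexp_def by (rule bgraphon_cavg[OF K'])
  have dy: "dyad m \<in> I1 \<rightarrow>\<^sub>M count_space UNIV" by simp
  have p: "(\<lambda>x. dyad m (\<gamma> x)) \<in> I1 \<rightarrow>\<^sub>M count_space UNIV"
    by (rule measurable_compose[OF mpt_measurable[OF \<gamma>] dy])
  have same: "measure I1 {x\<in>{0..1}. dyad m (\<gamma> x) = k} = measure I1 {x\<in>{0..1}. dyad m x = k}" for k
    using mpt_vimage_measure[OF \<gamma> label_sets[OF dy, of "{k}"]] mpt_unit[OF \<gamma>] by (simp cong: conj_cong)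
  \<comment> \<open>The two strips double \<open>e / 8\<close>; the two replacements of a function
    by its step function cost less than \<open>e / 4\<close> each.\<close>
  have "\<exists>\<phi>. aut \<phi> \<and> measure I1 {x\<in>{0..1}. dyad m (\<gamma> (\<phi> x)) \<noteq> dyad m x}
      \<le> e / 8 + (\<Sum>k\<in>{..2 ^ m}. \<bar>measure I1 {x\<in>{0..1}. dyad m (\<gamma> x) = k} - measure I1 {x\<in>{0..1}. dyad m x = k}\<bar>)"
  proof (rule conjugate_labels[OF _ p dy])
    show "dyad m (\<gamma> x) \<in> {..2 ^ m}" "dyad m x \<in> {..2 ^ m}" if "x \<in> {0..1}" for x
      using dyad_le_power[OF mpt_unit[OF \<gamma> that]] dyad_le_power[OF that] by simp_all
  qed (use e in simp_all)
  then obtain \<phi> where \<phi>: "aut \<phi>" and bad: "measure I1 {x\<in>{0..1}. dyad m (\<gamma> (\<phi> x)) \<noteq> dyad m x} \<le> e / 8"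
    unfolding same by auto
  note mp = aut_mpt[OF \<phi>]
  let ?N = "{x\<in>{0..1}. dyad m (\<gamma> (\<phi> x)) \<noteq> dyad m x}"
  have N: "?N \<in> sets I1"
    by (rule label_neq_sets[of "{..2 ^ m}", OF _ measurable_compose[OF mpt_measurable[OF mp] p] dy])
      (simp, rule atMost_iff[THEN iffD2], rule dyad_le_power, rule mpt_unit[OF \<gamma>], rule mpt_unit[OF mp])
  let ?E' = "pull \<phi> (pull \<gamma> E)"
  have pm: "pull \<gamma> E \<in> borel_measurable I2" "?E' \<in> borel_measurable I2" "pull \<phi> K \<in> borel_measurable I2"
    by (intro pull_measurable mp \<gamma> Em bgraphon_measurable[OF K])+
  have ipE: "integrable I2 (pull \<gamma> E)" "integrable I2 ?E'"
    using pm E01 by (auto intro!: D2.integrable_unit simp: pull_def)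
  have ipK: "integrable I2 (pull \<phi> K)" by (rule bgraphon_integrable[OF bgraphon_pull[OF K mp]])
  have 1: "(LINT z|I2. \<bar>pull \<phi> K z - ?E' z\<bar>) < e / 4"
  proof -
    have "(LINT z|I2. \<bar>pull \<phi> K z - ?E' z\<bar>) = (LINT z|I2. pull \<phi> (\<lambda>z. \<bar>K z - pull \<gamma> E z\<bar>) z)"
      by (simp add: pull_def)
    also have "\<dots> = (LINT z|I2. \<bar>K z - pull \<gamma> E z\<bar>)"
      using pm K by (intro integral_pull mp) (auto dest: bgraphon_measurable)
    also have "\<dots> = (LINT z|I2. \<bar>pull \<gamma> K' z - pull \<gamma> E z\<bar>)"
    proof (rule integral_cong_AE)
      show "AE z in I2. \<bar>K z - pull \<gamma> E z\<bar> = \<bar>pull \<gamma> K' z - pull \<gamma> E z\<bar>"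
        using ae by eventually_elim simp
    qed (use pm K pull_measurable[OF \<gamma> bgraphon_measurable[OF K']] in \<open>auto dest: bgraphon_measurable\<close>)
    also have "\<dots> = (LINT z|I2. pull \<gamma> (\<lambda>z. \<bar>K' z - E z\<bar>) z)" by (simp add: pull_def)
    also have "\<dots> = (LINT z|I2. \<bar>K' z - E z\<bar>)"
      using Em K' by (intro integral_pull \<gamma>) (auto dest: bgraphon_measurable)
    finally show ?thesis using m by (simp add: E_def)
  qed
  have 2: "(LINT z|I2. \<bar>?E' z - E z\<bar>) \<le> 2 * 1 * measure I1 ?N"
  proof (rule integral_diff_off_strip[OF N pm(2) Em])
    show "\<bar>?E' z - E z\<bar> \<le> 1" if "z \<in> space I2" for z
      using E01[of z] E01[of "(\<gamma> (\<phi> (fst z)), \<gamma> (\<phi> (snd z)))"] by (auto simp: pull_def)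
    show "?E' (x, y) = E (x, y)" if "x \<in> {0..1} - ?N" "y \<in> {0..1} - ?N" for x y
      using that by (simp add: pull_def E_def D2.cexp_def dyad2_def)
  qed
  have "(LINT z|I2. \<bar>pull \<phi> K z - K' z\<bar>)
      \<le> (LINT z|I2. \<bar>pull \<phi> K z - ?E' z\<bar> + \<bar>?E' z - E z\<bar> + \<bar>K' z - E z\<bar>)"
    by (intro integral_mono integrable_abs Bochner_Integration.integrable_diff Bochner_Integration.integrable_add ipK ipE iE iK') linarith
  also have "\<dots> = (LINT z|I2. \<bar>pull \<phi> K z - ?E' z\<bar>) + (LINT z|I2. \<bar>?E' z - E z\<bar>) + (LINT z|I2. \<bar>K' z - E z\<bar>)"
    using ipK ipE iE iK' by simp
  also have "\<dots> \<le> e" using 1 2 bad m e unfolding E_def[symmetric] by linarith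
  finally show ?thesis using \<phi> by blast
qed

subsection \<open>Lowering the energy\<close>

lemma cell2_rect:
  "z \<in> space I2 \<Longrightarrow> indicator (D2.cell m (i, j)) z = rect (D1.cell m i) (D1.cell m j) z"
  by (auto simp: D2.cell_def D1.cell_def rect_def dyad2_def indicator_def)

text \<open>Cells of the square are products of cells, so their averages are integrals over
  rectangles, which weak-star limits and cut norms control.\<close>

lemma cavg2_rect:
  "D2.cavg m U (i, j) = (LINT z|I2. rect (D1.cell m i) (D1.cell m j) z * U z) / measure I2 (D2.cell m (i, j))"
proof -
  have "(LINT z|I2. indicator (D2.cell m (i, j)) z * U z) = (LINT z|I2. rect (D1.cell m i) (D1.cell m j) z * U z)"
    by (rule Bochner_Integration.integral_cong) (simp_all only: cell2_rect)
  then show ?thesis by (simp add: D2.cavg_def)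
qed

text \<open>Moves a lower bound for the cut integral from a set \<open>A\<close> that varies along
  the sequence to a fixed set \<open>L\<close>.\<close>

lemma cutI_lower_transport:
  fixes E :: "real \<times> real \<Rightarrow> real"
  assumes U: "bgraphon U" and E: "E \<in> borel_measurable I2" "\<And>z. E z \<in> {0..1}"
    and \<phi>: "mpt \<phi>" and A: "A \<in> sets I1" and L: "L \<in> sets I1" and N: "N \<in> sets I1"
    and eq: "\<And>x. x \<in> {0..1} - N \<Longrightarrow> \<phi> x \<in> A \<longleftrightarrow> x \<in> L"
    and eqE: "\<And>x y. x \<in> {0..1} - N \<Longrightarrow> y \<in> {0..1} - N \<Longrightarrow> E (\<phi> x, \<phi> y) = E (x, y)"
  shows "\<bar>cutI (\<lambda>z. U z - E z) A - cutI (\<lambda>z. pull \<phi> U z - E z) L\<bar> \<le> 4 * measure I1 N"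
  unfolding cutI_def
proof (rule transport_integral[OF \<phi> N])
  note pU = bgraphon_pull[OF U \<phi>]
  show "(\<lambda>z. rect A A z * (U z - E z)) \<in> borel_measurable I2"
    by (intro borel_measurable_times borel_measurable_diff rect_measurable A bgraphon_measurable U E)
  show "(\<lambda>z. rect L L z * (pull \<phi> U z - E z)) \<in> borel_measurable I2"
    by (intro borel_measurable_times borel_measurable_diff rect_measurable L bgraphon_measurable pU E)
  have b: "\<bar>rect B C z * (V z - E z)\<bar> \<le> 1" if "bgraphon V" "z \<in> space I2" for B C V z
  proof -
    have "\<bar>V z - E z\<bar> \<le> 1" using bgraphon_unit[OF that] E(2)[of z] by auto
    then show ?thesis by (simp add: rect_def indicator_def)
  qed
  show "\<bar>rect A A z * (U z - E z)\<bar> \<le> 1" "\<bar>rect L L z * (pull \<phi> U z - E z)\<bar> \<le> 1" if "z \<in> space I2" for z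
    by (rule b[OF U that] b[OF pU that])+
  show "rect A A (\<phi> x, \<phi> y) * (U (\<phi> x, \<phi> y) - E (\<phi> x, \<phi> y)) = rect L L (x, y) * (pull \<phi> U (x, y) - E (x, y))"
    if "x \<in> {0..1} - N" "y \<in> {0..1} - N" for x y
    using eq[OF that(1)] eq[OF that(2)] eqE[OF that] by (simp add: rect_def indicator_def pull_def)
qed

text \<open>Along a subsequence the indicators of the \<open>A n\<close> have a weak limit, so the
  measure of \<open>A n\<close> in each of the finitely many cells converges. \<open>L\<close> has
  the limiting measures, and \<open>conjugate_labels\<close> then aligns the sets up to an error
  tending to 0.\<close>

lemma align_sets:
  fixes A :: "nat \<Rightarrow> real set"
  assumes A: "\<And>n. A n \<in> sets I1"
  shows "\<exists>r L \<phi> N. strict_mono (r :: nat \<Rightarrow> nat) \<and> L \<in> sets I1 \<and> (\<forall>n. aut (\<phi> n)) \<and> (\<forall>n. N n \<in> sets I1) \<and>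
    (\<lambda>n. measure I1 (N n)) \<longlonglongrightarrow> 0 \<and>
    (\<forall>n. \<forall>x\<in>{0..1} - N n. dyad m (\<phi> n x) = dyad m x \<and> (\<phi> n x \<in> A (r n) \<longleftrightarrow> x \<in> L))"
proof -
  have "\<exists>r \<psi>. strict_mono r \<and> \<psi> \<in> borel_measurable I1 \<and> (\<forall>x. \<psi> x \<in> {0..1}) \<and>
    (\<forall>g :: real \<Rightarrow> real. integrable I1 g \<longrightarrow> (\<lambda>n. LINT x|I1. indicator (A (r n)) x * g x) \<longlonglongrightarrow> (LINT x|I1. \<psi> x * g x))"
    by (rule D1.weak_compactness[of "\<lambda>n. indicator (A n)"]) (use A in \<open>auto simp: indicator_def\<close>)
  then obtain r \<psi> where r: "strict_mono (r :: nat \<Rightarrow> nat)" and \<psi>m: "\<psi> \<in> borel_measurable I1" and \<psi>: "\<And>x. \<psi> x \<in> {0..1}"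
    and lim: "\<And>g :: real \<Rightarrow> real. integrable I1 g \<Longrightarrow> (\<lambda>n. LINT x|I1. indicator (A (r n)) x * g x) \<longlonglongrightarrow> (LINT x|I1. \<psi> x * g x)"
    by blast
  define t where "t k = (LINT x|I1. \<psi> x * indicator (D1.cell m k) x)" for k
  have ic: "integrable I1 (indicator (D1.cell m k) :: real \<Rightarrow> real)" for k
    by (rule D1.integrable_ind[OF D1.cell_sets])
  have cs: "D1.cell m k \<subseteq> {0..1}" for k by (auto simp: dyad_cell)
  have At: "(\<lambda>n. measure I1 (A (r n) \<inter> D1.cell m k)) \<longlonglongrightarrow> t k" for k
  proof -
    have "(LINT x|I1. indicator (A (r n)) x * indicator (D1.cell m k) x) = measure I1 (A (r n) \<inter> D1.cell m k)" for n
      using cs[of k] by (simp add: indicator_inter_arith[symmetric] Int_absorb2 inf.coboundedI2)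
    then show ?thesis using lim[OF ic, of k] by (simp add: t_def)
  qed
  have t0: "0 \<le> t k" for k
    unfolding t_def using \<psi> by (intro integral_nonneg_AE AE_I2) (auto simp: indicator_def)
  have t1: "t k \<le> measure I1 (D1.cell m k)" for k
    by (rule LIMSEQ_le_const2[OF At]) (auto intro!: exI[of _ 0] I1.finite_measure_mono)
  \<comment> \<open>In each cell, \<open>L\<close> is the initial segment whose length is the limit of the measures of the parts of
    \<open>A (r n)\<close> in that cell.\<close>
  define L where "L = {x\<in>space I1. x < real (dyad m x) / 2 ^ m + t (dyad m x)}"
  have L: "L \<in> sets I1"
  proof -
    have "(\<lambda>x. real (dyad m x) / 2 ^ m + t (dyad m x)) \<in> borel_measurable I1"
      by (rule measurable_compose[OF dyad_measurable, where g = "\<lambda>k. real k / 2 ^ m + t k"]) simp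
    then show ?thesis unfolding L_def by (intro borel_measurable_less ident_I1)
  qed
  have mL: "measure I1 (L \<inter> D1.cell m k) = t k" for k
  proof (cases "k < 2 ^ m")
    case True
    have tk: "t k \<le> 1 / 2 ^ m" using t1[of k] True by (simp add: measure_dyad_cell)
    have "real k + 1 \<le> 2 ^ m" using of_nat_mono[OF Suc_leI[OF True], where 'a = real] by simp
    then have le1: "real k / 2 ^ m + 1 / 2 ^ m \<le> 1" by (simp add: add_divide_distrib[symmetric])
    have "L \<inter> D1.cell m k = {real k / 2 ^ m ..< real k / 2 ^ m + t k}"
    proof (intro set_eqI iffI)
      fix x assume "x \<in> L \<inter> D1.cell m k"
      then have x: "x \<in> {0..1}" "dyad m x = k" "x < real k / 2 ^ m + t k" by (auto simp: L_def dyad_cell)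
      then have "real k \<le> 2 ^ m * x" using dyad_le[of x m] by simp
      then have "real k / 2 ^ m \<le> x" by (simp add: pos_divide_le_eq mult.commute)
      then show "x \<in> {real k / 2 ^ m ..< real k / 2 ^ m + t k}" using x by simp
    next
      fix x assume "x \<in> {real k / 2 ^ m ..< real k / 2 ^ m + t k}"
      then have x: "real k / 2 ^ m \<le> x" "x < real k / 2 ^ m + t k" by simp_all
      have "0 \<le> real k / 2 ^ m" by simp
      then have x0: "0 \<le> x" using x(1) by (rule order_trans)
      have x1: "x < real k / 2 ^ m + 1 / 2 ^ m" using x tk by linarith
      have "real k \<le> 2 ^ m * x" using x(1) by (simp add: pos_divide_le_eq mult.commute)
      moreover have "2 ^ m * x < real k + 1"
        using x1 by (simp add: add_divide_distrib[symmetric] pos_less_divide_eq mult.commute)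
      ultimately have "dyad m x = k" using dyad_eq_iff[OF x0] by blast
      then show "x \<in> L \<inter> D1.cell m k" using x x0 x1 le1 by (simp add: L_def dyad_cell)
    qed
    moreover have "L \<inter> D1.cell m k \<in> sets I1" by (intro sets.Int L D1.cell_sets)
    ultimately show ?thesis using t0[of k] by (simp add: measure_def emeasure_I1)
  next
    case False
    then have z: "measure I1 (D1.cell m k) = 0" by (simp add: measure_dyad_cell)
    have "measure I1 (L \<inter> D1.cell m k) \<le> measure I1 (D1.cell m k)" by (intro I1.finite_measure_mono) auto
    then show ?thesis using z t0[of k] t1[of k] measure_nonneg[of I1 "L \<inter> D1.cell m k"] by linarith
  qed
  \<comment> \<open>Labelling by cell and membership together makes a single automorphism respect
    the cells and carry \<open>L\<close> to \<open>A (r n)\<close>, up to a small error.\<close>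
  let ?p = "\<lambda>B x. (dyad m x, x \<in> B)" and ?S = "{..(2 :: nat) ^ m} \<times> (UNIV :: bool set)"
  have lab: "?p B \<in> I1 \<rightarrow>\<^sub>M count_space UNIV" if B: "B \<in> sets I1" for B
  proof -
    have "(\<lambda>x. x \<in> B) \<in> I1 \<rightarrow>\<^sub>M count_space UNIV"
      using B by measurable
    then have "?p B \<in> I1 \<rightarrow>\<^sub>M count_space UNIV \<Otimes>\<^sub>M count_space UNIV"
      by (intro measurable_Pair dyad_measurable)
    then show ?thesis by (simp add: pair_measure_countable)
  qed
  have labS: "?p B x \<in> ?S" if "x \<in> {0..1}" for B x using dyad_le_power[OF that] by simp
  have mp: "measure I1 {x\<in>{0..1}. ?p B x = (k, b)}
      = (if b then measure I1 (B \<inter> D1.cell m k) else measure I1 (D1.cell m k) - measure I1 (B \<inter> D1.cell m k))"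
    if B: "B \<in> sets I1" for B k b
  proof (cases b)
    case True
    have "{x\<in>{0..1}. ?p B x = (k, b)} = B \<inter> D1.cell m k" using True by (auto simp: dyad_cell)
    then show ?thesis using True by simp
  next
    case False
    have "{x\<in>{0..1}. ?p B x = (k, b)} = D1.cell m k - B \<inter> D1.cell m k" using False by (auto simp: dyad_cell)
    then show ?thesis using False B by (simp add: I1.finite_measure_Diff sets.Int)
  qed
  \<comment> \<open>The loss in \<open>conjugate_labels\<close>. It tends to 0 because a label's
    measure is the measure of the set in a cell or the complementary measure in that cell.\<close>
  define D where "D n = (\<Sum>s\<in>?S. \<bar>measure I1 {x\<in>{0..1}. ?p (A (r n)) x = s} - measure I1 {x\<in>{0..1}. ?p L x = s}\<bar>)" for n
  have D: "D \<longlonglongrightarrow> 0"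
  proof -
    have "(\<lambda>n. \<bar>measure I1 {x\<in>{0..1}. ?p (A (r n)) x = s} - measure I1 {x\<in>{0..1}. ?p L x = s}\<bar>) \<longlonglongrightarrow> 0" for s
    proof -
      obtain k b where s: "s = (k, b)" by fastforce
      have "(\<lambda>n. measure I1 (A (r n) \<inter> D1.cell m k) - t k) \<longlonglongrightarrow> t k - t k" by (intro tendsto_intros At)
      then have "(\<lambda>n. \<bar>measure I1 (A (r n) \<inter> D1.cell m k) - t k\<bar>) \<longlonglongrightarrow> 0" by (simp add: tendsto_rabs_zero)
      moreover have "\<bar>measure I1 {x\<in>{0..1}. ?p (A (r n)) x = s} - measure I1 {x\<in>{0..1}. ?p L x = s}\<bar>
          = \<bar>measure I1 (A (r n) \<inter> D1.cell m k) - t k\<bar>" for n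
        unfolding s mp[OF A] mp[OF L] mL by (simp add: abs_minus_commute)
      ultimately show ?thesis by simp
    qed
    then have "D \<longlonglongrightarrow> (\<Sum>s\<in>?S. 0)" unfolding D_def by (intro tendsto_sum)
    then show ?thesis by simp
  qed
  have "\<forall>n. \<exists>\<phi>. aut \<phi> \<and> measure I1 {x\<in>{0..1}. ?p (A (r n)) (\<phi> x) \<noteq> ?p L x} \<le> inverse (real (Suc n)) + D n"
    unfolding D_def by (intro allI conjugate_labels lab labS A L) simp_all
  from choice[OF this] obtain \<phi> where \<phi>: "\<And>n. aut (\<phi> n)"
    and bad: "\<And>n. measure I1 {x\<in>{0..1}. ?p (A (r n)) (\<phi> n x) \<noteq> ?p L x} \<le> inverse (real (Suc n)) + D n" by blast
  define N where "N n = {x\<in>{0..1}. ?p (A (r n)) (\<phi> n x) \<noteq> ?p L x}" for n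
  have N: "N n \<in> sets I1" for n
    unfolding N_def
  proof (rule label_neq_sets[of ?S, OF _ measurable_compose[OF mpt_measurable[OF aut_mpt[OF \<phi>]] lab[OF A]] lab[OF L]])
    show "?p (A (r n)) (\<phi> n x) \<in> ?S" if "x \<in> {0..1}" for x
      by (rule labS[OF mpt_unit[OF aut_mpt[OF \<phi>] that]])
  qed simp
  have "(\<lambda>n. measure I1 (N n)) \<longlonglongrightarrow> 0"
  proof (rule tendsto_sandwich[OF always_eventually always_eventually tendsto_const])
    have "(\<lambda>n. inverse (real (Suc n)) + D n) \<longlonglongrightarrow> 0 + 0"
      by (intro tendsto_add LIMSEQ_inverse_real_of_nat D)
    then show "(\<lambda>n. inverse (real (Suc n)) + D n) \<longlonglongrightarrow> 0" by simp
  qed (use bad in \<open>auto simp: N_def\<close>)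
  moreover have "dyad m (\<phi> n x) = dyad m x \<and> (\<phi> n x \<in> A (r n) \<longleftrightarrow> x \<in> L)" if "x \<in> {0..1} - N n" for n x
    using that by (simp add: N_def)
  ultimately show ?thesis using r L \<phi> N by blast
qed

context strictly_concave_unit
begin

interpretation CF: concave_filtration I2 dyad2 f ..

text \<open>Using \<open>jensen_gap\<close> with tolerance \<open>e / 2\<close> leaves an excess of
  at least \<open>e / 2\<close>, so the gain \<open>\<kappa> * (e / 2)\<close> is the same for all
  graphons and levels.\<close>

lemma energy_gap:
  assumes "e > 0"
  shows "\<exists>\<delta>>0. \<forall>U m. bgraphon U \<longrightarrow> e \<le> (LINT z|I2. \<bar>U z - D2.cexp m U z\<bar>) \<longrightarrow>
     (LINT z|I2. f (U z)) \<le> (LINT z|I2. f (D2.cexp m U z)) - \<delta>"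
proof -
  obtain \<kappa> where k: "\<kappa> > 0" and gap: "\<And>U m. U \<in> borel_measurable I2 \<Longrightarrow> (\<forall>x\<in>space I2. U x \<in> {0..1}) \<Longrightarrow>
     (LINT z|I2. f (U z)) \<le> (LINT z|I2. f (D2.cexp m U z)) - \<kappa> * ((LINT z|I2. \<bar>U z - D2.cexp m U z\<bar>) - e / 2)"
    using CF.jensen_gap[of "e/2"] assms by auto
  have "(LINT z|I2. f (U z)) \<le> (LINT z|I2. f (D2.cexp m U z)) - \<kappa> * (e / 2)"
    if U: "bgraphon U" and "e \<le> (LINT z|I2. \<bar>U z - D2.cexp m U z\<bar>)" for U m
  proof -
    have "\<kappa> * (e / 2) \<le> \<kappa> * ((LINT z|I2. \<bar>U z - D2.cexp m U z\<bar>) - e / 2)"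
      using that k by (intro mult_left_mono) auto
    moreover have "(LINT z|I2. f (U z)) \<le> (LINT z|I2. f (D2.cexp m U z)) - \<kappa> * ((LINT z|I2. \<bar>U z - D2.cexp m U z\<bar>) - e / 2)"
      using U unfolding bgraphon_def by (intro gap) blast+
    ultimately show ?thesis by linarith
  qed
  then show ?thesis using k assms by (intro exI[of _ "\<kappa> * (e / 2)"]) auto
qed

lemma energy_cexp_tendsto:
  assumes W: "bgraphon W"
  shows "(\<lambda>m. LINT z|I2. f (D2.cexp m W z)) \<longlonglongrightarrow> (LINT z|I2. f (W z))"
proof (rule CF.integral_f_tendsto[OF _ _ _ _ D2.cexp_tendsto[OF bgraphon_integrable[OF W]]])
  show "D2.cexp n W \<in> borel_measurable I2" for n by (rule D2.cexp_meas)
  show "D2.cexp n W z \<in> {0..1}" for n z unfolding D2.cexp_def by (rule bgraphon_cavg[OF W])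
  show "W \<in> borel_measurable I2" by (rule bgraphon_measurable[OF W])
  show "W z \<in> {0..1}" if "z \<in> space I2" for z by (rule bgraphon_unit[OF W that])
qed

lemma energy_drop:
  assumes e: "e > 0"
  shows "\<exists>\<delta>>0. \<forall>U W. (\<forall>n. bgraphon (U n)) \<longrightarrow> bgraphon W \<longrightarrow> wconv U W \<longrightarrow>
     infinite {n. \<not> cutle (\<lambda>z. U n z - W z) e} \<longrightarrow>
     (\<exists>r \<phi> W'. strict_mono (r :: nat \<Rightarrow> nat) \<and> (\<forall>n. aut (\<phi> n)) \<and> bgraphon W' \<and> wconv (\<lambda>n. pull (\<phi> n) (U (r n))) W' \<and>
        (LINT z|I2. f (W' z)) \<le> (LINT z|I2. f (W z)) - \<delta>)"
proof -
  \<comment> \<open>The gain is fixed before \<open>U\<close> and \<open>W\<close> are given. The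
    level \<open>m\<close> depends on \<open>W\<close> and on this gain.\<close>
  obtain \<delta> where d: "\<delta> > 0" and gap: "\<And>U m. bgraphon U \<Longrightarrow> e / 2 \<le> (LINT z|I2. \<bar>U z - D2.cexp m U z\<bar>) \<Longrightarrow>
     (LINT z|I2. f (U z)) \<le> (LINT z|I2. f (D2.cexp m U z)) - \<delta>"
    using energy_gap[of "e/2"] e by auto
  have "\<exists>r \<phi> W'. strict_mono (r :: nat \<Rightarrow> nat) \<and> (\<forall>n. aut (\<phi> n)) \<and> bgraphon W' \<and> wconv (\<lambda>n. pull (\<phi> n) (U (r n))) W' \<and>
        (LINT z|I2. f (W' z)) \<le> (LINT z|I2. f (W z)) - \<delta> / 2"
    if U: "\<And>n. bgraphon (U n)" and W: "bgraphon W" and conv: "wconv U W"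
      and inf: "infinite {n. \<not> cutle (\<lambda>z. U n z - W z) e}" for U W
  proof -
    note iU = bgraphon_integrable[OF U] and iW = bgraphon_integrable[OF W]
    have lim1: "(\<lambda>m. LINT z|I2. \<bar>W z - D2.cexp m W z\<bar>) \<longlonglongrightarrow> 0" by (rule D2.cexp_tendsto[OF iW])
    note lim2 = energy_cexp_tendsto[OF W]
    have "\<forall>\<^sub>F m in sequentially. (LINT z|I2. f (D2.cexp m W z)) < (LINT z|I2. f (W z)) + \<delta> / 2 \<and>
        (LINT z|I2. \<bar>W z - D2.cexp m W z\<bar>) < e / 2"
      by (intro eventually_conj order_tendstoD(2)[OF lim2] order_tendstoD(2)[OF lim1]) (use d e in simp_all)
    then have "\<exists>m. (LINT z|I2. f (D2.cexp m W z)) < (LINT z|I2. f (W z)) + \<delta> / 2 \<and>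
        (LINT z|I2. \<bar>W z - D2.cexp m W z\<bar>) < e / 2"
      by (rule eventually_happens'[OF sequentially_bot])
    \<comment> \<open>One level serves two purposes: averaging \<open>W\<close> raises its energy by
      less than \<open>\<delta> / 2\<close>, and it moves \<open>W\<close> by less than
      \<open>e / 2\<close> in L1, so half of each quantity is left.\<close>
    then obtain m where m1: "(LINT z|I2. f (D2.cexp m W z)) < (LINT z|I2. f (W z)) + \<delta> / 2"
      and m2: "(LINT z|I2. \<bar>W z - D2.cexp m W z\<bar>) < e / 2" by blast
    define E where "E = D2.cexp m W"
    have iE: "integrable I2 E" unfolding E_def by (rule D2.integrable_cexp)
    then have Em: "E \<in> borel_measurable I2" by (rule borel_measurable_integrable)
    have E01: "E z \<in> {0..1}" for z unfolding E_def D2.cexp_def by (rule bgraphon_cavg[OF W])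
    obtain r0 :: "nat \<Rightarrow> nat" where r0: "strict_mono r0" and "\<And>n. r0 n \<in> {n. \<not> cutle (\<lambda>z. U n z - W z) e}"
      using infinite_enumerate[OF inf] by blast
    then have "\<exists>A. A \<in> sets I1 \<and> \<bar>cutI (\<lambda>z. U (r0 n) z - W z) A\<bar> > e" for n
      unfolding cutle_def by (auto simp: not_le)
    then have "\<forall>n. \<exists>A. A \<in> sets I1 \<and> \<bar>cutI (\<lambda>z. U (r0 n) z - W z) A\<bar> > e" by (rule allI)
    from choice[OF this] obtain A where A: "\<And>n. A n \<in> sets I1"
      and big: "\<And>n. \<bar>cutI (\<lambda>z. U (r0 n) z - W z) (A n)\<bar> > e" by blast
    from align_sets[of A m, OF A] obtain r1 L \<phi> N where
      "strict_mono (r1 :: nat \<Rightarrow> nat) \<and> L \<in> sets I1 \<and> (\<forall>n. aut (\<phi> n)) \<and> (\<forall>n. N n \<in> sets I1) \<and>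
        (\<lambda>n. measure I1 (N n)) \<longlonglongrightarrow> 0 \<and>
        (\<forall>n. \<forall>x\<in>{0..1} - N n. dyad m (\<phi> n x) = dyad m x \<and> (\<phi> n x \<in> A (r1 n) \<longleftrightarrow> x \<in> L))"
      by (elim exE) (rule that)
    then have r1: "strict_mono r1" and L: "L \<in> sets I1" and \<phi>': "\<forall>n. aut (\<phi> n)" and N': "\<forall>n. N n \<in> sets I1"
      and N0: "(\<lambda>n. measure I1 (N n)) \<longlonglongrightarrow> 0"
      and al': "\<forall>n. \<forall>x\<in>{0..1} - N n. dyad m (\<phi> n x) = dyad m x \<and> (\<phi> n x \<in> A (r1 n) \<longleftrightarrow> x \<in> L)"
      by blast+
    note \<phi> = \<phi>'[rule_format] and N = N'[rule_format] and al = al'[rule_format]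
    note mp = aut_mpt[OF \<phi>]
    define V0 where "V0 n = U (r0 (r1 n))" for n
    define V where "V n = pull (\<phi> n) (V0 n)" for n
    have V0: "bgraphon (V0 n)" and V: "bgraphon (V n)" for n
      unfolding V_def V0_def by (intro bgraphon_pull U mp)+
    note iV0 = bgraphon_integrable[OF V0] and iV = bgraphon_integrable[OF V]
    have conv0: "wconv V0 W"
      using wconv_subseq[OF wconv_subseq[OF conv r0] r1] by (simp add: V0_def[abs_def])
    obtain r2 W' where r2: "strict_mono (r2 :: nat \<Rightarrow> nat)" and W': "bgraphon W'" and conv2: "wconv (\<lambda>n. V (r2 n)) W'"
      using bgraphon_compact[of V, OF V] by blast
    note iW' = bgraphon_integrable[OF W']
    have Nr: "(\<lambda>n. 4 * measure I1 (N (r2 n))) \<longlonglongrightarrow> 0"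
      using tendsto_mult_right_zero[OF LIMSEQ_subseq_LIMSEQ[OF N0 r2], of 4] by (simp add: comp_def)
    \<comment> \<open>The automorphisms preserve cells off a set of vanishing measure, so integrals
      over cell rectangles before and after the rearrangement have the same limit.\<close>
    have cavg_eq: "D2.cavg m W' (i, j) = D2.cavg m W (i, j)" for i j
    proof -
      let ?R = "rect (D1.cell m i) (D1.cell m j)"
      have Rm: "?R \<in> borel_measurable I2" by (intro rect_measurable D1.cell_sets)
      have close: "\<bar>(LINT z|I2. ?R z * V0 n z) - (LINT z|I2. ?R z * V n z)\<bar> \<le> 4 * measure I1 (N n)" for n
      proof (rule transport_integral[OF mp N])
        show "(\<lambda>z. ?R z * V0 n z) \<in> borel_measurable I2" "(\<lambda>z. ?R z * V n z) \<in> borel_measurable I2"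
          by (intro borel_measurable_times Rm bgraphon_measurable V0 V)+
        show "\<bar>?R z * V0 n z\<bar> \<le> 1" "\<bar>?R z * V n z\<bar> \<le> 1" if "z \<in> space I2" for z
          using bgraphon_unit[OF V0 that, of n] bgraphon_unit[OF V that, of n] by (auto simp: rect_def indicator_def)
        show "?R (\<phi> n x, \<phi> n y) * V0 n (\<phi> n x, \<phi> n y) = ?R (x, y) * V n (x, y)"
          if "x \<in> {0..1} - N n" "y \<in> {0..1} - N n" for x y
          using al[OF that(1)] al[OF that(2)] mpt_unit[OF mp, of x n] mpt_unit[OF mp, of y n] that
          by (auto simp: rect_def indicator_def dyad_cell V_def pull_def)
      qed
      have "(\<lambda>n. (LINT z|I2. ?R z * V0 (r2 n) z) - (LINT z|I2. ?R z * V (r2 n) z)) \<longlonglongrightarrow> 0"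
        by (rule tendsto_0_le[OF Nr, where K = 1]) (use close in \<open>auto intro!: always_eventually\<close>)
      moreover have "(\<lambda>n. (LINT z|I2. ?R z * V0 (r2 n) z) - (LINT z|I2. ?R z * V (r2 n) z))
          \<longlonglongrightarrow> (LINT z|I2. ?R z * W z) - (LINT z|I2. ?R z * W' z)"
        by (intro tendsto_diff wconv_rect[OF conv2] wconv_rect[OF wconv_subseq[OF conv0 r2]] D1.cell_sets)
      ultimately have "(LINT z|I2. ?R z * W z) - (LINT z|I2. ?R z * W' z) = 0"
        using LIMSEQ_unique by blast
      then show ?thesis unfolding cavg2_rect by simp
    qed
    then have E': "D2.cexp m W' = E"
      unfolding E_def by (auto simp: D2.cexp_def fun_eq_iff dyad2_def)
    \<comment> \<open>The witnesses refer to \<open>W\<close>; passing to its averages loses less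
      than \<open>e / 2\<close>.\<close>
    have big2: "e / 2 \<le> \<bar>cutI (\<lambda>z. V0 n z - E z) (A (r1 n))\<bar>" for n
    proof -
      have "\<bar>cutI (\<lambda>z. W z - E z) (A (r1 n))\<bar> \<le> (LINT z|I2. \<bar>W z - E z\<bar>)"
        by (intro cutI_le_L1 Bochner_Integration.integrable_diff iW iE A)
      then have "\<bar>cutI W (A (r1 n)) - cutI E (A (r1 n))\<bar> < e / 2"
        using m2 unfolding E_def[symmetric] cutI_diff[OF iW iE A] by linarith
      moreover have "\<bar>cutI (V0 n) (A (r1 n)) - cutI W (A (r1 n))\<bar> > e"
        using big[of "r1 n"] by (simp add: cutI_diff[OF iU iW A] V0_def)
      ultimately show ?thesis unfolding cutI_diff[OF iV0 iE A] by linarith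
    qed
    \<comment> \<open>The lower bound survives the weak-star limit because both \<open>L\<close> and
      \<open>E\<close> are independent of \<open>n\<close>.\<close>
    have "e / 2 \<le> \<bar>cutI (\<lambda>z. W' z - E z) L\<bar>"
    proof (rule LIMSEQ_le_const)
      have "(\<lambda>n. \<bar>cutI (\<lambda>z. V (r2 n) z - E z) L\<bar> + 4 * measure I1 (N (r2 n))) \<longlonglongrightarrow> \<bar>cutI (\<lambda>z. W' z - E z) L\<bar> + 0"
        by (intro tendsto_add tendsto_rabs Nr wconv_cutI[OF conv2 iV iW' iE L])
      then show "(\<lambda>n. \<bar>cutI (\<lambda>z. V (r2 n) z - E z) L\<bar> + 4 * measure I1 (N (r2 n))) \<longlonglongrightarrow> \<bar>cutI (\<lambda>z. W' z - E z) L\<bar>"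
        by simp
      have tr: "\<bar>cutI (\<lambda>z. V0 n z - E z) (A (r1 n)) - cutI (\<lambda>z. V n z - E z) L\<bar> \<le> 4 * measure I1 (N n)" for n
        unfolding V_def
      proof (rule cutI_lower_transport[OF V0 Em E01 mp A L N])
        show "\<phi> n x \<in> A (r1 n) \<longleftrightarrow> x \<in> L" if "x \<in> {0..1} - N n" for x using al[OF that] by blast
        show "E (\<phi> n x, \<phi> n y) = E (x, y)" if "x \<in> {0..1} - N n" "y \<in> {0..1} - N n" for x y
          using al[OF that(1)] al[OF that(2)] by (simp add: E_def D2.cexp_def dyad2_def)
      qed
      have "e / 2 \<le> \<bar>cutI (\<lambda>z. V n z - E z) L\<bar> + 4 * measure I1 (N n)" for n
        using tr[of n] big2[of n] by linarith
      then show "\<exists>N'. \<forall>n\<ge>N'. e / 2 \<le> \<bar>cutI (\<lambda>z. V (r2 n) z - E z) L\<bar> + 4 * measure I1 (N (r2 n))" by blast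
    qed
    also have "\<dots> \<le> (LINT z|I2. \<bar>W' z - E z\<bar>)"
      by (intro cutI_le_L1 Bochner_Integration.integrable_diff iW' iE L)
    finally have "(LINT z|I2. f (W' z)) \<le> (LINT z|I2. f (E z)) - \<delta>"
      using gap[OF W', of m] unfolding E' by blast
    then have "(LINT z|I2. f (W' z)) \<le> (LINT z|I2. f (W z)) - \<delta> / 2"
      using m1 by (simp add: E_def)
    moreover have "strict_mono (\<lambda>n. r0 (r1 (r2 n)))"
      using r0 r1 r2 by (simp add: strict_mono_def)
    moreover have "wconv (\<lambda>n. pull (\<phi> (r2 n)) (U (r0 (r1 (r2 n))))) W'"
      using conv2 by (simp add: V_def V0_def)
    ultimately show ?thesis using \<phi> W' by (intro exI[of _ "\<lambda>n. r0 (r1 (r2 n))"] exI[of _ "\<lambda>n. \<phi> (r2 n)"] exI[of _ W']) blast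
  qed
  then show ?thesis using d by (intro exI[of _ "\<delta> / 2"]) simp
qed

end

subsection \<open>Compactness in the cut norm\<close>

text \<open>The rearrangements are indexed along the subsequence only;
  \<open>versions_along_subsequence\<close> later supplies those at the remaining indices.\<close>

definition acc :: "(nat \<Rightarrow> real \<times> real \<Rightarrow> real) \<Rightarrow> (real \<times> real \<Rightarrow> real) set" where
  "acc U = {W. bgraphon W \<and> (\<exists>r \<phi>. strict_mono (r :: nat \<Rightarrow> nat) \<and> (\<forall>n. aut (\<phi> n)) \<and>
     wconv (\<lambda>n. pull (\<phi> n) (U (r n))) W)}"

lemma pull_id: "pull (\<lambda>x. x) U = U"
  by (simp add: pull_def fun_eq_iff)

lemma acc_nonempty: "(\<And>n. bgraphon (U n)) \<Longrightarrow> \<exists>W. W \<in> acc U"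
proof -
  assume "\<And>n. bgraphon (U n)"
  then obtain r W where "strict_mono (r :: nat \<Rightarrow> nat)" "bgraphon W" "wconv (\<lambda>n. U (r n)) W"
    using bgraphon_compact by blast
  moreover have "\<forall>n :: nat. aut (\<lambda>x. x)" by (simp add: aut_id)
  moreover have "wconv (\<lambda>n. pull (\<lambda>x. x) (U (r n))) W" using \<open>wconv (\<lambda>n. U (r n)) W\<close> by (simp add: pull_id)
  ultimately have "W \<in> acc U"
    unfolding acc_def by (intro CollectI conjI exI[of _ r] exI[of _ "\<lambda>n x. x"])
  then show ?thesis by blast
qed

lemma acc_trans:
  assumes "strict_mono r" "\<And>n. aut (\<phi> n)" "W \<in> acc (\<lambda>n. pull (\<phi> n) (U (r n)))"
  shows "W \<in> acc U"
proof -
  from assms(3) obtain s \<psi> where "bgraphon W" and s: "strict_mono (s :: nat \<Rightarrow> nat)" and \<psi>: "\<And>n. aut (\<psi> n)"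
    and w: "wconv (\<lambda>n. pull (\<psi> n) (pull (\<phi> (s n)) (U (r (s n))))) W"
    unfolding acc_def by blast
  have "strict_mono (\<lambda>n. r (s n))" using assms(1) s by (simp add: strict_mono_def)
  moreover have "\<forall>n. aut (\<lambda>x. \<phi> (s n) (\<psi> n x))" using aut_comp[OF assms(2) \<psi>] by blast
  moreover have "wconv (\<lambda>n. pull (\<lambda>x. \<phi> (s n) (\<psi> n x)) (U (r (s n)))) W"
    using w by (simp add: pull_pull)
  ultimately show ?thesis unfolding acc_def using \<open>bgraphon W\<close>
    by (intro CollectI conjI exI[of _ "\<lambda>n. r (s n)"] exI[of _ "\<lambda>n x. \<phi> (s n) (\<psi> n x)"])
qed

lemma cutI_cong: "(\<And>z. z \<in> space I2 \<Longrightarrow> U z = V z) \<Longrightarrow> cutI U A = cutI V A"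
  unfolding cutI_def by (intro Bochner_Integration.integral_cong) auto

lemma cutle_cong: "cutle U e \<Longrightarrow> (\<And>z. z \<in> space I2 \<Longrightarrow> U z = V z) \<Longrightarrow> cutle V e"
  unfolding cutle_def using cutI_cong[of U V] by simp

lemma cutle_triangle:
  assumes "integrable I2 U" "integrable I2 V" "integrable I2 W"
    and "cutle (\<lambda>z. U z - V z) a" "cutle (\<lambda>z. V z - W z) b"
  shows "cutle (\<lambda>z. U z - W z) (a + b)"
  unfolding cutle_def
proof
  fix A assume A: "A \<in> sets I1"
  have "\<bar>cutI U A - cutI V A\<bar> \<le> a" "\<bar>cutI V A - cutI W A\<bar> \<le> b"
    using assms(4,5) A unfolding cutle_def by (auto simp: cutI_diff assms(1-3))
  then show "\<bar>cutI (\<lambda>z. U z - W z) A\<bar> \<le> a + b" by (simp add: cutI_diff assms(1-3) A)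
qed

lemma cutle_commute:
  assumes "integrable I2 U" "integrable I2 V" "cutle (\<lambda>z. U z - V z) a"
  shows "cutle (\<lambda>z. V z - U z) a"
  using assms unfolding cutle_def by (simp add: cutI_diff abs_minus_commute)

text \<open>The cut integral over \<open>A\<close> becomes the one over the image of
  \<open>A\<close>. Writing that image as a preimage under the inverse makes it measurable.\<close>

lemma cutle_pull:
  assumes \<phi>: "aut \<phi>" and X: "X \<in> borel_measurable I2" "cutle X e"
  shows "cutle (pull \<phi> X) e"
  unfolding cutle_def
proof
  fix A assume A: "A \<in> sets I1"
  obtain \<psi> where \<psi>: "aut \<psi>" and inv: "\<And>x. x \<in> {0..1} \<Longrightarrow> \<psi> (\<phi> x) = x" using aut_inverse[OF \<phi>] by blast
  define A' where "A' = \<psi> -` A \<inter> space I1"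
  have A': "A' \<in> sets I1"
    unfolding A'_def by (rule measurable_sets[OF mpt_measurable[OF aut_mpt[OF \<psi>]] A])
  have "cutI X A' = (LINT z|I2. pull \<phi> (\<lambda>z. rect A' A' z * X z) z)"
    unfolding cutI_def
    by (rule integral_pull[symmetric]) (intro aut_mpt \<phi> borel_measurable_times rect_measurable A' X)+
  also have "\<dots> = cutI (pull \<phi> X) A"
    unfolding cutI_def
  proof (rule Bochner_Integration.integral_cong[OF refl])
    fix z assume "z \<in> space I2"
    then have z: "fst z \<in> {0..1}" "snd z \<in> {0..1}" by auto
    have "\<phi> x \<in> A' \<longleftrightarrow> x \<in> A" if "x \<in> {0..1}" for x
      using inv[OF that] mpt_unit[OF aut_mpt[OF \<phi>] that] by (simp add: A'_def)
    then show "pull \<phi> (\<lambda>z. rect A' A' z * X z) z = rect A A z * pull \<phi> X z"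
      using z by (simp add: pull_def rect_def indicator_def)
  qed
  finally show "\<bar>cutI (pull \<phi> X) A\<bar> \<le> e" using X(2) A' unfolding cutle_def by metis
qed

text \<open>Polarization: for disjoint \<open>A\<close> and \<open>B\<close>, the square of \<open>A \<union> B\<close> consists of the two diagonal squares and
  of two rectangles on which the symmetric \<open>X\<close> has the same integral.\<close>

lemma rect_le_cut:
  assumes X: "X \<in> borel_measurable I2" "\<And>z. z \<in> space I2 \<Longrightarrow> \<bar>X z\<bar> \<le> 1"
    and sym: "\<And>x y. x \<in> {0..1} \<Longrightarrow> y \<in> {0..1} \<Longrightarrow> X (x, y) = X (y, x)"
    and le: "cutle X e" and A: "A \<in> sets I1" and B: "B \<in> sets I1" and AB: "A = B \<or> A \<inter> B = {}"
  shows "\<bar>LINT z|I2. rect A B z * X z\<bar> \<le> 2 * e"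
proof -
  have iX: "integrable I2 X" by (rule D2.integrable_bounded[OF X])
  have cA: "\<bar>cutI X C\<bar> \<le> e" if "C \<in> sets I1" for C using le that unfolding cutle_def by blast
  have e0: "0 \<le> e" using cA[OF A] by linarith
  show ?thesis
  proof (cases "A = B")
    case True
    then show ?thesis using cA[OF A] e0 by (simp add: cutI_def)
  next
    case False
    then have d: "A \<inter> B = {}" using AB by blast
    have "(LINT z|I2. rect B A z * X z) = (LINT z|I2. rect B A (snd z, fst z) * X (snd z, fst z))"
      by (rule integral_swap[symmetric]) (intro borel_measurable_times rect_measurable A B X(1))
    also have "\<dots> = (LINT z|I2. rect A B z * X z)"
      by (rule Bochner_Integration.integral_cong) (auto simp: rect_def sym)
    finally have sw: "(LINT z|I2. rect B A z * X z) = (LINT z|I2. rect A B z * X z)" .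
    have "rect (A \<union> B) (A \<union> B) z * X z
        = rect A A z * X z + rect A B z * X z + rect B A z * X z + rect B B z * X z" for z
      unfolding rect_def using d by (simp add: indicator_add[OF d, symmetric] algebra_simps)
    then have "cutI X (A \<union> B) = (LINT z|I2. rect A A z * X z + rect A B z * X z + rect B A z * X z + rect B B z * X z)"
      unfolding cutI_def by simp
    also have "\<dots> = cutI X A + 2 * (LINT z|I2. rect A B z * X z) + cutI X B"
      using integrable_rect_mult[OF A A iX] integrable_rect_mult[OF A B iX]
        integrable_rect_mult[OF B A iX] integrable_rect_mult[OF B B iX]
      by (simp add: sw cutI_def)
    finally show ?thesis using cA[OF A] cA[OF B] cA[OF sets.Un[OF A B]] e0 by linarith
  qed
qed

text \<open>Both graphons are near the same \<open>W\<close> after rearrangement; undoing the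
  rearrangement of \<open>U\<close> brings \<open>V\<close> near \<open>U\<close> itself.\<close>

lemma cutle_align:
  assumes U: "bgraphon U" and V: "bgraphon V" and W: "bgraphon W" and \<phi>: "aut \<phi>" and \<psi>: "aut \<psi>"
    and "cutle (\<lambda>z. pull \<phi> U z - W z) e" "cutle (\<lambda>z. pull \<psi> V z - W z) e"
  shows "\<exists>\<theta>. aut \<theta> \<and> cutle (\<lambda>z. pull \<theta> V z - U z) (2 * e)"
proof -
  obtain \<phi>' where \<phi>': "aut \<phi>'" and inv: "\<And>x. x \<in> {0..1} \<Longrightarrow> \<phi> (\<phi>' x) = x" using aut_inverse[OF \<phi>] by blast
  have pU: "bgraphon (pull \<phi> U)" and pV: "bgraphon (pull \<psi> V)"
    using U V \<phi> \<psi> by (auto intro: bgraphon_pull aut_mpt)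
  note i = bgraphon_integrable[OF pU] bgraphon_integrable[OF pV] bgraphon_integrable[OF W]
  have "cutle (\<lambda>z. pull \<psi> V z - pull \<phi> U z) (e + e)"
    by (rule cutle_triangle[OF i(2,3,1) assms(7) cutle_commute[OF i(1,3) assms(6)]])
  then have "cutle (pull \<phi>' (\<lambda>z. pull \<psi> V z - pull \<phi> U z)) (e + e)"
    by (intro cutle_pull \<phi>' borel_measurable_diff bgraphon_measurable pU pV)
  then have "cutle (\<lambda>z. pull (\<lambda>x. \<psi> (\<phi>' x)) V z - U z) (e + e)"
  proof (rule cutle_cong)
    fix z assume "z \<in> space I2"
    then show "pull \<phi>' (\<lambda>z. pull \<psi> V z - pull \<phi> U z) z = pull (\<lambda>x. \<psi> (\<phi>' x)) V z - U z"
      using inv[of "fst z"] inv[of "snd z"] by (auto simp: pull_def)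
  qed
  then show ?thesis using aut_comp[OF \<psi> \<phi>'] by (intro exI[of _ "\<lambda>x. \<psi> (\<phi>' x)"]) simp
qed

text \<open>Completeness from weak-star compactness: each cut integral is continuous under weak-star
  limits, so the Cauchy bounds pass to the limit.\<close>

lemma cut_Cauchy_limit:
  assumes V: "\<And>n. bgraphon (V n)" and step: "\<And>n. cutle (\<lambda>z. V (Suc n) z - V n z) (2 * (1/2) ^ n)"
  shows "\<exists>W s. bgraphon W \<and> strict_mono (s :: nat \<Rightarrow> nat) \<and> wconv (\<lambda>l. V (s l)) W \<and>
     (\<forall>n. cutle (\<lambda>z. W z - V n z) (4 * (1/2) ^ n))"
proof -
  note iV = bgraphon_integrable[OF V]
  \<comment> \<open>The subtracted term makes the induction close exactly: the step bound
    \<open>2 * (1/2) ^ (n + i)\<close> is the difference of two consecutive values of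
    \<open>4 * (1/2) ^ (n + i)\<close>.\<close>
  have Cauchy: "cutle (\<lambda>z. V (n + i) z - V n z) (4 * (1/2) ^ n - 4 * (1/2) ^ (n + i))" for n i
  proof (induction i)
    case 0
    then show ?case by (simp add: cutle_def cutI_def)
  next
    case (Suc i)
    have "cutle (\<lambda>z. V (Suc (n + i)) z - V n z) (2 * (1/2) ^ (n + i) + (4 * (1/2) ^ n - 4 * (1/2) ^ (n + i)))"
      by (rule cutle_triangle[OF iV iV iV step Suc.IH])
    moreover have "2 * (1/2 :: real) ^ (n + i) + (4 * (1/2) ^ n - 4 * (1/2) ^ (n + i))
        = 4 * (1/2) ^ n - 4 * (1/2) ^ Suc (n + i)" by simp
    ultimately show ?case by (simp only: add_Suc_right)
  qed
  obtain s W where s: "strict_mono (s :: nat \<Rightarrow> nat)" and W: "bgraphon W" and w: "wconv (\<lambda>l. V (s l)) W"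
    using bgraphon_compact[of V, OF V] by blast
  note iW = bgraphon_integrable[OF W]
  have "cutle (\<lambda>z. W z - V n z) (4 * (1/2) ^ n)" for n
    unfolding cutle_def
  proof
    fix A assume A: "A \<in> sets I1"
    show "\<bar>cutI (\<lambda>z. W z - V n z) A\<bar> \<le> 4 * (1/2) ^ n"
    proof (rule LIMSEQ_le_const2)
      show "(\<lambda>l. \<bar>cutI (\<lambda>z. V (s l) z - V n z) A\<bar>) \<longlonglongrightarrow> \<bar>cutI (\<lambda>z. W z - V n z) A\<bar>"
        by (intro tendsto_rabs wconv_cutI[OF w iV iW iV A])
      have "\<bar>cutI (\<lambda>z. V (s l) z - V n z) A\<bar> \<le> 4 * (1/2) ^ n" if "l \<ge> n" for l
      proof -
        have "n \<le> s l" using that seq_suble[OF s, of l] by linarith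
        then have "cutle (\<lambda>z. V (s l) z - V n z) (4 * (1/2) ^ n - 4 * (1/2) ^ s l)"
          using Cauchy[of n "s l - n"] by simp
        then have "\<bar>cutI (\<lambda>z. V (s l) z - V n z) A\<bar> \<le> 4 * (1/2) ^ n - 4 * (1/2) ^ s l"
          using A unfolding cutle_def by blast
        moreover have "0 \<le> 4 * (1/2 :: real) ^ s l" by simp
        ultimately show ?thesis by linarith
      qed
      then show "\<exists>N. \<forall>l\<ge>N. \<bar>cutI (\<lambda>z. V (s l) z - V n z) A\<bar> \<le> 4 * (1/2) ^ n" by blast
    qed
  qed
  then show ?thesis using W s w by blast
qed

context strictly_concave_unit
begin

interpretation CF: concave_filtration I2 dyad2 f ..

lemma energy_bounded_below: "\<exists>B. \<forall>W. bgraphon W \<longrightarrow> B \<le> (LINT z|I2. f (W z))"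
proof -
  obtain B where B: "\<And>x. x \<in> {0..1} \<Longrightarrow> \<bar>f x\<bar> \<le> B" using f_bounded by blast
  have "- B \<le> (LINT z|I2. f (W z))" if W: "bgraphon W" for W
  proof -
    have "(LINT z|I2. - B) \<le> (LINT z|I2. f (W z))"
    proof (rule integral_mono)
      show "integrable I2 (\<lambda>z. f (W z))"
        by (rule f_integrable[OF I2_finite bgraphon_measurable[OF W] bgraphon_unit[OF W]])
      show "- B \<le> f (W z)" if "z \<in> space I2" for z using B[OF bgraphon_unit[OF W that]] by linarith
    qed simp
    then show ?thesis using measure_I2_space by simp
  qed
  then show ?thesis by blast
qed

text \<open>The uniform gain lets a near-minimizer do: infinitely many distant terms would produce
  an accumulation point of the original sequence below the infimum.\<close>

lemma near_in_cut:
  assumes e: "e > 0" and U: "\<And>n. bgraphon (U n)"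
  shows "\<exists>r \<phi> W. strict_mono (r :: nat \<Rightarrow> nat) \<and> (\<forall>n. aut (\<phi> n)) \<and> bgraphon W \<and>
     (\<forall>n. cutle (\<lambda>z. pull (\<phi> n) (U (r n)) z - W z) e)"
proof -
  obtain \<delta> where d: "\<delta> > 0" and drop: "\<And>U W. (\<forall>n. bgraphon (U n)) \<Longrightarrow> bgraphon W \<Longrightarrow> wconv U W \<Longrightarrow>
     infinite {n. \<not> cutle (\<lambda>z. U n z - W z) e} \<Longrightarrow>
     \<exists>r \<phi> W'. strict_mono (r :: nat \<Rightarrow> nat) \<and> (\<forall>n. aut (\<phi> n)) \<and> bgraphon W' \<and> wconv (\<lambda>n. pull (\<phi> n) (U (r n))) W' \<and>
        (LINT z|I2. f (W' z)) \<le> (LINT z|I2. f (W z)) - \<delta>"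
    using energy_drop[OF e] by (elim exE conjE) (rule that, blast+)
  let ?E = "(\<lambda>W. LINT z|I2. f (W z)) ` acc U"
  have bdd: "bdd_below ?E"
    using energy_bounded_below unfolding bdd_below_def acc_def by fast
  have ne: "?E \<noteq> {}" using acc_nonempty[of U, OF U] by blast
  have "Inf ?E < Inf ?E + \<delta>" using d by simp
  from cInf_lessD[OF ne this] obtain W where W: "W \<in> acc U" and lt: "(LINT z|I2. f (W z)) < Inf ?E + \<delta>" by blast
  from W obtain r \<phi> where bW: "bgraphon W" and r: "strict_mono (r :: nat \<Rightarrow> nat)" and \<phi>: "\<And>n. aut (\<phi> n)"
    and w: "wconv (\<lambda>n. pull (\<phi> n) (U (r n))) W"
    unfolding acc_def by blast
  have fin: "finite {n. \<not> cutle (\<lambda>z. pull (\<phi> n) (U (r n)) z - W z) e}"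
  proof (rule ccontr)
    assume inf: "infinite {n. \<not> cutle (\<lambda>z. pull (\<phi> n) (U (r n)) z - W z) e}"
    have "\<forall>n. bgraphon (pull (\<phi> n) (U (r n)))" using bgraphon_pull[OF U aut_mpt[OF \<phi>]] by blast
    from drop[OF this bW w inf] obtain W' where W': "W' \<in> acc (\<lambda>n. pull (\<phi> n) (U (r n)))"
      and le: "(LINT z|I2. f (W' z)) \<le> (LINT z|I2. f (W z)) - \<delta>"
      unfolding acc_def by blast
    have "W' \<in> acc U" by (rule acc_trans[OF r \<phi> W'])
    then have "Inf ?E \<le> (LINT z|I2. f (W' z))" using bdd by (intro cInf_lower) auto
    then show False using le lt by linarith
  qed
  \<comment> \<open>Finitely many indices may be bad; they are skipped by starting at
    \<open>Suc N\<close>.\<close>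
  then obtain N where N: "\<And>n. \<not> cutle (\<lambda>z. pull (\<phi> n) (U (r n)) z - W z) e \<Longrightarrow> n \<le> N"
    using finite_nat_set_iff_bounded_le by auto
  have "cutle (\<lambda>z. pull (\<phi> (n + Suc N)) (U (r (n + Suc N))) z - W z) e" for n
    using N[of "n + Suc N"] by auto
  moreover have "strict_mono (\<lambda>n. r (n + Suc N))" using r by (simp add: strict_mono_def)
  ultimately show ?thesis using bW \<phi>
    by (intro exI[of _ "\<lambda>n. r (n + Suc N)"] exI[of _ "\<lambda>n. \<phi> (n + Suc N)"] exI[of _ W]) blast
qed

text \<open>Successive terms of a diagonal sequence are near each other after an automorphism.
  Composing these automorphisms places all terms in one frame, where they form a fast Cauchy
  sequence.\<close>

lemma cut_compactness:
  assumes U: "\<And>n. bgraphon (U n)"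
  shows "\<exists>k \<psi> W s. strict_mono (k :: nat \<Rightarrow> nat) \<and> (\<forall>n. aut (\<psi> n)) \<and> bgraphon W \<and> strict_mono (s :: nat \<Rightarrow> nat) \<and>
     wconv (\<lambda>l. pull (\<psi> (s l)) (U (k (s l)))) W \<and>
     (\<forall>n. cutle (\<lambda>z. W z - pull (\<psi> n) (U (k n)) z) (4 * (1/2) ^ n))"
proof -
  \<comment> \<open>All terms share the same centre \<open>W\<close>, so any two of them can be
    compared.\<close>
  define P where "P n s \<longleftrightarrow> (\<exists>\<phi> W. (\<forall>l. aut (\<phi> l)) \<and> bgraphon W \<and>
     (\<forall>l. cutle (\<lambda>z. pull (\<phi> l) (U (s l)) z - W z) ((1/2) ^ n)))" for n :: nat and s :: "nat \<Rightarrow> nat"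
  interpret subseqs P
  proof
    fix n and s :: "nat \<Rightarrow> nat"
    obtain r \<phi> W where "strict_mono (r :: nat \<Rightarrow> nat)" "\<forall>n. aut (\<phi> n)" "bgraphon W"
      "\<forall>l. cutle (\<lambda>z. pull (\<phi> l) (U (s (r l))) z - W z) ((1/2) ^ n)"
      using near_in_cut[of "(1/2) ^ n" "\<lambda>l. U (s l)"] U by auto
    then show "\<exists>r. strict_mono r \<and> P n (s \<circ> r)" unfolding P_def comp_def by blast
  qed
  have hold: "P j (diagseq \<circ> ((+) (Suc j)))" for j
  proof (rule diagseq_holds)
    fix r s :: "nat \<Rightarrow> nat" and n
    assume "P n s"
    then obtain \<phi> W where "\<forall>l. aut (\<phi> l)" "bgraphon W" "\<forall>l. cutle (\<lambda>z. pull (\<phi> l) (U (s l)) z - W z) ((1/2) ^ n)"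
      unfolding P_def by blast
    then show "P n (s \<circ> r)" unfolding P_def comp_def
      by (intro exI[of _ "\<lambda>l. \<phi> (r l)"] exI[of _ W]) blast
  qed
  \<comment> \<open>The stage-\<open>n\<close> property covers the diagonal sequence from index
    \<open>Suc n\<close> on, so \<open>k n\<close> and \<open>k (Suc n)\<close> share a centre at
    precision \<open>(1/2) ^ n\<close>.\<close>
  define k where "k n = diagseq (Suc n)" for n
  have k: "strict_mono k" using subseq_diagseq by (simp add: strict_mono_def k_def)
  have "\<exists>\<theta>. aut \<theta> \<and> cutle (\<lambda>z. pull \<theta> (U (k (Suc n))) z - U (k n) z) (2 * (1/2) ^ n)" for n
  proof -
    from hold[of n] obtain \<phi> W where \<phi>: "\<And>l. aut (\<phi> l)" and W: "bgraphon W"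
      and c: "\<And>l. cutle (\<lambda>z. pull (\<phi> l) (U (diagseq (Suc n + l))) z - W z) ((1/2) ^ n)"
      unfolding P_def comp_def by blast
    show ?thesis
      using cutle_align[OF U U W \<phi> \<phi> c[of 0] c[of 1]] by (simp add: k_def)
  qed
  then have "\<forall>n. \<exists>\<theta>. aut \<theta> \<and> cutle (\<lambda>z. pull \<theta> (U (k (Suc n))) z - U (k n) z) (2 * (1/2) ^ n)" by blast
  from choice[OF this] obtain \<theta> where \<theta>: "\<And>n. aut (\<theta> n)"
    and step: "\<And>n. cutle (\<lambda>z. pull (\<theta> n) (U (k (Suc n))) z - U (k n) z) (2 * (1/2) ^ n)" by blast
  \<comment> \<open>\<open>\<theta> n\<close> aligns term \<open>Suc n\<close> with term
    \<open>n\<close>, and pulling back by \<open>\<psi> n\<close> then carries it to the frame of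
    term 0. Pulling back composes in this order, see \<open>pull_pull\<close>.\<close>
  define \<psi> where "\<psi> = rec_nat (\<lambda>x. x) (\<lambda>n p x. \<theta> n (p x))"
  have \<psi>_Suc: "\<psi> (Suc n) = (\<lambda>x. \<theta> n (\<psi> n x))" for n by (simp add: \<psi>_def)
  have \<psi>: "aut (\<psi> n)" for n
  proof (induction n)
    case 0
    then show ?case using aut_id by (simp add: \<psi>_def)
  next
    case (Suc n)
    then show ?case unfolding \<psi>_Suc by (rule aut_comp[OF \<theta>])
  qed
  define V where "V n = pull (\<psi> n) (U (k n))" for n
  have V: "bgraphon (V n)" for n unfolding V_def by (intro bgraphon_pull U aut_mpt \<psi>)
  have "cutle (\<lambda>z. V (Suc n) z - V n z) (2 * (1/2) ^ n)" for n
  proof -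
    have "cutle (pull (\<psi> n) (\<lambda>z. pull (\<theta> n) (U (k (Suc n))) z - U (k n) z)) (2 * (1/2) ^ n)"
      by (intro cutle_pull \<psi> step borel_measurable_diff bgraphon_measurable bgraphon_pull U aut_mpt \<theta>)
    then show ?thesis
      by (rule cutle_cong) (simp add: V_def \<psi>_Suc pull_def)
  qed
  from cut_Cauchy_limit[of V, OF V this] obtain W s where "bgraphon W" "strict_mono (s :: nat \<Rightarrow> nat)" "wconv (\<lambda>l. V (s l)) W"
     "\<forall>n. cutle (\<lambda>z. W z - V n z) (4 * (1/2) ^ n)" by blast
  then show ?thesis using k \<psi> unfolding V_def by blast
qed

text \<open>Cut-norm closeness controls integrals over cell rectangles, so the cell averages of the
  rearranged copies of \<open>W\<close> converge to those of \<open>W'\<close>. By Jensen, each copy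
  has at most the energy of its averages. Let \<open>n\<close> grow first, then refine the
  partition.\<close>

lemma cut_limit_minimal:
  assumes W: "bgraphon W" and W': "bgraphon W'" and X: "\<And>n. bgraphon (X n)" and conv: "wconv X W'"
    and \<xi>: "\<And>n. mpt (\<xi> n)" and cut: "\<And>n. cutle (\<lambda>z. pull (\<xi> n) W z - X n z) (d n)" and d: "d \<longlonglongrightarrow> 0"
  shows "(LINT z|I2. f (W z)) \<le> (LINT z|I2. f (W' z))"
proof -
  have Y: "bgraphon (pull (\<xi> n) W)" for n by (intro bgraphon_pull W \<xi>)
  have cavg: "(\<lambda>n. D2.cavg m (pull (\<xi> n) W) (i, j)) \<longlonglongrightarrow> D2.cavg m W' (i, j)" for m i j
  proof -
    let ?R = "rect (D1.cell m i) (D1.cell m j)"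
    have d2: "(\<lambda>n. 2 * d n) \<longlonglongrightarrow> 0" using tendsto_mult_right_zero[OF d, of 2] by simp
    have c: "\<bar>LINT z|I2. ?R z * (pull (\<xi> n) W z - X n z)\<bar> \<le> 2 * d n" for n
    proof (rule rect_le_cut[OF _ _ _ cut D1.cell_sets D1.cell_sets])
      show "(\<lambda>z. pull (\<xi> n) W z - X n z) \<in> borel_measurable I2"
        by (intro borel_measurable_diff bgraphon_measurable X Y)
      show "\<bar>pull (\<xi> n) W z - X n z\<bar> \<le> 1" if "z \<in> space I2" for z
        using bgraphon_unit[OF X that, of n] bgraphon_unit[OF Y that, of n] by auto
      show "pull (\<xi> n) W (x, y) - X n (x, y) = pull (\<xi> n) W (y, x) - X n (y, x)"
        if "x \<in> {0..1}" "y \<in> {0..1}" for x y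
        using that X[of n] Y[of n] unfolding bgraphon_def by metis
      show "D1.cell m i = D1.cell m j \<or> D1.cell m i \<inter> D1.cell m j = {}"
        by (auto simp: dyad_cell)
    qed
    have split: "(LINT z|I2. ?R z * (pull (\<xi> n) W z - X n z)) = (LINT z|I2. ?R z * pull (\<xi> n) W z) - (LINT z|I2. ?R z * X n z)" for n
      using integrable_rect_mult[OF D1.cell_sets D1.cell_sets bgraphon_integrable[OF Y], of m i m j n]
        integrable_rect_mult[OF D1.cell_sets D1.cell_sets bgraphon_integrable[OF X], of m i m j n]
      by (simp add: right_diff_distrib)
    have "norm ((LINT z|I2. ?R z * pull (\<xi> n) W z) - (LINT z|I2. ?R z * X n z)) \<le> norm (2 * d n) * 1" for n
      using c[of n] unfolding split real_norm_def by linarith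
    then have "(\<lambda>n. (LINT z|I2. ?R z * pull (\<xi> n) W z) - (LINT z|I2. ?R z * X n z)) \<longlonglongrightarrow> 0"
      by (intro tendsto_0_le[OF d2, where K = 1] always_eventually allI)
    from tendsto_add[OF this wconv_rect[OF conv D1.cell_sets D1.cell_sets, of m i m j]]
    have "(\<lambda>n. LINT z|I2. ?R z * pull (\<xi> n) W z) \<longlonglongrightarrow> (LINT z|I2. ?R z * W' z)" by simp
    \<comment> \<open>On null cells all the averages are 0 by convention.\<close>
    then show ?thesis unfolding cavg2_rect
      by (cases "measure I2 (D2.cell m (i, j)) = 0") (auto intro: tendsto_divide)
  qed
  have "(LINT z|I2. f (W z)) \<le> (LINT z|I2. f (D2.cexp m W' z))" for m
  proof (rule LIMSEQ_le_const)
    have ex: "(LINT z|I2. f (D2.cexp m V z)) = (\<Sum>k\<in>dyad2 m ` space I2. f (D2.cavg m V k) * measure I2 (D2.cell m k))" for V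
      unfolding D2.cexp_def by (rule D2.integral_label)
    show "(\<lambda>n. LINT z|I2. f (D2.cexp m (pull (\<xi> n) W) z)) \<longlonglongrightarrow> (LINT z|I2. f (D2.cexp m W' z))"
      unfolding ex
    proof (intro tendsto_sum tendsto_mult tendsto_const)
      fix k :: "nat \<times> nat"
      have "(\<lambda>n. D2.cavg m (pull (\<xi> n) W) k) \<longlonglongrightarrow> D2.cavg m W' k" using cavg[of m "fst k" "snd k"] by simp
      then show "(\<lambda>n. f (D2.cavg m (pull (\<xi> n) W) k)) \<longlonglongrightarrow> f (D2.cavg m W' k)"
        by (rule continuous_on_tendsto_compose[OF f_cont])
          (intro always_eventually allI bgraphon_cavg W' Y)+
    qed
    have "(LINT z|I2. f (W z)) \<le> (LINT z|I2. f (D2.cexp m (pull (\<xi> n) W) z))" for n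
    proof -
      have "(LINT z|I2. f (W z)) = (LINT z|I2. pull (\<xi> n) (\<lambda>z. f (W z)) z)"
        by (rule integral_pull[symmetric, OF \<xi> f_measurable[OF bgraphon_measurable[OF W] bgraphon_unit[OF W]]])
      also have "\<dots> = (LINT z|I2. f (pull (\<xi> n) W z))" by (simp add: pull_def)
      also have "\<dots> \<le> (LINT z|I2. f (D2.cexp m (pull (\<xi> n) W) z))"
        by (rule CF.jensen[OF bgraphon_measurable[OF Y] bgraphon_unit[OF Y]])
      finally show ?thesis .
    qed
    then show "\<exists>N. \<forall>n\<ge>N. (LINT z|I2. f (W z)) \<le> (LINT z|I2. f (D2.cexp m (pull (\<xi> n) W) z))" by blast
  qed
  moreover have "(\<lambda>m. LINT z|I2. f (D2.cexp m W' z)) \<longlonglongrightarrow> (LINT z|I2. f (W' z))"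
    by (rule energy_cexp_tendsto[OF W'])
  ultimately show ?thesis by (intro LIMSEQ_le_const) auto
qed

text \<open>The cut-norm limit \<open>W\<close> is itself an accumulation point, and near it every
  other accumulation point is a weak-star limit of rearranged copies of \<open>W\<close>.\<close>

lemma minimizer_exists:
  assumes U: "\<And>n. bgraphon (U n)"
  shows "\<exists>k W. strict_mono (k :: nat \<Rightarrow> nat) \<and> W \<in> acc (\<lambda>n. U (k n)) \<and>
     (\<forall>W'\<in>acc (\<lambda>n. U (k n)). (LINT z|I2. f (W z)) \<le> (LINT z|I2. f (W' z)))"
proof -
  from cut_compactness[of U, OF U] obtain k \<psi> W s where
    "strict_mono (k :: nat \<Rightarrow> nat) \<and> (\<forall>n. aut (\<psi> n)) \<and> bgraphon W \<and> strict_mono (s :: nat \<Rightarrow> nat) \<and>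
     wconv (\<lambda>l. pull (\<psi> (s l)) (U (k (s l)))) W \<and>
     (\<forall>n. cutle (\<lambda>z. W z - pull (\<psi> n) (U (k n)) z) (4 * (1/2) ^ n))"
    by (elim exE) (rule that)
  then have k: "strict_mono k" and \<psi>: "\<And>n. aut (\<psi> n)" and W: "bgraphon W" and s: "strict_mono s"
    and w: "wconv (\<lambda>l. pull (\<psi> (s l)) (U (k (s l)))) W"
    and cut: "\<And>n. cutle (\<lambda>z. W z - pull (\<psi> n) (U (k n)) z) (4 * (1/2) ^ n)"
    by blast+
  have "W \<in> acc (\<lambda>n. U (k n))"
    unfolding acc_def using W s \<psi> w by (intro CollectI conjI exI[of _ s] exI[of _ "\<lambda>l. \<psi> (s l)"]) blast+
  moreover have "(LINT z|I2. f (W z)) \<le> (LINT z|I2. f (W' z))" if W'a: "W' \<in> acc (\<lambda>n. U (k n))" for W'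
  proof -
    from W'a obtain r \<phi> where W': "bgraphon W'" and r: "strict_mono (r :: nat \<Rightarrow> nat)" and \<phi>: "\<And>n. aut (\<phi> n)"
      and conv: "wconv (\<lambda>n. pull (\<phi> n) (U (k (r n)))) W'"
      unfolding acc_def by blast
    have "\<forall>n. \<exists>\<psi>'. aut \<psi>' \<and> (\<forall>x\<in>{0..1}. \<psi> n (\<psi>' x) = x)" using aut_inverse[OF \<psi>] by blast
    from choice[OF this] obtain \<psi>' where \<psi>': "\<And>n. aut (\<psi>' n)" and inv: "\<And>n x. x \<in> {0..1} \<Longrightarrow> \<psi> n (\<psi>' n x) = x" by blast
    \<comment> \<open>Chosen so that \<open>\<psi> (r n)\<close> after \<open>\<xi> n\<close> is
      \<open>\<phi> n\<close>: pulling the cut-norm estimate back by \<open>\<xi> n\<close> compares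
      a copy of \<open>W\<close> with the given rearrangement of \<open>U (k (r n))\<close>.\<close>
    define \<xi> where "\<xi> n x = \<psi>' (r n) (\<phi> n x)" for n x
    have \<xi>: "aut (\<xi> n)" for n
      unfolding \<xi>_def[abs_def] by (rule aut_comp[OF \<psi>' \<phi>])
    show ?thesis
    proof (rule cut_limit_minimal[OF W W' bgraphon_pull[OF U aut_mpt[OF \<phi>]] conv aut_mpt[OF \<xi>]])
      fix n
      have "cutle (pull (\<xi> n) (\<lambda>z. W z - pull (\<psi> (r n)) (U (k (r n))) z)) (4 * (1/2) ^ r n)"
        by (intro cutle_pull \<xi> cut borel_measurable_diff bgraphon_measurable bgraphon_pull W U aut_mpt \<psi>)
      then show "cutle (\<lambda>z. pull (\<xi> n) W z - pull (\<phi> n) (U (k (r n))) z) (4 * (1/2) ^ r n)"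
      proof (rule cutle_cong)
        fix z assume "z \<in> space I2"
        then have "fst z \<in> {0..1}" "snd z \<in> {0..1}" by auto
        then show "pull (\<xi> n) (\<lambda>z. W z - pull (\<psi> (r n)) (U (k (r n))) z) z = pull (\<xi> n) W z - pull (\<phi> n) (U (k (r n))) z"
          using inv mpt_unit[OF aut_mpt[OF \<phi>]] by (simp add: pull_def \<xi>_def del: atLeastAtMost_iff)
      qed
    next
      have "(\<lambda>n. 4 * (1/2 :: real) ^ n) \<longlonglongrightarrow> 0" by (intro tendsto_mult_right_zero LIMSEQ_power_zero) simp
      from LIMSEQ_subseq_LIMSEQ[OF this r] show "(\<lambda>n. 4 * (1/2 :: real) ^ r n) \<longlonglongrightarrow> 0" by (simp add: comp_def)
    qed
  qed
  ultimately show ?thesis using k by blast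
qed

end

subsection \<open>Lebesgue measurable graphons and their versions\<close>

text \<open>A completed set inside \<open>\<Omega>\<close> is a measurable set together with part of
  a null set, and that null set can be cut down to \<open>\<Omega>\<close>. Both sides therefore
  have the same sets, measured by the same measurable part.\<close>

lemma restrict_space_completion:
  assumes O: "\<Omega> \<in> sets M"
  shows "restrict_space (completion M) \<Omega> = completion (restrict_space M \<Omega>)"
proof -
  have sp: "\<Omega> \<subseteq> space M" using sets.sets_into_space[OF O] .
  have O': "\<Omega> \<inter> space M \<in> sets M" "\<Omega> \<inter> space (completion M) \<in> sets (completion M)"
    using O sp by (simp_all add: Int_absorb2)
  have L: "A \<in> sets (restrict_space (completion M) \<Omega>) \<longleftrightarrow> A \<in> sets (completion M) \<and> A \<subseteq> \<Omega>" for A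
    using O by (subst sets_restrict_space_iff[OF O'(2)]) auto
  have R: "A \<in> sets (restrict_space M \<Omega>) \<longleftrightarrow> A \<in> sets M \<and> A \<subseteq> \<Omega>" for A
    using O by (subst sets_restrict_space_iff[OF O'(1)]) auto
  have dec: "\<exists>S N N'. A = S \<union> N \<and> N \<subseteq> N' \<and> N' \<in> null_sets M \<and> S \<in> sets M \<and> S \<subseteq> \<Omega> \<and> N' \<subseteq> \<Omega>"
    if A: "A \<in> sets (completion M)" "A \<subseteq> \<Omega>" for A
  proof -
    obtain S N N' where "A = S \<union> N" "N \<subseteq> N'" "N' \<in> null_sets M" "S \<in> sets M"
      using A(1) by (rule sets_completionE)
    then show ?thesis using A(2) O
      by (intro exI[of _ S] exI[of _ N] exI[of _ "N' \<inter> \<Omega>"]) (auto intro: null_set_Int2)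
  qed
  show ?thesis
  proof (rule measure_eqI)
    show sets: "sets (restrict_space (completion M) \<Omega>) = sets (completion (restrict_space M \<Omega>))"
    proof (intro set_eqI iffI)
      fix A assume "A \<in> sets (restrict_space (completion M) \<Omega>)"
      then have "A \<in> sets (completion M)" "A \<subseteq> \<Omega>" unfolding L by auto
      from dec[OF this]
      obtain S N N' where A: "A = S \<union> N" "N \<subseteq> N'" "N' \<in> null_sets M" "S \<in> sets M" "S \<subseteq> \<Omega>" "N' \<subseteq> \<Omega>"
        by (elim exE conjE) (rule that)
      then show "A \<in> sets (completion (restrict_space M \<Omega>))"
        by (intro sets_completionI[OF A(1,2)]) (auto simp: R null_sets_restrict_space[OF O])
    next
      fix A assume "A \<in> sets (completion (restrict_space M \<Omega>))"
      then obtain S N N' where A: "A = S \<union> N" "N \<subseteq> N'" "N' \<in> null_sets (restrict_space M \<Omega>)" "S \<in> sets (restrict_space M \<Omega>)"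
        by (rule sets_completionE)
      then have "N' \<in> null_sets M" "S \<in> sets M" "N' \<subseteq> \<Omega>" "S \<subseteq> \<Omega>"
        by (auto simp: R null_sets_restrict_space[OF O])
      then have "A \<in> sets (completion M)" by (intro sets_completionI[OF A(1,2)])
      moreover have "A \<subseteq> \<Omega>" using A \<open>N' \<subseteq> \<Omega>\<close> \<open>S \<subseteq> \<Omega>\<close> by auto
      ultimately show "A \<in> sets (restrict_space (completion M) \<Omega>)" unfolding L ..
    qed
    fix A assume "A \<in> sets (restrict_space (completion M) \<Omega>)"
    then have AO: "A \<in> sets (completion M)" "A \<subseteq> \<Omega>" unfolding L by auto
    from dec[OF this]
    obtain S N N' where A: "A = S \<union> N" "N \<subseteq> N'" "N' \<in> null_sets M" "S \<in> sets M" "S \<subseteq> \<Omega>" "N' \<subseteq> \<Omega>"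
      by (elim exE conjE) (rule that)
    have N1: "N \<in> null_sets (completion M)"
      using A unfolding null_sets_completion_iff2 by blast
    have "N' \<in> null_sets (restrict_space M \<Omega>)" using A by (simp add: null_sets_restrict_space[OF O])
    then have N2: "N \<in> null_sets (completion (restrict_space M \<Omega>))"
      using A(2) unfolding null_sets_completion_iff2 by blast
    have "emeasure (restrict_space (completion M) \<Omega>) A = emeasure (completion M) A"
      by (rule emeasure_restrict_space[OF O'(2) AO(2)])
    also have "\<dots> = emeasure (completion M) S"
      unfolding A(1) by (rule emeasure_Un_null_set) (use A N1 in auto)
    also have "\<dots> = emeasure M S" using A by simp
    also have "\<dots> = emeasure (restrict_space M \<Omega>) S"
      by (rule emeasure_restrict_space[OF O'(1), symmetric]) (rule A)
    also have "\<dots> = emeasure (completion (restrict_space M \<Omega>)) S" using A by (simp add: R)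
    also have "\<dots> = emeasure (completion (restrict_space M \<Omega>)) A"
      unfolding A(1) by (rule emeasure_Un_null_set[symmetric]) (use A N2 in \<open>auto simp: R\<close>)
    finally show "emeasure (restrict_space (completion M) \<Omega>) A = emeasure (completion (restrict_space M \<Omega>)) A" .
  qed
qed

lemma lebesgue_on_unit: "lebesgue_on {0..1} = completion I1"
  unfolding I1_def by (rule restrict_space_completion) simp

text \<open>Planar Lebesgue measure and the product agree on rectangles, and product measures are
  determined by rectangles.\<close>

lemma I2_restrict: "I2 = restrict_space lborel ({0..1} \<times> {0..1})"
  unfolding I2_def
proof (rule pair_measure_eqI)
  let ?R = "restrict_space (lborel :: (real \<times> real) measure) ({0..1} \<times> {0..1})"
  have sq: "{0..1::real} \<times> {0..1::real} \<in> sets borel" by (intro borel_closed closed_Times) auto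
  have spR: "space ?R = {0..1} \<times> {0..1}" by (simp add: space_restrict_space)
  have stR: "A \<in> sets ?R \<longleftrightarrow> A \<in> sets borel \<and> A \<subseteq> {0..1} \<times> {0..1}" for A
    using sq by (subst sets_restrict_space_iff) auto
  have borel: "f \<in> borel_measurable ?R" if "f \<in> borel_measurable borel" for f :: "real \<times> real \<Rightarrow> real"
    using that by (intro measurable_restrict_space1) simp
  have f: "fst \<in> ?R \<rightarrow>\<^sub>M I1" and s: "snd \<in> ?R \<rightarrow>\<^sub>M I1"
    by (rule measurable_to_I1[OF borel]; auto simp: spR borel_prod[symmetric])+
  have id: "(\<lambda>z. z) \<in> ?R \<rightarrow>\<^sub>M I1 \<Otimes>\<^sub>M I1" using measurable_Pair[OF f s] by simp
  have "(\<lambda>z. (fst z, snd z)) \<in> I1 \<Otimes>\<^sub>M I1 \<rightarrow>\<^sub>M borel \<Otimes>\<^sub>M borel"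
    by (intro measurable_Pair measurable_from_I1 measurable_fst measurable_snd)
  then have id': "(\<lambda>z. z) \<in> I1 \<Otimes>\<^sub>M I1 \<rightarrow>\<^sub>M borel" by (simp add: borel_prod)
  show "sets (I1 \<Otimes>\<^sub>M I1) = sets ?R"
  proof (intro set_eqI iffI)
    fix A assume A: "A \<in> sets (I1 \<Otimes>\<^sub>M I1)"
    have "A \<subseteq> {0..1} \<times> {0..1}" using sets.sets_into_space[OF A] by (simp add: space_pair_measure)
    moreover from this have "(\<lambda>z. z) -` A \<inter> space ?R = A" by (auto simp: spR)
    ultimately show "A \<in> sets ?R" using measurable_sets[OF id A] by simp
  next
    fix A assume A: "A \<in> sets ?R"
    then have "(\<lambda>z. z) -` A \<inter> space (I1 \<Otimes>\<^sub>M I1) \<in> sets (I1 \<Otimes>\<^sub>M I1)"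
      by (intro measurable_sets[OF id']) (simp add: stR)
    moreover have "(\<lambda>z. z) -` A \<inter> space (I1 \<Otimes>\<^sub>M I1) = A"
      using A by (auto simp: stR space_pair_measure)
    ultimately show "A \<in> sets (I1 \<Otimes>\<^sub>M I1)" by simp
  qed
  fix A B assume AB: "A \<in> sets I1" "B \<in> sets I1"
  then have AB': "A \<in> sets borel" "B \<in> sets borel" "A \<times> B \<subseteq> {0..1} \<times> {0..1}" by (auto simp: sets_I1)
  have "emeasure ?R (A \<times> B) = emeasure lborel (A \<times> B)"
    by (rule emeasure_restrict_space) (use sq AB' in simp_all)
  also have "\<dots> = emeasure lborel A * emeasure lborel B"
    using AB' by (simp add: lborel_prod[symmetric] lborel.emeasure_pair_measure_Times)
  finally show "emeasure I1 A * emeasure I1 B = emeasure ?R (A \<times> B)" using AB by (simp add: emeasure_I1)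
qed (rule I1.sigma_finite_measure_axioms)+

lemma lebesgue_on_square: "lebesgue_on ({0..1} \<times> {0..1}) = completion I2"
  unfolding I2_restrict
proof (rule restrict_space_completion)
  have "{0..1::real} \<times> {0..1::real} \<in> sets borel" by (intro borel_closed closed_Times) auto
  then show "{0..1::real} \<times> {0..1::real} \<in> sets lborel" by simp
qed

lemma completion_measurable_AE:
  fixes h k :: "'a \<Rightarrow> real"
  assumes h: "h \<in> borel_measurable (completion M)" and ae: "AE x in completion M. h x = k x"
  shows "k \<in> borel_measurable (completion M)"
proof (rule measurableI)
  fix A :: "real set" assume "A \<in> sets borel"
  then have "h -` A \<inter> space (completion M) \<in> sets (completion M)" by (rule measurable_sets[OF h])
  then show "k -` A \<inter> space (completion M) \<in> sets (completion M)"
  proof (rule completion.in_sets_AE[rotated])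
    show "AE x in completion M. x \<in> h -` A \<inter> space (completion M) \<longleftrightarrow> x \<in> k -` A \<inter> space (completion M)"
      using ae by eventually_elim simp
  qed auto
qed simp

text \<open>Completeness makes \<open>h\<close> measurable as soon as it agrees almost everywhere
  with a measurable function.\<close>

lemma integral_completion_AE:
  fixes h k :: "'a \<Rightarrow> real"
  assumes k: "k \<in> borel_measurable M" and ae: "AE x in M. h x = k x"
  shows "integral\<^sup>L (completion M) h = integral\<^sup>L M k"
proof -
  have kc: "k \<in> borel_measurable (completion M)" by (rule measurable_completion[OF k])
  have ae': "AE x in completion M. k x = h x" using AE_completion[OF ae] by eventually_elim simp
  have "integral\<^sup>L (completion M) k = integral\<^sup>L (completion M) h"
    by (rule integral_cong_AE[OF kc completion_measurable_AE[OF kc ae'] ae'])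
  then show ?thesis using integral_completion[OF k] by simp
qed

text \<open>\<open>INT_f\<close> and \<open>cut_norm\<close> are iterated Lebesgue integrals. Almost
  every section of \<open>h\<close> agrees almost everywhere with the section of \<open>k\<close>,
  so both integrations reduce to Borel ones and Fubini applies.\<close>

lemma iterated_integral_AE:
  assumes k: "integrable I2 k" and ae: "AE z in I2. h z = k z"
  shows "(LINT x|completion I1. (LINT y|completion I1. h (x, y))) = (LINT z|I2. k z :: real)"
proof -
  have km: "k \<in> borel_measurable (I1 \<Otimes>\<^sub>M I1)" using k unfolding I2_def by auto
  have "AE x in I1. (LINT y|completion I1. h (x, y)) = (LINT y|I1. k (x, y))"
    using I12.AE_pair[OF ae[unfolded I2_def]] AE_space
  proof eventually_elim
    case (elim x)
    have "(\<lambda>y. k (x, y)) \<in> borel_measurable I1"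
      using elim(2) km by (intro measurable_compose[OF measurable_Pair1']) auto
    then show ?case using elim(1) by (rule integral_completion_AE)
  qed
  then have "(LINT x|completion I1. (LINT y|completion I1. h (x, y))) = (LINT x|I1. (LINT y|I1. k (x, y)))"
  proof (rule integral_completion_AE[rotated])
    show "(\<lambda>x. LINT y|I1. k (x, y)) \<in> borel_measurable I1"
      using I1.borel_measurable_lebesgue_integral[of "\<lambda>x y. k (x, y)" I1] km by simp
  qed
  also have "\<dots> = (LINT z|I2. k z)"
    using I12.integral_fst'[of k] k unfolding I2_def by simp
  finally show ?thesis .
qed

section \<open>Borel representatives of Lebesgue measurable graphons\<close>

definition represents :: "(real \<times> real \<Rightarrow> real) \<Rightarrow> (real \<times> real \<Rightarrow> real) \<Rightarrow> bool" where
  "represents V W \<longleftrightarrow> bgraphon V \<and> (AE z in I2. W z = V z)"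

lemma AE_pull: "mpt \<phi> \<Longrightarrow> AE z in I2. P z \<Longrightarrow> AE z in I2. P (\<phi> (fst z), \<phi> (snd z))"
  by (rule AE_distrD[OF mpt_square(1)]) (simp_all only: mpt_square(2))

lemma AE_square:
  assumes "AE x in I1. P x"
  shows "AE z in I2. P (fst z) \<and> P (snd z)"
proof -
  obtain N where N: "N \<in> null_sets I1" "{x\<in>space I1. \<not> P x} \<subseteq> N"
    using assms unfolding eventually_ae_filter by blast
  let ?S = "{z\<in>space I2. fst z \<in> N \<or> snd z \<in> N}"
  have "measure I2 ?S \<le> 2 * measure I1 N" by (rule I2_strip) (use N in auto)
  then have "measure I2 ?S = 0" using N by (simp add: measure_eq_0_null_sets antisym)
  moreover have "?S \<in> sets I2"
  proof -
    have "N \<in> sets I1" using N by auto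
    then show ?thesis by measurable
  qed
  ultimately have "?S \<in> null_sets I2" by (intro null_setsI) (simp_all add: I2.emeasure_eq_measure)
  then show ?thesis
    by (rule AE_I') (use N in auto)
qed

lemma graphon_measurable: "graphon W \<Longrightarrow> W \<in> borel_measurable (completion I2)"
  by (simp add: graphon_def lebesgue_on_square)

text \<open>The Borel function supplied by the completion may leave the unit interval or lose
  symmetry on a null set. Clamping and averaging with the reflection repair this everywhere.\<close>

lemma graphon_represented:
  assumes W: "graphon W"
  shows "\<exists>V. represents V W"
proof -
  obtain g where g: "g \<in> borel_measurable I2" and ae: "AE z in I2. W z = g z"
    using completion_ex_borel_measurable_real[OF graphon_measurable[OF W]] by blast
  define h where "h z = max 0 (min 1 (g z))" for z
  define V where "V z = (h z + h (snd z, fst z)) / 2" for z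
  have h: "h \<in> borel_measurable I2" unfolding h_def using g by measurable
  have hs: "(\<lambda>z. h (snd z, fst z)) \<in> borel_measurable I2" by (rule measurable_compose[OF swap_I2(1) h])
  have W01: "W z \<in> {0..1}" "W (snd z, fst z) = W z" if "z \<in> space I2" for z
    using W that unfolding graphon_def by (cases z, simp)+
  have aeh: "AE z in I2. W z = h z"
    using ae AE_space
  proof eventually_elim
    case (elim z)
    then show ?case using W01(1)[of z] by (simp add: h_def)
  qed
  then have "AE z in I2. W (snd z, fst z) = h (snd z, fst z)"
    by (intro AE_distrD[OF swap_I2(1), of "\<lambda>z. W z = h z"]) (simp only: swap_I2(2))
  with aeh AE_space[of I2] have "AE z in I2. W z = V z"
  proof eventually_elim
    case (elim z)
    then show ?case using W01(2)[of z] by (simp add: V_def)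
  qed
  moreover have "bgraphon V"
    unfolding bgraphon_def
  proof (intro conjI ballI)
    show "V \<in> borel_measurable I2" unfolding V_def using h hs by measurable
    show "V z \<in> {0..1}" for z by (auto simp: V_def h_def)
    show "V (x, y) = V (y, x)" for x y by (simp add: V_def)
  qed
  ultimately show ?thesis unfolding represents_def by blast
qed

lemma bgraphon_graphon: "bgraphon V \<Longrightarrow> graphon V"
  unfolding graphon_def lebesgue_on_square bgraphon_def by (auto intro: measurable_completion)

lemma represents_self: "bgraphon V \<Longrightarrow> represents V V"
  by (simp add: represents_def)

text \<open>The two notions also differ in their test functions, so a Lebesgue integrable one is
  replaced by a Borel function equal to it almost everywhere.\<close>

lemma weak_star_iff_wconv:
  assumes U: "\<And>n. represents (V n) (U n)" and W: "represents X W"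
  shows "weak_star_converges U W \<longleftrightarrow> wconv V X"
proof -
  have eq: "(LINT z|completion I2. U z * g z) = (LINT z|I2. V z * g' z)"
    if "represents V U" "g' \<in> borel_measurable I2" "AE z in I2. g z = g' z" for U V g g'
  proof (rule integral_completion_AE)
    show "(\<lambda>z. V z * g' z) \<in> borel_measurable I2"
      using that(1,2) by (auto simp: represents_def dest: bgraphon_measurable)
    have "AE z in I2. U z = V z" using that(1) by (simp add: represents_def)
    then show "AE z in I2. U z * g z = V z * g' z" using that(3) by eventually_elim simp
  qed
  show ?thesis
  proof
    assume L: "weak_star_converges U W"
    show "wconv V X"
      unfolding wconv_def
    proof (intro allI impI)
      fix g :: "real \<times> real \<Rightarrow> real" assume g: "integrable I2 g"
      then have gm: "g \<in> borel_measurable I2" by simp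
      then have "integrable (completion I2) g" using g by (simp add: integrable_completion)
      then have "(\<lambda>n. LINT z|completion I2. U n z * g z) \<longlonglongrightarrow> (LINT z|completion I2. W z * g z)"
        using L unfolding weak_star_converges_def lebesgue_on_square by blast
      moreover have "(LINT z|completion I2. U n z * g z) = (LINT z|I2. V n z * g z)" for n
        by (rule eq[OF U gm]) simp
      moreover have "(LINT z|completion I2. W z * g z) = (LINT z|I2. X z * g z)"
        by (rule eq[OF W gm]) simp
      ultimately show "(\<lambda>n. LINT z|I2. V n z * g z) \<longlonglongrightarrow> (LINT z|I2. X z * g z)"
        by (simp only:)
    qed
  next
    assume R: "wconv V X"
    show "weak_star_converges U W"
      unfolding weak_star_converges_def lebesgue_on_square
    proof (intro allI impI)
      fix g :: "real \<times> real \<Rightarrow> real" assume g: "integrable (completion I2) g"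
      obtain g' where g': "g' \<in> borel_measurable I2" and ae: "AE z in I2. g z = g' z"
        using completion_ex_borel_measurable_real[OF borel_measurable_integrable[OF g]] by blast
      have "integrable (completion I2) g'"
        using g' ae by (intro integrable_cong_AE_imp[OF g]) (auto intro: measurable_completion AE_completion)
      then have "integrable I2 g'" using g' by (simp add: integrable_completion)
      then show "(\<lambda>n. LINT z|completion I2. U n z * g z) \<longlonglongrightarrow> (LINT z|completion I2. W z * g z)"
        using R eq[OF U g' ae] eq[OF W g' ae] unfolding wconv_def by simp
    qed
  qed
qed

lemma INT_f_represented:
  assumes "strictly_concave_unit f" and V: "represents V W"
  shows "INT_f f W = (LINT z|I2. f (V z))"
proof -
  have bV: "bgraphon V" using V by (simp add: represents_def)
  have "integrable I2 (\<lambda>z. f (V z))"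
    by (rule strictly_concave_unit.f_integrable[OF assms(1) I2_finite bgraphon_measurable[OF bV] bgraphon_unit[OF bV]])
  moreover have "AE z in I2. f (W z) = f (V z)"
    using V unfolding represents_def by (auto elim: eventually_mono)
  ultimately show ?thesis
    unfolding INT_f_def lebesgue_on_unit by (rule iterated_integral_AE)
qed

text \<open>A Lebesgue set differs from a Borel set by a null set, whose strips in the square are
  null; so the bound over Borel sets is enough.\<close>

lemma cut_norm_le:
  assumes X: "integrable I2 X" and ae: "AE z in I2. U z = X z" and le: "cutle X e"
  shows "\<bar>cut_norm U\<bar> \<le> e"
proof -
  have key: "\<bar>LINT x:A|lebesgue. (LINT y:A|lebesgue. U (x, y))\<bar> \<le> e"
    if "A \<in> sets (lebesgue_on {0..1})" for A
  proof -
    have A: "A \<in> sets (completion I1)" using that by (simp add: lebesgue_on_unit)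
    have A01: "A \<subseteq> {0..1}" using sets.sets_into_space[OF A] by simp
    have r: "(LINT x:A|lebesgue. F x) = (LINT x|completion I1. indicator A x * F x)" for F :: "real \<Rightarrow> real"
    proof -
      have "(LINT x|lebesgue_on {0..1}. indicator A x * F x) = (LINT x|lebesgue. indicator {0..1} x *\<^sub>R (indicator A x * F x))"
        by (rule integral_restrict_space) simp
      also have "\<dots> = (LINT x:A|lebesgue. F x)"
        unfolding set_lebesgue_integral_def
        using A01 by (intro Bochner_Integration.integral_cong refl) (auto simp: indicator_def)
      finally show ?thesis by (simp add: lebesgue_on_unit)
    qed
    obtain S N N' where S: "A = S \<union> N" "N \<subseteq> N'" "N' \<in> null_sets I1" "S \<in> sets I1"
      using A by (rule sets_completionE)
    have "AE x in I1. x \<in> A \<longleftrightarrow> x \<in> S"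
      using AE_not_in[OF S(3)] by eventually_elim (use S in auto)
    from AE_square[OF this] ae
    have "AE z in I2. rect A A z * U z = rect S S z * X z"
      by eventually_elim (simp add: rect_def indicator_def)
    then have "(LINT x|completion I1. (LINT y|completion I1. rect A A (x, y) * U (x, y))) = cutI X S"
      unfolding cutI_def by (rule iterated_integral_AE[OF integrable_rect_mult[OF S(4,4) X]])
    moreover have "(LINT x:A|lebesgue. (LINT y:A|lebesgue. U (x, y)))
        = (LINT x|completion I1. (LINT y|completion I1. rect A A (x, y) * U (x, y)))"
      unfolding r by (simp add: rect_def mult.assoc)
    ultimately show ?thesis using le S(4) unfolding cutle_def by simp
  qed
  have "cut_norm U \<le> e"
    unfolding cut_norm_def by (rule cSUP_least) (use key in auto)
  \<comment> \<open>The empty set contributes 0, and \<open>key\<close> bounds the family whose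
    supremum is taken.\<close>
  moreover have "0 \<le> cut_norm U"
    unfolding cut_norm_def
  proof (rule cSUP_upper2)
    show "bdd_above ((\<lambda>A. \<bar>LINT x:A|lebesgue. (LINT y:A|lebesgue. U (x, y))\<bar>) ` sets (lebesgue_on {0..1}))"
      using key by (intro bdd_aboveI2[of _ _ e]) auto
  qed (auto intro: sets.empty_sets)
  ultimately show ?thesis by simp
qed

lemma mpt_measure_preserving:
  assumes \<psi>: "mpt \<psi>"
  shows "measure_preserving \<psi>"
proof -
  have m: "\<psi> \<in> completion I1 \<rightarrow>\<^sub>M I1" by (rule measurable_completion[OF mpt_measurable[OF \<psi>]])
  have d: "distr (completion I1) I1 \<psi> = I1"
    using distr_completion[OF mpt_measurable[OF \<psi>]] \<psi> by (simp add: mpt_def)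
  have "\<psi> \<in> completion I1 \<rightarrow>\<^sub>M completion I1"
    by (rule completion.measurable_completion2[OF m]) (simp add: d)
  moreover have "distr (completion I1) (completion I1) \<psi> = completion I1"
    using completion.completion_distr_eq[OF m] d by simp
  ultimately show ?thesis unfolding measure_preserving_def lebesgue_on_unit by simp
qed

text \<open>A version moves arguments by the inverse of its almost-bijection. So the
  almost-bijection is the inverse of \<open>\<phi>\<close>, with the whole interval as both conull
  sets.\<close>

lemma version_of_pull:
  assumes \<Gamma>: "graphon \<Gamma>" and V: "represents V \<Gamma>" and \<phi>: "aut \<phi>"
  shows "version_of (pull \<phi> V) \<Gamma>"
proof -
  have bV: "bgraphon V" and ae: "AE z in I2. \<Gamma> z = V z" using V by (simp_all add: represents_def)
  obtain \<psi> where \<psi>: "aut \<psi>" and inv: "\<And>x. x \<in> {0..1} \<Longrightarrow> \<psi> (\<phi> x) = x \<and> \<phi> (\<psi> x) = x" using aut_inverse[OF \<phi>] by blast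
  have mp: "measure_preserving \<psi>" by (rule mpt_measure_preserving[OF aut_mpt[OF \<psi>]])
  have bij: "bij_betw \<psi> {0..1} {0..1}"
    by (rule bij_betw_byWitness[where f' = \<phi>])
      (use inv mpt_unit[OF aut_mpt[OF \<phi>]] mpt_unit[OF aut_mpt[OF \<psi>]] in auto)
  have ab: "almost_bijection \<psi> {0..1} {0..1}"
    using mp bij unfolding almost_bijection_def measure_preserving_def by simp
  have iv: "inv_into {0..1} \<psi> x = \<phi> x" if "x \<in> {0..1}" for x
  proof (rule inv_into_f_eq)
    show "inj_on \<psi> {0..1}" using bij by (rule bij_betw_imp_inj_on)
  qed (use inv[OF that] mpt_unit[OF aut_mpt[OF \<phi>] that] in auto)
  have "AE z in I2. pull \<phi> V z = \<Gamma> (inv_into {0..1} \<psi> (fst z), inv_into {0..1} \<psi> (snd z))"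
    using AE_pull[OF aut_mpt[OF \<phi>] ae] AE_space
  proof eventually_elim
    case (elim z)
    then show ?case using iv[of "fst z"] iv[of "snd z"] by (auto simp: pull_def)
  qed
  from AE_completion[OF this]
  have "AE (x, y) in lebesgue_on ({0..1} \<times> {0..1}). pull \<phi> V (x, y) = \<Gamma> (inv_into {0..1} \<psi> x, inv_into {0..1} \<psi> y)"
    unfolding lebesgue_on_square by (simp add: case_prod_beta')
  moreover have "graphon (pull \<phi> V)" by (intro bgraphon_graphon bgraphon_pull bV aut_mpt \<phi>)
  ultimately show ?thesis unfolding version_of_def using \<Gamma> ab mp by blast
qed

text \<open>Composing with \<open>\<gamma>\<close> cancels \<open>inv_into J1 \<gamma>\<close>
  almost everywhere. What remains factors \<open>V\<close> through a measure preserving map, which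
  is the input of \<open>version_approx\<close>.\<close>

lemma version_of_represented:
  assumes ver: "version_of \<Gamma>' \<Gamma>" and V': "represents V' \<Gamma>'" and V: "represents V \<Gamma>"
  shows "\<exists>\<gamma>. mpt \<gamma> \<and> (AE z in I2. V z = pull \<gamma> V' z)"
proof -
  from ver obtain \<gamma> J1 J2 where ab: "almost_bijection \<gamma> J1 J2" and mp: "measure_preserving \<gamma>"
    and ae: "AE (x, y) in lebesgue_on ({0..1} \<times> {0..1}). \<Gamma>' (x, y) = \<Gamma> (inv_into J1 \<gamma> x, inv_into J1 \<gamma> y)"
    unfolding version_of_def by blast
  have g: "\<gamma> \<in> completion I1 \<rightarrow>\<^sub>M completion I1" "distr (completion I1) (completion I1) \<gamma> = completion I1"
    using mp unfolding measure_preserving_def lebesgue_on_unit by simp_all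
  have "(\<lambda>x. \<gamma> x) \<in> borel_measurable (completion I1)"
    by (rule measurable_compose[OF g(1) measurable_completion[OF ident_I1]])
  then obtain h where h: "h \<in> borel_measurable I1" and ha: "AE x in I1. \<gamma> x = h x"
    using completion_ex_borel_measurable_real by blast
  \<comment> \<open>The Borel function \<open>h\<close> equals \<open>\<gamma>\<close> only almost
    everywhere; clamping keeps it in the interval on the exceptional set.\<close>
  define \<gamma>' where "\<gamma>' x = max 0 (min 1 (h x))" for x
  have g': "\<gamma>' \<in> I1 \<rightarrow>\<^sub>M I1"
    by (rule measurable_to_I1) (use h in \<open>auto simp: \<gamma>'_def[abs_def]\<close>)
  have \<gamma>\<gamma>': "AE x in I1. \<gamma> x = \<gamma>' x"
    using ha AE_space
  proof eventually_elim
    case (elim x)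
    then show ?case using measurable_space[OF g(1), of x] by (simp add: \<gamma>'_def)
  qed
  have "distr I1 I1 \<gamma>' = I1"
  proof (rule measure_eqI)
    fix A assume "A \<in> sets (distr I1 I1 \<gamma>')"
    then have A: "A \<in> sets I1" by simp
    have A': "A \<in> sets (completion I1)" using A by simp
    have "emeasure (distr I1 I1 \<gamma>') A = emeasure I1 (\<gamma>' -` A \<inter> space I1)"
      by (rule emeasure_distr[OF g' A])
    also have "\<dots> = emeasure (completion I1) (\<gamma>' -` A \<inter> space I1)"
      using measurable_sets[OF g' A] by simp
    also have "\<dots> = emeasure (completion I1) (\<gamma> -` A \<inter> space (completion I1))"
    proof (rule emeasure_eq_AE)
      show "AE x in completion I1. x \<in> \<gamma>' -` A \<inter> space I1 \<longleftrightarrow> x \<in> \<gamma> -` A \<inter> space (completion I1)"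
        using AE_completion[OF \<gamma>\<gamma>'] by eventually_elim auto
    qed (use measurable_sets[OF g' A] measurable_sets[OF g(1) A'] in auto)
    also have "\<dots> = emeasure (distr (completion I1) (completion I1) \<gamma>) A"
      by (rule emeasure_distr[OF g(1) A', symmetric])
    also have "\<dots> = emeasure I1 A" using A by (simp add: g(2))
    finally show "emeasure (distr I1 I1 \<gamma>') A = emeasure I1 A" .
  qed simp
  with g' have mpt: "mpt \<gamma>'" by (simp add: mpt_def)
  have "unit_ivl - J1 \<in> null_sets lebesgue" and inj: "inj_on \<gamma> J1"
    using ab unfolding almost_bijection_def by (auto simp: negligible_iff_null_sets bij_betw_def)
  then have "AE x in lebesgue. x \<notin> unit_ivl - J1" by (intro AE_not_in)
  then have "AE x in lebesgue_on {0..1}. x \<in> J1"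
    by (subst AE_restrict_space_iff) (auto elim: eventually_mono)
  then have "AE x in I1. x \<in> J1" by (simp only: lebesgue_on_unit AE_completion_iff)
  with \<gamma>\<gamma>' have "AE x in I1. inv_into J1 \<gamma> (\<gamma>' x) = x"
    by eventually_elim (metis inj inv_into_f_f)
  note i = AE_square[OF this]
  have "AE z in completion I2. \<Gamma>' z = \<Gamma> (inv_into J1 \<gamma> (fst z), inv_into J1 \<gamma> (snd z))"
    using ae unfolding lebesgue_on_square by (simp add: case_prod_beta')
  then have "AE z in I2. \<Gamma>' z = \<Gamma> (inv_into J1 \<gamma> (fst z), inv_into J1 \<gamma> (snd z))"
    by (simp add: AE_completion_iff)
  moreover have "AE z in I2. \<Gamma>' z = V' z" and aeV: "AE z in I2. \<Gamma> z = V z" using V V' by (simp_all add: represents_def)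
  ultimately have "AE z in I2. V' z = \<Gamma> (inv_into J1 \<gamma> (fst z), inv_into J1 \<gamma> (snd z))"
    by eventually_elim simp
  from AE_pull[OF mpt this] i aeV have "AE z in I2. V z = pull \<gamma>' V' z"
    by eventually_elim (simp add: pull_def)
  then show ?thesis using mpt by blast
qed

text \<open>L1-closeness handles bounded test functions. The differences are bounded by 1, so
  closing up in L1 reaches all integrable ones.\<close>

lemma wconv_perturb:
  assumes U: "\<And>n. bgraphon (U n)" and V: "\<And>n. bgraphon (V n)"
    and close: "(\<lambda>n. LINT z|I2. \<bar>U n z - V n z\<bar>) \<longlonglongrightarrow> 0" and conv: "wconv V W"
  shows "wconv U W"
  unfolding wconv_def
proof (intro allI impI)
  fix g :: "real \<times> real \<Rightarrow> real" assume g: "integrable I2 g"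
  have dm: "(\<lambda>z. U n z - V n z) \<in> borel_measurable I2" for n
    by (intro borel_measurable_diff bgraphon_measurable U V)
  have d1: "\<bar>U n z - V n z\<bar> \<le> 1" if "z \<in> space I2" for n z
    using bgraphon_unit[OF U that, of n] bgraphon_unit[OF V that, of n] by auto
  have di: "integrable I2 (\<lambda>z. (U n z - V n z) * u z)" if "integrable I2 u" for n u
    using that dm d1 by (intro Bochner_Integration.integrable_bound[OF that])
      (auto simp: abs_mult intro!: mult_left_le_one_le AE_I2)
  have "(\<lambda>n. LINT z|I2. (U n z - V n z) * g z) \<longlonglongrightarrow> 0"
    using g
  proof (induction rule: D2.closed_subspace_induct)
    case (ind m S)
    let ?A = "dyad2 m -` S \<inter> space I2"
    have iA: "integrable I2 (indicator ?A :: _ \<Rightarrow> real)" by (rule D2.integrable_ind[OF D2.label_set])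
    have "norm (LINT z|I2. (U n z - V n z) * indicator ?A z) \<le> norm (LINT z|I2. \<bar>U n z - V n z\<bar>) * 1" for n
    proof -
      have "\<bar>LINT z|I2. (U n z - V n z) * indicator ?A z\<bar> \<le> (LINT z|I2. \<bar>(U n z - V n z) * indicator ?A z\<bar>)"
        by (rule integral_abs_bound)
      also have "\<dots> \<le> (LINT z|I2. \<bar>U n z - V n z\<bar>)"
      proof (rule integral_mono)
        show "integrable I2 (\<lambda>z. \<bar>U n z - V n z\<bar>)"
          by (intro integrable_abs Bochner_Integration.integrable_diff bgraphon_integrable U V)
      qed (use integrable_abs[OF di[OF iA]] in \<open>auto simp: abs_mult indicator_def\<close>)
      finally show ?thesis by simp
    qed
    then show ?case by (intro tendsto_0_le[OF close, where K = 1] always_eventually allI)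
  next
    case (lin u v a b)
    have e: "(LINT z|I2. (U n z - V n z) * (a * u z + b * v z))
        = a * (LINT z|I2. (U n z - V n z) * u z) + b * (LINT z|I2. (U n z - V n z) * v z)" for n
    proof -
      have "(LINT z|I2. (U n z - V n z) * (a * u z + b * v z))
          = (LINT z|I2. a * ((U n z - V n z) * u z) + b * ((U n z - V n z) * v z))"
        by (simp add: algebra_simps)
      also have "\<dots> = a * (LINT z|I2. (U n z - V n z) * u z) + b * (LINT z|I2. (U n z - V n z) * v z)"
        using di[OF lin.hyps(1), of n] di[OF lin.hyps(2), of n]
        by (subst Bochner_Integration.integral_add) (auto simp del: left_diff_distrib)
      finally show ?thesis .
    qed
    have "(\<lambda>n. a * (LINT z|I2. (U n z - V n z) * u z) + b * (LINT z|I2. (U n z - V n z) * v z)) \<longlonglongrightarrow> a * 0 + b * 0"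
      by (intro tendsto_intros lin.IH)
    then show ?case unfolding e by simp
  next
    case (clo u s)
    show ?case
    proof (rule tendsto_approx)
      fix e :: real assume "e > 0"
      then obtain i where i: "(LINT z|I2. \<bar>u z - s i z\<bar>) < e"
        using eventually_happens'[OF sequentially_bot order_tendstoD(2)[OF clo.hyps(3)]] by blast
      have "\<bar>(LINT z|I2. (U n z - V n z) * u z) - (LINT z|I2. (U n z - V n z) * s i z)\<bar> \<le> (LINT z|I2. \<bar>u z - s i z\<bar>)" for n
        by (rule integral_bounded_diff[OF clo.hyps(1) clo.hyps(2) dm d1])
      then have "\<forall>n. \<bar>(LINT z|I2. (U n z - V n z) * u z) - (LINT z|I2. (U n z - V n z) * s i z)\<bar> \<le> e"
        using i by (meson less_imp_le order_trans)
      then show "\<exists>b L. b \<longlonglongrightarrow> L \<and> \<bar>0 - L\<bar> \<le> e \<and> (\<forall>n. \<bar>(LINT z|I2. (U n z - V n z) * u z) - b n\<bar> \<le> e)"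
        using clo.IH[of i] \<open>e > 0\<close>
        by (intro exI[of _ "\<lambda>n. LINT z|I2. (U n z - V n z) * s i z"] exI[of _ 0]) simp
    qed
  qed
  moreover have "(\<lambda>n. LINT z|I2. V n z * g z) \<longlonglongrightarrow> (LINT z|I2. W z * g z)" using conv g unfolding wconv_def by blast
  ultimately have "(\<lambda>n. (LINT z|I2. (U n z - V n z) * g z) + (LINT z|I2. V n z * g z)) \<longlonglongrightarrow> 0 + (LINT z|I2. W z * g z)"
    by (rule tendsto_add)
  moreover have "(LINT z|I2. (U n z - V n z) * g z) + (LINT z|I2. V n z * g z) = (LINT z|I2. U n z * g z)" for n
  proof -
    have "integrable I2 (\<lambda>z. V n z * g z)"
      by (rule D2.integrable_unit_mult[OF bgraphon_measurable[OF V] bgraphon_unit[OF V] g])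
    then have "(LINT z|I2. (U n z - V n z) * g z) + (LINT z|I2. V n z * g z) = (LINT z|I2. (U n z - V n z) * g z + V n z * g z)"
      by (rule Bochner_Integration.integral_add[OF di[OF g], symmetric])
    then show ?thesis by (simp add: algebra_simps)
  qed
  ultimately show "(\<lambda>n. LINT z|I2. U n z * g z) \<longlonglongrightarrow> (LINT z|I2. W z * g z)" by simp
qed

text \<open>Versions are demanded at every index; outside the range of \<open>r\<close> the identity
  supplies them.\<close>

lemma versions_along_subsequence:
  assumes \<Gamma>: "\<And>n. graphon (\<Gamma> n)" and V: "\<And>n. represents (V n) (\<Gamma> n)"
    and r: "strict_mono (r :: nat \<Rightarrow> nat)" and \<phi>: "\<And>n. aut (\<phi> n)"
  shows "\<exists>\<Gamma>'. (\<forall>n. version_of (\<Gamma>' n) (\<Gamma> n)) \<and> (\<forall>n. \<Gamma>' (r n) = pull (\<phi> n) (V (r n)))"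
proof -
  define \<theta> where "\<theta> n = (if n \<in> range r then \<phi> (inv r n) else (\<lambda>x. x))" for n
  have \<theta>: "aut (\<theta> n)" for n using \<phi> aut_id by (simp add: \<theta>_def)
  have "\<theta> (r n) = \<phi> n" for n using strict_mono_imp_inj_on[OF r] by (simp add: \<theta>_def)
  then show ?thesis using version_of_pull[OF \<Gamma> V \<theta>] by (intro exI[of _ "\<lambda>n. pull (\<theta> n) (V n)"]) simp
qed

text \<open>Arbitrary versions are approximated by automorphisms with L1-errors tending to 0, which
  leaves weak-star limits unchanged. Conversely, automorphisms along a subsequence extend to
  versions at all indices.\<close>

lemma ACC_iff_acc:
  assumes \<Gamma>: "\<And>n. graphon (\<Gamma> n)" and V: "\<And>n. represents (V n) (\<Gamma> n)"
    and W: "graphon W" and X: "represents X W"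
  shows "W \<in> ACC_weak_star \<Gamma> \<longleftrightarrow> X \<in> acc V"
proof
  assume "W \<in> ACC_weak_star \<Gamma>"
  then obtain \<Gamma>' r where ver: "\<And>n. version_of (\<Gamma>' n) (\<Gamma> n)" and r: "strict_mono (r :: nat \<Rightarrow> nat)"
    and w: "weak_star_converges (\<Gamma>' \<circ> r) W"
    unfolding ACC_weak_star_def weak_star_acc_point_def by blast
  have "\<forall>n. \<exists>V'. represents V' (\<Gamma>' n)"
    using ver graphon_represented unfolding version_of_def by blast
  from choice[OF this] obtain V' where V': "\<And>n. represents (V' n) (\<Gamma>' n)" by blast
  have bV: "bgraphon (V n)" and bV': "bgraphon (V' n)" for n using V V' by (simp_all add: represents_def)
  have "\<exists>\<phi>. aut \<phi> \<and> (LINT z|I2. \<bar>pull \<phi> (V n) z - V' n z\<bar>) \<le> inverse (real (Suc n))" for n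
  proof -
    obtain \<gamma> where "mpt \<gamma>" "AE z in I2. V n z = pull \<gamma> (V' n) z"
      using version_of_represented[OF ver V' V] by blast
    from version_approx[OF this(1) bV bV' this(2)] show ?thesis by simp
  qed
  then have "\<forall>n. \<exists>\<phi>. aut \<phi> \<and> (LINT z|I2. \<bar>pull \<phi> (V n) z - V' n z\<bar>) \<le> inverse (real (Suc n))" by blast
  from choice[OF this] obtain \<phi> where \<phi>: "\<And>n. aut (\<phi> n)"
    and c: "\<And>n. (LINT z|I2. \<bar>pull (\<phi> n) (V n) z - V' n z\<bar>) \<le> inverse (real (Suc n))" by blast
  have "(\<lambda>n. LINT z|I2. \<bar>pull (\<phi> n) (V n) z - V' n z\<bar>) \<longlonglongrightarrow> 0"
    by (rule tendsto_sandwich[OF always_eventually always_eventually tendsto_const LIMSEQ_inverse_real_of_nat])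
      (use c in auto)
  from LIMSEQ_subseq_LIMSEQ[OF this r]
  have close: "(\<lambda>n. LINT z|I2. \<bar>pull (\<phi> (r n)) (V (r n)) z - V' (r n) z\<bar>) \<longlonglongrightarrow> 0" by (simp add: comp_def)
  have "wconv (\<lambda>n. V' (r n)) X"
    using weak_star_iff_wconv[of "\<lambda>n. V' (r n)" "\<Gamma>' \<circ> r" X W] V' X w by simp
  then have "wconv (\<lambda>n. pull (\<phi> (r n)) (V (r n))) X"
    by (rule wconv_perturb[OF bgraphon_pull[OF bV aut_mpt[OF \<phi>]] bV' close])
  moreover have "bgraphon X" using X by (simp add: represents_def)
  ultimately show "X \<in> acc V"
    unfolding acc_def using r \<phi> by (intro CollectI conjI exI[of _ r] exI[of _ "\<lambda>n. \<phi> (r n)"]) blast+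
next
  assume "X \<in> acc V"
  then obtain r \<phi> where r: "strict_mono (r :: nat \<Rightarrow> nat)" and \<phi>: "\<And>n. aut (\<phi> n)"
    and w: "wconv (\<lambda>n. pull (\<phi> n) (V (r n))) X"
    unfolding acc_def by blast
  obtain \<Gamma>' where ver: "\<And>n. version_of (\<Gamma>' n) (\<Gamma> n)" and \<Gamma>': "\<And>n. \<Gamma>' (r n) = pull (\<phi> n) (V (r n))"
    using versions_along_subsequence[of \<Gamma> V r \<phi>, OF \<Gamma> V r \<phi>] by blast
  have "represents (pull (\<phi> n) (V (r n))) ((\<Gamma>' \<circ> r) n)" for n
    unfolding comp_def \<Gamma>' using V \<phi> by (intro represents_self bgraphon_pull aut_mpt) (simp_all add: represents_def)
  then have "weak_star_converges (\<Gamma>' \<circ> r) W"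
    using weak_star_iff_wconv[of "\<lambda>n. pull (\<phi> n) (V (r n))" "\<Gamma>' \<circ> r" X W] X w by blast
  then show "W \<in> ACC_weak_star \<Gamma>"
    unfolding ACC_weak_star_def weak_star_acc_point_def using W r ver by blast
qed

theorem theorem3:
  fixes f :: "real \<Rightarrow> real"
    and \<Gamma> :: "nat \<Rightarrow> real \<times> real \<Rightarrow> real"
  assumes f_cont: "continuous_on {0..1} f"
    and f_concave: "strictly_concave_on {0..1} f"
    and \<Gamma>_graphon: "\<And>n. graphon (\<Gamma> n)"
  shows "(\<forall>W \<in> ACC_weak_star \<Gamma>.
            \<not> (\<exists>\<Gamma>' r. (\<forall>n. version_of (\<Gamma>' n) (\<Gamma> n)) \<and> strict_mono r \<and>
                   (\<lambda>i. cut_norm (\<lambda>z. \<Gamma>' (r i) z - W z)) \<longlonglongrightarrow> 0) \<longrightarrow>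
            (\<exists>W' \<in> ACC_weak_star \<Gamma>. INT_f f W' < INT_f f W))
       \<and> (\<exists>k. strict_mono k \<and>
            (\<exists>Wmin. graphon Wmin \<and> Wmin \<in> ACC_weak_star (\<Gamma> \<circ> k) \<and>
               INT_f f Wmin = Inf {INT_f f W |W. W \<in> ACC_weak_star (\<Gamma> \<circ> k)}))"
proof -
  have sc: "strictly_concave_unit f" by unfold_locales (fact f_cont f_concave)+
  have "\<forall>n. \<exists>V. represents V (\<Gamma> n)" using graphon_represented[OF \<Gamma>_graphon] by blast
  from choice[OF this] obtain V where V: "\<And>n. represents (V n) (\<Gamma> n)" by blast
  have bV: "bgraphon (V n)" for n using V by (simp add: represents_def)
  show ?thesis
  proof (intro conjI ballI impI)
    fix W assume W: "W \<in> ACC_weak_star \<Gamma>"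
      and no: "\<not> (\<exists>\<Gamma>' r. (\<forall>n. version_of (\<Gamma>' n) (\<Gamma> n)) \<and> strict_mono r \<and>
                   (\<lambda>i. cut_norm (\<lambda>z. \<Gamma>' (r i) z - W z)) \<longlonglongrightarrow> 0)"
    have gW: "graphon W" using W by (simp add: ACC_weak_star_def)
    obtain X where X: "represents X W" using graphon_represented[OF gW] by blast
    then have bX: "bgraphon X" and aeX: "AE z in I2. W z = X z" by (simp_all add: represents_def)
    have "X \<in> acc V" using W ACC_iff_acc[of \<Gamma> V, OF \<Gamma>_graphon V gW X] by blast
    then obtain r \<phi> where r: "strict_mono (r :: nat \<Rightarrow> nat)" and \<phi>: "\<And>n. aut (\<phi> n)"
      and w: "wconv (\<lambda>n. pull (\<phi> n) (V (r n))) X"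
      unfolding acc_def by blast
    have bY: "bgraphon (pull (\<phi> n) (V (r n)))" for n by (intro bgraphon_pull bV aut_mpt \<phi>)
    \<comment> \<open>Otherwise, for every \<open>e\<close>, almost all of these rearrangements are
      within \<open>e\<close> of \<open>X\<close>, and extending them to versions at all indices
      gives the cut-norm convergence that is excluded.\<close>
    have "\<exists>e>0. infinite {n. \<not> cutle (\<lambda>z. pull (\<phi> n) (V (r n)) z - X z) e}"
    proof (rule ccontr)
      assume "\<not> ?thesis"
      then have fin: "finite {n. \<not> cutle (\<lambda>z. pull (\<phi> n) (V (r n)) z - X z) e}" if "e > 0" for e using that by blast
      obtain \<Gamma>' where ver: "\<And>n. version_of (\<Gamma>' n) (\<Gamma> n)" and \<Gamma>': "\<And>n. \<Gamma>' (r n) = pull (\<phi> n) (V (r n))"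
        using versions_along_subsequence[of \<Gamma> V r \<phi>, OF \<Gamma>_graphon V r \<phi>] by blast
      have "(\<lambda>i. cut_norm (\<lambda>z. \<Gamma>' (r i) z - W z)) \<longlonglongrightarrow> 0"
      proof (rule LIMSEQ_I)
        fix e :: real assume e: "e > 0"
        \<comment> \<open>Half of \<open>e\<close> leaves room for the strict inequality, since
          \<open>cut_norm_le\<close> gives a weak one.\<close>
        obtain N where N: "\<forall>n\<in>{n. \<not> cutle (\<lambda>z. pull (\<phi> n) (V (r n)) z - X z) (e / 2)}. n \<le> N"
          using fin[of "e / 2"] e unfolding finite_nat_set_iff_bounded_le by auto
        have "norm (cut_norm (\<lambda>z. \<Gamma>' (r n) z - W z) - 0) < e" if "n \<ge> Suc N" for n
        proof -
          have "cutle (\<lambda>z. pull (\<phi> n) (V (r n)) z - X z) (e / 2)" using N that by force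
          moreover have "AE z in I2. \<Gamma>' (r n) z - W z = pull (\<phi> n) (V (r n)) z - X z"
            using aeX by eventually_elim (simp add: \<Gamma>')
          moreover have "integrable I2 (\<lambda>z. pull (\<phi> n) (V (r n)) z - X z)"
            by (intro Bochner_Integration.integrable_diff bgraphon_integrable bY bX)
          ultimately have "\<bar>cut_norm (\<lambda>z. \<Gamma>' (r n) z - W z)\<bar> \<le> e / 2" by (intro cut_norm_le)
          then show ?thesis using e by simp
        qed
        then show "\<exists>no. \<forall>n\<ge>no. norm (cut_norm (\<lambda>z. \<Gamma>' (r n) z - W z) - 0) < e" by blast
      qed
      then show False using no ver r by blast
    qed
    then obtain e where e: "e > 0" and inf: "infinite {n. \<not> cutle (\<lambda>z. pull (\<phi> n) (V (r n)) z - X z) e}" by blast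
    from strictly_concave_unit.energy_drop[OF sc e] obtain \<delta> where d: "\<delta> > 0"
      and drop: "\<exists>s \<psi> W'. strict_mono (s :: nat \<Rightarrow> nat) \<and> (\<forall>n. aut (\<psi> n)) \<and> bgraphon W' \<and>
        wconv (\<lambda>n. pull (\<psi> n) (pull (\<phi> (s n)) (V (r (s n))))) W' \<and>
        (LINT z|I2. f (W' z)) \<le> (LINT z|I2. f (X z)) - \<delta>"
      using bY bX w inf by (elim exE conjE) (drule spec[of _ "\<lambda>n. pull (\<phi> n) (V (r n))"], drule spec[of _ X], blast)
    then obtain X' where X': "X' \<in> acc (\<lambda>n. pull (\<phi> n) (V (r n)))" and bX': "bgraphon X'"
      and le: "(LINT z|I2. f (X' z)) \<le> (LINT z|I2. f (X z)) - \<delta>"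
      unfolding acc_def by blast
    have "X' \<in> acc V" by (rule acc_trans[OF r \<phi> X'])
    then have "X' \<in> ACC_weak_star \<Gamma>"
      using ACC_iff_acc[of \<Gamma> V, OF \<Gamma>_graphon V bgraphon_graphon[OF bX'] represents_self[OF bX']] by blast
    moreover have "INT_f f X' < INT_f f W"
      using le d by (simp add: INT_f_represented[OF sc X] INT_f_represented[OF sc represents_self[OF bX']])
    ultimately show "\<exists>W' \<in> ACC_weak_star \<Gamma>. INT_f f W' < INT_f f W" by blast
  next
    obtain k X where k: "strict_mono (k :: nat \<Rightarrow> nat)" and X: "X \<in> acc (\<lambda>n. V (k n))"
      and min: "\<And>X'. X' \<in> acc (\<lambda>n. V (k n)) \<Longrightarrow> (LINT z|I2. f (X z)) \<le> (LINT z|I2. f (X' z))"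
      using strictly_concave_unit.minimizer_exists[OF sc, of V, OF bV] by blast
    have bX: "bgraphon X" using X by (simp add: acc_def)
    note gX = bgraphon_graphon[OF bX] and rX = represents_self[OF bX]
    have \<Gamma>k: "graphon ((\<Gamma> \<circ> k) n)" and Vk: "represents (V (k n)) ((\<Gamma> \<circ> k) n)" for n
      using \<Gamma>_graphon V by simp_all
    note iff = ACC_iff_acc[of "\<Gamma> \<circ> k" "\<lambda>n. V (k n)", OF \<Gamma>k Vk]
    have mem: "X \<in> ACC_weak_star (\<Gamma> \<circ> k)" using iff[OF gX rX] X by blast
    \<comment> \<open>The energy depends only on the representative, so the minimizer among Borel
      representatives attains the infimum over the whole set.\<close>
    have eq: "Inf {INT_f f W |W. W \<in> ACC_weak_star (\<Gamma> \<circ> k)} = INT_f f X"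
    proof (rule cInf_eq_minimum)
      fix a assume "a \<in> {INT_f f W |W. W \<in> ACC_weak_star (\<Gamma> \<circ> k)}"
      then obtain W where W: "W \<in> ACC_weak_star (\<Gamma> \<circ> k)" "a = INT_f f W" by blast
      then have gW: "graphon W" by (simp add: ACC_weak_star_def)
      obtain X' where X': "represents X' W" using graphon_represented[OF gW] by blast
      then have "X' \<in> acc (\<lambda>n. V (k n))" using iff[OF gW X'] W by blast
      then show "INT_f f X \<le> a"
        unfolding W(2) INT_f_represented[OF sc X'] INT_f_represented[OF sc rX] by (rule min)
    qed (use mem in blast)
    then show "\<exists>k. strict_mono k \<and>
            (\<exists>Wmin. graphon Wmin \<and> Wmin \<in> ACC_weak_star (\<Gamma> \<circ> k) \<and>
               INT_f f Wmin = Inf {INT_f f W |W. W \<in> ACC_weak_star (\<Gamma> \<circ> k)})"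
      by (intro exI[of _ k] exI[of _ X] conjI k gX mem eq[symmetric])
  qed
qed

end
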